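(* Let $(M,g)$ be a compact Riemannian manifold of dimension $m$ and let $(g,u,f,\sigma)$ be a gradient almost $(RH)_\alpha$ soliton on $M$ such that $\Delta\sigma\le 0$ on $M$. Set $S_{\min}:=\min_M S$, $\sigma_*:=\inf_M\sigma$ and $\sigma^*:=\sup_M\sigma$. Then: (i) if the soliton is steady, then $S_{\min}=0$; (ii) if the soliton is shrinking with $0<\sigma\le\sigma^*$, then $0\le S_{\min}\le m\sigma^*$; in particular $S\ge 0$; (iii) if the soliton is expanding with $\sigma_*\le\sigma<0$, then $m\sigma_*\le S_{\min}\le 0$; in particular $S\ge m\sigma$.
   Context: Let $(M,g)$ and $(N,h)$ be Riemannian manifolds, $m=\dim M$, and let $\alpha>0$ be a constant. A gradient almost $(RH)_\alpha$ soliton (gradient almost Ricci-harmonic soliton) is a quadruple $(g,u,f,\sigma)$ with $u:(M,g)\to(N,h)$ a smooth map and $f,\sigma:M\to\mathbb{R}$ smooth functions satisfying $$Rc-\alpha\,\nabla u\otimes\nabla u+\mathrm{Hess} f=\sigma g,\qquad \tau_g u-\langle\nabla u,\nabla f\rangle=0,$$ where $Rc$ is the Ricci tensor of $g$, $\nabla u\otimes\nabla u=u^*h$ is the pullback metric, $\tau_g u=\mathrm{trace}_g\nabla du$ is the tension field of $u$, and $\langle\nabla u,\nabla f\rangle=du(\nabla f)$. The soliton is shrinking, steady or expanding if $\sigma$ is respectively positive, identically zero, or negative on $M$. Write $|\nabla u|^2=\mathrm{trace}_g(u^*h)$, let $R$ be the scalar curvature of $g$, and set $S:=R-\alpha|\nabla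 u|^2$. $\Delta$ is the Laplace–Beltrami operator (trace of the Hessian). *)

theory Defs
  imports "HOL-Analysis.Analysis"
begin

text \<open>Intended for open \<open>S\<close>: all iterated directional derivatives up to order \<open>k\<close> exist
  and are continuous, those of order less than \<open>k\<close> being Frechet differentiable.\<close>

primrec C_k_on ::
  "nat \<Rightarrow> 'a::real_normed_vector set \<Rightarrow> ('a \<Rightarrow> 'b::real_normed_vector) \<Rightarrow> bool" where
  "C_k_on 0 S f \<longleftrightarrow> continuous_on S f"
| "C_k_on (Suc k) S f \<longleftrightarrow>
     (\<forall>x\<in>S. f differentiable (at x)) \<and>
     (\<forall>v. C_k_on k S (\<lambda>x. frechet_derivative f (at x) v))"

definition smooth_on ::
  "'a::real_normed_vector set \<Rightarrow> ('a \<Rightarrow> 'b::real_normed_vector) \<Rightarrow> bool" where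
  "smooth_on S f \<longleftrightarrow> (\<forall>k. C_k_on k S f)"

text \<open>A chart is a pair of its domain and its coordinate map. The values of the coordinate map
  outside the domain are irrelevant. The dimension of the manifold is \<open>CARD('m)\<close>.\<close>

type_synonym ('a, 'm) chart = "'a set \<times> ('a \<Rightarrow> real^'m)"

record ('a, 'm) manifold =
  mtop :: "'a topology"
  atlas :: "('a, 'm::finite) chart set"

abbreviation points :: "('a, 'm::finite) manifold \<Rightarrow> 'a set" where
  "points M \<equiv> topspace (mtop M)"

definition chart_inv :: "('a, 'm::finite) chart \<Rightarrow> real^'m \<Rightarrow> 'a" where
  "chart_inv c = inv_into (fst c) (snd c)"

definition is_chart :: "'a topology \<Rightarrow> ('a, 'm::finite) chart \<Rightarrow> bool" where
  "is_chart X c \<longleftrightarrow>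
     openin X (fst c) \<and> open (snd c ` fst c) \<and>
     homeomorphic_map (subtopology X (fst c)) (top_of_set (snd c ` fst c)) (snd c)"

definition smooth_manifold :: "('a, 'm::finite) manifold \<Rightarrow> bool" where
  "smooth_manifold M \<longleftrightarrow>
     Hausdorff_space (mtop M) \<and> second_countable (mtop M) \<and>
     (\<forall>c\<in>atlas M. is_chart (mtop M) c) \<and>
     (\<Union>c\<in>atlas M. fst c) = points M \<and>
     (\<forall>c\<in>atlas M. \<forall>d\<in>atlas M.
        smooth_on (snd c ` (fst c \<inter> fst d)) (snd d \<circ> chart_inv c))"

definition smooth_fun :: "('a, 'm::finite) manifold \<Rightarrow> ('a \<Rightarrow> real) \<Rightarrow> bool" where
  "smooth_fun M f \<longleftrightarrow> (\<forall>c\<in>atlas M. smooth_on (snd c ` fst c) (f \<circ> chart_inv c))"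

definition smooth_map ::
  "('a, 'm::finite) manifold \<Rightarrow> ('b, 'n::finite) manifold \<Rightarrow> ('a \<Rightarrow> 'b) \<Rightarrow> bool" where
  "smooth_map M N u \<longleftrightarrow>
     continuous_map (mtop M) (mtop N) u \<and>
     (\<forall>c\<in>atlas M. \<forall>d\<in>atlas N.
        smooth_on (snd c ` (fst c \<inter> u -` fst d)) (snd d \<circ> u \<circ> chart_inv c))"

text \<open>Scalars given by a coordinate expression that does not depend on the chart are turned into
  functions of the point by evaluating the expression in some chart around it.\<close>

definition chart_at :: "('a, 'm::finite) manifold \<Rightarrow> 'a \<Rightarrow> ('a, 'm) chart" where
  "chart_at M p = (SOME c. c \<in> atlas M \<and> p \<in> fst c)"

text \<open>A covariant 2-tensor field is given by its component matrix at each point of each chart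
  domain, subject to the transformation law under change of coordinates.\<close>

type_synonym ('a, 'm) tensor2 = "('a, 'm) chart \<Rightarrow> 'a \<Rightarrow> real^'m^'m"

definition riemannian_metric ::
  "('a, 'm::finite) manifold \<Rightarrow> ('a, 'm) tensor2 \<Rightarrow> bool" where
  "riemannian_metric M g \<longleftrightarrow>
     (\<forall>c\<in>atlas M.
        smooth_on (snd c ` fst c) (g c \<circ> chart_inv c) \<and>
        (\<forall>p\<in>fst c. transpose (g c p) = g c p \<and> (\<forall>v. v \<noteq> 0 \<longrightarrow> v \<bullet> (g c p *v v) > 0))) \<and>
     (\<forall>c\<in>atlas M. \<forall>d\<in>atlas M. \<forall>p\<in>fst c \<inter> fst d.
        let J = jacobian (snd d \<circ> chart_inv c) (at (snd c p))
        in g c p = transpose J ** g d p ** J)"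

definition riemannian_manifold ::
  "('a, 'm::finite) manifold \<Rightarrow> ('a, 'm) tensor2 \<Rightarrow> bool" where
  "riemannian_manifold M g \<longleftrightarrow> smooth_manifold M \<and> riemannian_metric M g"

text \<open>The coordinate derivative \<open>\<partial>\<^sub>i F\<close> in the chart \<open>c\<close>, again as a function of the point.\<close>

definition chart_deriv ::
  "('a, 'm::finite) chart \<Rightarrow> 'm \<Rightarrow> ('a \<Rightarrow> real) \<Rightarrow> 'a \<Rightarrow> real" where
  "chart_deriv c i F p = frechet_derivative (F \<circ> chart_inv c) (at (snd c p)) (axis i 1)"

definition metric_trace ::
  "('a, 'm::finite) tensor2 \<Rightarrow> ('a, 'm) chart \<Rightarrow> 'a \<Rightarrow> real^'m^'m \<Rightarrow> real" where
  "metric_trace g c p T = (\<Sum>i\<in>UNIV. \<Sum>j\<in>UNIV. matrix_inv (g c p) $ i $ j * T $ i $ j)"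

text \<open>\<open>christoffel g c k i j\<close> is \<open>\<Gamma>\<^sup>k\<^sub>i\<^sub>j\<close>.\<close>

definition christoffel ::
  "('a, 'm::finite) tensor2 \<Rightarrow> ('a, 'm) chart \<Rightarrow> 'm \<Rightarrow> 'm \<Rightarrow> 'm \<Rightarrow> 'a \<Rightarrow> real" where
  "christoffel g c k i j p =
     1/2 * (\<Sum>l\<in>UNIV. matrix_inv (g c p) $ k $ l *
              (chart_deriv c i (\<lambda>q. g c q $ j $ l) p
             + chart_deriv c j (\<lambda>q. g c q $ i $ l) p
             - chart_deriv c l (\<lambda>q. g c q $ i $ j) p))"

text \<open>\<open>riemann g c l k i j\<close> is the \<open>l\<close>-th component of
  \<open>R(\<partial>\<^sub>i, \<partial>\<^sub>j) \<partial>\<^sub>k = \<nabla>\<^sub>i \<nabla>\<^sub>j \<partial>\<^sub>k - \<nabla>\<^sub>j \<nabla>\<^sub>i \<partial>\<^sub>k\<close>, and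
  \<open>Rc(Y, Z)\<close> is the trace of \<open>X \<mapsto> R(X, Y) Z\<close>, so that round spheres have positive Ricci
  curvature.\<close>

definition riemann ::
  "('a, 'm::finite) tensor2 \<Rightarrow> ('a, 'm) chart \<Rightarrow> 'm \<Rightarrow> 'm \<Rightarrow> 'm \<Rightarrow> 'm \<Rightarrow> 'a \<Rightarrow> real" where
  "riemann g c l k i j p =
     chart_deriv c i (christoffel g c l j k) p - chart_deriv c j (christoffel g c l i k) p
     + (\<Sum>n\<in>UNIV. christoffel g c l i n p * christoffel g c n j k p
                 - christoffel g c l j n p * christoffel g c n i k p)"

definition ricci :: "('a, 'm::finite) tensor2 \<Rightarrow> ('a, 'm) tensor2" where
  "ricci g c p = (\<chi> j k. \<Sum>i\<in>UNIV. riemann g c i k i j p)"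

definition scalar_curvature ::
  "('a, 'm::finite) manifold \<Rightarrow> ('a, 'm) tensor2 \<Rightarrow> 'a \<Rightarrow> real" where
  "scalar_curvature M g p = (let c = chart_at M p in metric_trace g c p (ricci g c p))"

definition gradient ::
  "('a, 'm::finite) tensor2 \<Rightarrow> ('a, 'm) chart \<Rightarrow> ('a \<Rightarrow> real) \<Rightarrow> 'a \<Rightarrow> real^'m" where
  "gradient g c f p = matrix_inv (g c p) *v (\<chi> j. chart_deriv c j f p)"

definition hessian ::
  "('a, 'm::finite) tensor2 \<Rightarrow> ('a, 'm) chart \<Rightarrow> ('a \<Rightarrow> real) \<Rightarrow> 'a \<Rightarrow> real^'m^'m" where
  "hessian g c f p =
     (\<chi> i j. chart_deriv c i (chart_deriv c j f) p
            - (\<Sum>k\<in>UNIV. christoffel g c k i j p * chart_deriv c k f p))"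

definition laplacian ::
  "('a, 'm::finite) manifold \<Rightarrow> ('a, 'm) tensor2 \<Rightarrow> ('a \<Rightarrow> real) \<Rightarrow> 'a \<Rightarrow> real" where
  "laplacian M g f p = (let c = chart_at M p in metric_trace g c p (hessian g c f p))"

text \<open>Here \<open>c\<close> is a chart of the source around \<open>p\<close> and \<open>d\<close> a chart of the target around \<open>u p\<close>.\<close>

definition map_deriv ::
  "('a, 'm::finite) chart \<Rightarrow> ('b, 'n::finite) chart \<Rightarrow> ('a \<Rightarrow> 'b) \<Rightarrow> 'a \<Rightarrow> real^'m^'n" where
  "map_deriv c d u p = (\<chi> a i. chart_deriv c i (\<lambda>q. snd d (u q) $ a) p)"

definition pullback ::
  "('b, 'n::finite) tensor2 \<Rightarrow> ('a, 'm::finite) chart \<Rightarrow> ('b, 'n) chart \<Rightarrow> ('a \<Rightarrow> 'b) \<Rightarrow> 'a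
     \<Rightarrow> real^'m^'m" where
  "pullback h c d u p = transpose (map_deriv c d u p) ** h d (u p) ** map_deriv c d u p"

definition energy_density ::
  "('a, 'm::finite) manifold \<Rightarrow> ('a, 'm) tensor2 \<Rightarrow>
   ('b, 'n::finite) manifold \<Rightarrow> ('b, 'n) tensor2 \<Rightarrow> ('a \<Rightarrow> 'b) \<Rightarrow> 'a \<Rightarrow> real" where
  "energy_density M g N h u p =
     (let c = chart_at M p; d = chart_at N (u p) in metric_trace g c p (pullback h c d u p))"

text \<open>The \<open>a\<close>-th component of \<open>\<nabla>du\<close>, where \<open>\<nabla>\<close> is the connection on \<open>T\<^sup>*M \<otimes> u\<^sup>*TN\<close>
  induced by the two Levi-Civita connections.\<close>

definition second_fundamental_form ::
  "('a, 'm::finite) tensor2 \<Rightarrow> ('b, 'n::finite) tensor2 \<Rightarrow> ('a, 'm) chart \<Rightarrow> ('b, 'n) chart \<Rightarrow>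
   ('a \<Rightarrow> 'b) \<Rightarrow> 'n \<Rightarrow> 'a \<Rightarrow> real^'m^'m" where
  "second_fundamental_form g h c d u a p =
     (let U = map_deriv c d u p in
      \<chi> i j. chart_deriv c i (chart_deriv c j (\<lambda>q. snd d (u q) $ a)) p
            - (\<Sum>k\<in>UNIV. christoffel g c k i j p * U $ a $ k)
            + (\<Sum>b\<in>UNIV. \<Sum>e\<in>UNIV. christoffel h d a b e (u p) * U $ b $ i * U $ e $ j))"

definition tension ::
  "('a, 'm::finite) tensor2 \<Rightarrow> ('b, 'n::finite) tensor2 \<Rightarrow> ('a, 'm) chart \<Rightarrow> ('b, 'n) chart \<Rightarrow>
   ('a \<Rightarrow> 'b) \<Rightarrow> 'a \<Rightarrow> real^'n" where
  "tension g h c d u p = (\<chi> a. metric_trace g c p (second_fundamental_form g h c d u a p))"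

definition gradient_almost_RH_soliton ::
  "real \<Rightarrow> ('a, 'm::finite) manifold \<Rightarrow> ('b, 'n::finite) manifold \<Rightarrow> ('b, 'n) tensor2 \<Rightarrow>
   ('a, 'm) tensor2 \<Rightarrow> ('a \<Rightarrow> 'b) \<Rightarrow> ('a \<Rightarrow> real) \<Rightarrow> ('a \<Rightarrow> real) \<Rightarrow> bool" where
  "gradient_almost_RH_soliton \<alpha> M N h g u f \<sigma> \<longleftrightarrow>
     smooth_map M N u \<and> smooth_fun M f \<and> smooth_fun M \<sigma> \<and>
     (\<forall>c\<in>atlas M. \<forall>d\<in>atlas N. \<forall>p\<in>fst c. u p \<in> fst d \<longrightarrow>
        ricci g c p - \<alpha> *\<^sub>R pullback h c d u p + hessian g c f p = \<sigma> p *\<^sub>R g c p \<and>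
        tension g h c d u p - map_deriv c d u p *v gradient g c f p = 0)"

definition shrinking :: "('a, 'm::finite) manifold \<Rightarrow> ('a \<Rightarrow> real) \<Rightarrow> bool" where
  "shrinking M \<sigma> \<longleftrightarrow> (\<forall>p\<in>points M. \<sigma> p > 0)"

definition steady :: "('a, 'm::finite) manifold \<Rightarrow> ('a \<Rightarrow> real) \<Rightarrow> bool" where
  "steady M \<sigma> \<longleftrightarrow> (\<forall>p\<in>points M. \<sigma> p = 0)"

definition expanding :: "('a, 'm::finite) manifold \<Rightarrow> ('a \<Rightarrow> real) \<Rightarrow> bool" where
  "expanding M \<sigma> \<longleftrightarrow> (\<forall>p\<in>points M. \<sigma> p < 0)"

definition soliton_S ::
  "real \<Rightarrow> ('a, 'm::finite) manifold \<Rightarrow> ('b, 'n::finite) manifold \<Rightarrow> ('b, 'n) tensor2 \<Rightarrow>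
   ('a, 'm) tensor2 \<Rightarrow> ('a \<Rightarrow> 'b) \<Rightarrow> 'a \<Rightarrow> real" where
  "soliton_S \<alpha> M N h g u p = scalar_curvature M g p - \<alpha> * energy_density M g N h u p"

end

theory Submission
  imports Defs
begin

text \<open>A superharmonic function on a compact manifold is locally constant by the strong maximum
  principle, so near every point \<open>\<sigma>\<close> is a constant \<open>c\<close>. Write \<open>T = Rc - \<alpha> u\<^sup>*h = c g - Hess f\<close>; its
  trace is \<open>S = m c - \<Delta>f\<close>. The divergence of \<open>T\<close> is computed twice: from \<open>div Hess f = d(\<Delta>f) + Rc(\<nabla>f)\<close>, and
  from the contracted Bianchi identity together with \<open>div(u\<^sup>*h) = h(\<tau>, du) + d|du|\<^sup>2/2\<close>. Comparison gives
  \<open>dS = 2 T(\<nabla>f)\<close>, and a further divergence gives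
  \<open>\<Delta>S = \<langle>\<nabla>S, \<nabla>f\<rangle> - 2\<alpha>|\<tau>|\<^sup>2 + 2 c S - 2|T|\<^sup>2\<close>. Since \<open>|T|\<^sup>2 \<ge> S\<^sup>2/m\<close>, every local minimum of \<open>S\<close>
  satisfies \<open>S\<^sup>2 \<le> m c S\<close>, that is, \<open>S\<close> lies between \<open>0\<close> and \<open>m c\<close> there. The pointwise bound
  \<open>S \<ge> m \<sigma>\<close> follows at a minimum of \<open>S - m \<sigma>\<close>, which is a local minimum of \<open>S\<close>.\<close>

section \<open>Smooth functions\<close>

text \<open>For variable \<sigma> the two divergences would leave an extra term 2(m-1) d\<sigma> in
  dS; this is why local constancy is settled before any tensor computation. The manifold is not
  assumed connected, so the constant may change from component to component, and the minimum of S
  does not control S - m \<sigma>; hence two separate minimisations. The harmonic map equation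
  enters at one place: \<tau> = du(\<nabla>f) turns h(\<tau>, du) into u^*h(\<nabla>f), which
  combines with Rc(\<nabla>f) to T(\<nabla>f). At a minimum of S, \<alpha> > 0 gives the term in
  |\<tau>|^2 the favourable sign. Curvature and Hessian are given by chart components, and scalars
  through an arbitrarily chosen chart. The differential identities are therefore proved on open
  subsets of R^m for matrix-valued functions. The only scalar compared between charts is the
  Laplacian, since the traced soliton equation gives S = m \<sigma> - \<Delta>f. Transition maps are
  isometries, their second fundamental form vanishes, and so the Laplacians agree.\<close>

lemma frechet_derivative_eqI: "(f has_derivative f') (at x) \<Longrightarrow> frechet_derivative f (at x) = f'"
  using frechet_derivative_at by metis

lemma has_frechet_derivative:
  "f differentiable (at x) \<Longrightarrow> (f has_derivative (\<lambda>v. frechet_derivative f (at x) v)) (at x)"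
  by (simp add: frechet_derivative_works)

text \<open>On an open set the values determine the derivative at every point, so agreement passes
  down the recursion.\<close>

lemma C_k_on_cong:
  assumes "open S" "\<And>x. x \<in> S \<Longrightarrow> f x = g x" "C_k_on k S f"
  shows "C_k_on k S g"
  using assms(2,3)
proof (induction k arbitrary: f g)
  case 0
  then show ?case by (simp cong: continuous_on_cong)
next
  case (Suc k)
  have fd: "frechet_derivative f (at x) = frechet_derivative g (at x)" if "x \<in> S" for x
    using frechet_derivative_transform_within_open[of f x S g] Suc.prems assms(1) that by auto
  have "g differentiable (at x)" if "x \<in> S" for x
    using has_derivative_transform_within_open[OF has_frechet_derivative assms(1) that, of f g] Suc.prems that
    by (auto simp: differentiable_def)
  then show ?case
    using Suc.prems fd Suc.IH[of "\<lambda>x. frechet_derivative f (at x) v" "\<lambda>x. frechet_derivative g (at x) v" for v]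
    by auto
qed

lemma C_k_on_cont: "C_k_on k S f \<Longrightarrow> continuous_on S f"
  by (cases k) (auto intro!: differentiable_imp_continuous_on
      simp: differentiable_on_def differentiable_at_withinI)

lemma C_k_on_SucD: "C_k_on (Suc k) S f \<Longrightarrow> C_k_on k S f"
proof (induction k arbitrary: f)
  case 0
  then show ?case using C_k_on_cont by fastforce
next
  case (Suc k)
  then show ?case using C_k_on.simps(2) by blast
qed

lemma C_k_on_const: "C_k_on k S (\<lambda>x. c)"
  by (induction k arbitrary: c) auto

lemma C_k_on_id: "C_k_on k S (\<lambda>x. x)"
  by (cases k) (auto simp: C_k_on_const)

lemma C_k_on_add:
  assumes "open S" "C_k_on k S f" "C_k_on k S g"
  shows "C_k_on k S (\<lambda>x. f x + g x)"
  using assms(2,3)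
proof (induction k arbitrary: f g)
  case 0
  then show ?case by (simp add: continuous_on_add)
next
  case (Suc k)
  have "frechet_derivative (\<lambda>x. f x + g x) (at x) v
      = frechet_derivative f (at x) v + frechet_derivative g (at x) v" if "x \<in> S" for x v
    using that Suc.prems
    by (subst frechet_derivative_eqI[OF has_derivative_add[OF has_frechet_derivative has_frechet_derivative]]) auto
  moreover have "C_k_on k S (\<lambda>x. frechet_derivative f (at x) v + frechet_derivative g (at x) v)" for v
    using Suc by auto
  ultimately have "C_k_on k S (\<lambda>x. frechet_derivative (\<lambda>x. f x + g x) (at x) v)" for v
    using C_k_on_cong[OF assms(1)] by (metis (no_types, lifting))
  then show ?case
    using Suc.prems by (auto intro!: differentiable_add)
qed

lemma (in bounded_bilinear) frechet_derivative_prod: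
  assumes "f differentiable (at x)" "g differentiable (at x)"
  shows "frechet_derivative (\<lambda>x. prod (f x) (g x)) (at x)
       = (\<lambda>v. prod (f x) (frechet_derivative g (at x) v) + prod (frechet_derivative f (at x) v) (g x))"
  using frechet_derivative_eqI[OF FDERIV[OF has_frechet_derivative has_frechet_derivative]] assms by blast

text \<open>One Leibniz argument serves scalar, matrix, matrix-vector and inner products. The
  undifferentiated factor must itself be of class \<open>k\<close>, which \<open>C_k_on_SucD\<close>
  provides.\<close>

lemma (in bounded_bilinear) C_k_on_prod:
  assumes "open S" "C_k_on k S f" "C_k_on k S g"
  shows "C_k_on k S (\<lambda>x. prod (f x) (g x))"
  using assms(2,3)
proof (induction k arbitrary: f g)
  case 0
  then show ?case by (simp add: continuous_on)
next
  case (Suc k)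
  have "frechet_derivative (\<lambda>x. prod (f x) (g x)) (at x) v
      = prod (f x) (frechet_derivative g (at x) v) + prod (frechet_derivative f (at x) v) (g x)"
    if "x \<in> S" for x v
    using that Suc.prems frechet_derivative_prod[of f x g] by auto
  moreover have "C_k_on k S (\<lambda>x. prod (f x) (frechet_derivative g (at x) v)
      + prod (frechet_derivative f (at x) v) (g x))" for v
  proof (rule C_k_on_add[OF assms(1)])
    have fg: "C_k_on k S f" "C_k_on k S g"
      using Suc.prems C_k_on_SucD by blast+
    show "C_k_on k S (\<lambda>x. prod (f x) (frechet_derivative g (at x) v))"
      by (rule Suc.IH) (use fg Suc.prems in auto)
    show "C_k_on k S (\<lambda>x. prod (frechet_derivative f (at x) v) (g x))"
      by (rule Suc.IH) (use fg Suc.prems in auto)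
  qed
  ultimately have "C_k_on k S (\<lambda>x. frechet_derivative (\<lambda>x. prod (f x) (g x)) (at x) v)" for v
    using C_k_on_cong[OF assms(1)] by (metis (no_types, lifting))
  then show ?case
    using Suc.prems FDERIV[OF has_frechet_derivative has_frechet_derivative, of f _ g]
    by (auto simp: differentiable_def) blast
qed

lemma C_k_on_bounded_linear:
  assumes L: "bounded_linear L" and "open S" "C_k_on k S f"
  shows "C_k_on k S (\<lambda>x. L (f x))"
  using assms(3)
proof (induction k arbitrary: f)
  case 0
  then show ?case using L by (simp add: bounded_linear.continuous_on)
next
  case (Suc k)
  have "frechet_derivative (\<lambda>x. L (f x)) (at x) v = L (frechet_derivative f (at x) v)" if "x \<in> S" for x v
    using that Suc.prems
    by (subst frechet_derivative_eqI[OF bounded_linear.has_derivative[OF L has_frechet_derivative]]) auto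
  moreover have "C_k_on k S (\<lambda>x. L (frechet_derivative f (at x) v))" for v
    using Suc by auto
  ultimately have "C_k_on k S (\<lambda>x. frechet_derivative (\<lambda>x. L (f x)) (at x) v)" for v
    using C_k_on_cong[OF assms(2)] by (metis (no_types, lifting))
  then show ?case
    using Suc.prems bounded_linear.has_derivative[OF L has_frechet_derivative, of f]
    by (auto simp: differentiable_def) blast
qed

text \<open>A bootstrap: the derivative of 1/f is built from 1/f and the derivative of f, so
  regularity of 1/f at level \<open>k\<close> yields level \<open>k + 1\<close>.\<close>

lemma C_k_on_inverse:
  fixes f :: "'a::real_normed_vector \<Rightarrow> real"
  assumes "open S" "\<And>x. x \<in> S \<Longrightarrow> f x \<noteq> 0" "C_k_on k S f"
  shows "C_k_on k S (\<lambda>x. inverse (f x))"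
  using assms(3)
proof (induction k)
  case 0
  then show ?case by (simp add: assms(2) continuous_on_inverse)
next
  case (Suc k)
  have hd: "((\<lambda>x. inverse (f x)) has_derivative
      (\<lambda>v. - (inverse (f x) * frechet_derivative f (at x) v * inverse (f x)))) (at x)"
    if "x \<in> S" for x
    using Suc.prems assms(2)[OF that] that
    by (intro Deriv.has_derivative_inverse has_frechet_derivative) auto
  have inv: "C_k_on k S (\<lambda>x. inverse (f x))"
    using Suc C_k_on_SucD by blast
  have "C_k_on k S (\<lambda>x. - (inverse (f x) * frechet_derivative f (at x) v * inverse (f x)))" for v
    by (rule C_k_on_bounded_linear[OF bounded_linear_minus[OF bounded_linear_ident] assms(1)],
        rule bounded_bilinear.C_k_on_prod[OF bounded_bilinear_mult assms(1)
          bounded_bilinear.C_k_on_prod[OF bounded_bilinear_mult assms(1)]])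
      (use inv Suc.prems in auto)
  then have "C_k_on k S (\<lambda>x. frechet_derivative (\<lambda>x. inverse (f x)) (at x) v)" for v
    using C_k_on_cong[OF assms(1)] frechet_derivative_eqI[OF hd] by (metis (no_types, lifting))
  then show ?case
    using hd by (auto simp: differentiable_def)
qed

lemma smooth_on_cong:
  assumes "open S" "\<And>x. x \<in> S \<Longrightarrow> f x = g x" "smooth_on S f"
  shows "smooth_on S g"
  using assms C_k_on_cong unfolding smooth_on_def by metis

lemma smooth_on_subset:
  assumes "smooth_on S f" "T \<subseteq> S"
  shows "smooth_on T f"
proof -
  have "C_k_on k T f" if "C_k_on k S f" for k and f :: "'a \<Rightarrow> 'b"
    using that by (induction k arbitrary: f) (use assms(2) in \<open>auto intro: continuous_on_subset\<close>)
  then show ?thesis using assms unfolding smooth_on_def by blast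
qed

lemma smooth_on_differentiable: "smooth_on S f \<Longrightarrow> x \<in> S \<Longrightarrow> f differentiable (at x)"
  unfolding smooth_on_def using C_k_on.simps(2) by blast

lemma smooth_on_continuous: "smooth_on S f \<Longrightarrow> continuous_on S f"
  unfolding smooth_on_def using C_k_on.simps(1) by blast

lemma smooth_on_frechet_derivative:
  "smooth_on S f \<Longrightarrow> smooth_on S (\<lambda>x. frechet_derivative f (at x) v)"
  unfolding smooth_on_def using C_k_on.simps(2) by blast

lemma smooth_on_const: "smooth_on S (\<lambda>x. c)"
  by (simp add: smooth_on_def C_k_on_const)

lemma smooth_on_id: "smooth_on S (\<lambda>x. x)"
  by (simp add: smooth_on_def C_k_on_id)

lemma smooth_on_add: "open S \<Longrightarrow> smooth_on S f \<Longrightarrow> smooth_on S g \<Longrightarrow> smooth_on S (\<lambda>x. f x + g x)"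
  by (simp add: smooth_on_def C_k_on_add)

lemma smooth_on_bounded_linear:
  "bounded_linear L \<Longrightarrow> open S \<Longrightarrow> smooth_on S f \<Longrightarrow> smooth_on S (\<lambda>x. L (f x))"
  by (simp add: smooth_on_def C_k_on_bounded_linear)

lemma smooth_on_bilinear:
  "bounded_bilinear b \<Longrightarrow> open S \<Longrightarrow> smooth_on S f \<Longrightarrow> smooth_on S g \<Longrightarrow> smooth_on S (\<lambda>x. b (f x) (g x))"
  by (simp add: smooth_on_def bounded_bilinear.C_k_on_prod)

lemmas smooth_on_scaleR = smooth_on_bilinear[OF bounded_bilinear_scaleR]
lemmas smooth_on_mult = smooth_on_bilinear[OF bounded_bilinear_mult]
lemmas smooth_on_nth = smooth_on_bounded_linear[OF bounded_linear_vec_nth]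

lemma smooth_on_minus: "open S \<Longrightarrow> smooth_on S f \<Longrightarrow> smooth_on S (\<lambda>x. - f x)"
  by (rule smooth_on_bounded_linear[OF bounded_linear_minus[OF bounded_linear_ident]])

lemma smooth_on_diff: "open S \<Longrightarrow> smooth_on S f \<Longrightarrow> smooth_on S g \<Longrightarrow> smooth_on S (\<lambda>x. f x - g x)"
  using smooth_on_add[of S f "\<lambda>x. - g x"] smooth_on_minus by auto

lemma smooth_on_sum:
  assumes "open S" "\<And>i. i \<in> I \<Longrightarrow> smooth_on S (f i)"
  shows "smooth_on S (\<lambda>x. \<Sum>i\<in>I. f i x)"
  using assms(2) by (induction I rule: infinite_finite_induct) (auto simp: smooth_on_const intro!: smooth_on_add assms(1))

lemma smooth_on_prod:
  fixes f :: "'i \<Rightarrow> 'a::real_normed_vector \<Rightarrow> real"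
  assumes "open S" "\<And>i. i \<in> I \<Longrightarrow> smooth_on S (f i)"
  shows "smooth_on S (\<lambda>x. \<Prod>i\<in>I. f i x)"
  using assms(2) by (induction I rule: infinite_finite_induct) (auto simp: smooth_on_const intro!: smooth_on_mult assms(1))

lemma smooth_on_vecI:
  fixes f :: "'a::real_normed_vector \<Rightarrow> ('b::euclidean_space)^'n"
  assumes "open S" "\<And>i. smooth_on S (\<lambda>x. f x $ i)"
  shows "smooth_on S f"
proof -
  have bl: "bounded_linear (axis i :: 'b \<Rightarrow> 'b^'n)" for i
    by (simp add: linear_conv_bounded_linear[symmetric] linear_iff vec_eq_iff axis_def)
  have "f = (\<lambda>x. \<Sum>i\<in>UNIV. axis i (f x $ i))"
    by (auto simp: fun_eq_iff vec_eq_iff axis_def if_distrib cong: if_cong)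
  moreover have "smooth_on S (\<lambda>x. \<Sum>i\<in>UNIV. axis i (f x $ i))"
    by (intro smooth_on_sum assms smooth_on_bounded_linear[OF bl])
  ultimately show ?thesis by simp
qed

lemma smooth_on_inverse:
  fixes f :: "'a::real_normed_vector \<Rightarrow> real"
  shows "open S \<Longrightarrow> (\<And>x. x \<in> S \<Longrightarrow> f x \<noteq> 0) \<Longrightarrow> smooth_on S f \<Longrightarrow> smooth_on S (\<lambda>x. inverse (f x))"
  by (simp add: smooth_on_def C_k_on_inverse)

section \<open>Smoothness of matrix products, determinants and inverses\<close>

lemma bounded_bilinear_matrix_mult:
  "bounded_bilinear ((**) :: real^'m^'n \<Rightarrow> real^'k^'m \<Rightarrow> real^'k^'n)"
  by (rule bilinear_conv_bounded_bilinear[THEN iffD1])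
    (auto simp: bilinear_def linear_iff matrix_matrix_mult_def vec_eq_iff sum.distrib sum_distrib_left algebra_simps)

lemma bounded_bilinear_matrix_vector_mult:
  "bounded_bilinear ((*v) :: real^'m^'n \<Rightarrow> real^'m \<Rightarrow> real^'n)"
  by (rule bilinear_conv_bounded_bilinear[THEN iffD1])
    (auto simp: bilinear_def linear_iff matrix_vector_mult_def vec_eq_iff sum.distrib sum_distrib_left algebra_simps)

lemma bounded_linear_transpose: "bounded_linear (transpose :: real^'m^'n \<Rightarrow> real^'n^'m)"
  by (simp add: linear_conv_bounded_linear[symmetric] linear_iff transpose_def vec_eq_iff)

lemmas smooth_on_matrix_mult = smooth_on_bilinear[OF bounded_bilinear_matrix_mult]
lemmas smooth_on_matrix_vector_mult = smooth_on_bilinear[OF bounded_bilinear_matrix_vector_mult]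
lemmas smooth_on_transpose = smooth_on_bounded_linear[OF bounded_linear_transpose]

lemma matrix_inv_inverse:
  fixes A :: "real^'n^'n"
  assumes "invertible A"
  shows "A ** matrix_inv A = mat 1" "matrix_inv A ** A = mat 1"
  using someI_ex[OF assms[unfolded invertible_def]] unfolding matrix_inv_def by auto

text \<open>Cramer's rule exhibits the entries of the inverse as quotients of polynomials in the
  entries of \<open>A\<close>, which makes the inverse metric smooth.\<close>

lemma matrix_inv_cramer:
  fixes A :: "real^'n^'n"
  assumes "invertible A"
  shows "matrix_inv A $ k $ l =
    inverse (det A) * det (\<chi> i j. if j = k then axis l 1 $ i else A $ i $ j)"
proof -
  have d: "det A \<noteq> 0" using assms invertible_det_nz by blast
  have "A ** matrix_inv A = mat 1" using assms by (rule matrix_inv_inverse)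
  then have "A *v (matrix_inv A *v axis l 1) = axis l 1"
    by (simp add: matrix_vector_mul_assoc)
  then have "matrix_inv A *v axis l 1 = (\<chi> k. det (\<chi> i j. if j = k then axis l 1 $ i else A $ i $ j) / det A)"
    using cramer[OF d] by blast
  then have "(matrix_inv A *v axis l 1) $ k = det (\<chi> i j. if j = k then axis l 1 $ i else A $ i $ j) / det A"
    by simp
  then show ?thesis
    by (simp add: matrix_vector_mult_basis column_def field_simps)
qed

lemma smooth_on_det:
  fixes A :: "'a::real_normed_vector \<Rightarrow> real^'n^'n"
  assumes "open S" "\<And>i j. smooth_on S (\<lambda>x. A x $ i $ j)"
  shows "smooth_on S (\<lambda>x. det (A x))"
  unfolding det_def by (intro smooth_on_sum smooth_on_mult smooth_on_const smooth_on_prod assms)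

lemma smooth_on_matrix_inv:
  fixes A :: "'a::real_normed_vector \<Rightarrow> real^'n^'n"
  assumes "open S" "smooth_on S A" "\<And>x. x \<in> S \<Longrightarrow> invertible (A x)"
  shows "smooth_on S (\<lambda>x. matrix_inv (A x))"
proof (rule smooth_on_vecI[OF assms(1)], rule smooth_on_vecI[OF assms(1)])
  fix k l
  have comp: "smooth_on S (\<lambda>x. A x $ i $ j)" for i j
    by (intro smooth_on_nth assms)
  have entry: "smooth_on S (\<lambda>x. if j = k then axis l 1 $ i else A x $ i $ j)" for i j
    using comp by (cases "j = k") (auto intro: smooth_on_const)
  have "smooth_on S (\<lambda>x. inverse (det (A x)) * det (\<chi> i j. if j = k then axis l 1 $ i else A x $ i $ j))"
    by (intro smooth_on_mult smooth_on_inverse smooth_on_det assms(1) comp)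
      (use assms(3) invertible_det_nz entry in auto)
  then show "smooth_on S (\<lambda>x. matrix_inv (A x) $ k $ l)"
    by (rule smooth_on_cong[OF assms(1), rotated]) (simp add: matrix_inv_cramer assms(3))
qed

section \<open>Symmetry of second derivatives\<close>

lemma has_real_derivative_line:
  fixes F :: "'a::real_normed_vector \<Rightarrow> real"
  assumes "F differentiable (at (x + s *\<^sub>R u))"
  shows "((\<lambda>s. F (x + s *\<^sub>R u)) has_real_derivative frechet_derivative F (at (x + s *\<^sub>R u)) u) (at s)"
proof -
  have "((\<lambda>s. x + s *\<^sub>R u) has_derivative (\<lambda>h. h *\<^sub>R u)) (at s)"
    by (auto intro!: derivative_eq_intros)
  from has_derivative_compose[OF this has_frechet_derivative[OF assms]]
  have "((\<lambda>s. F (x + s *\<^sub>R u)) has_derivative (\<lambda>h. frechet_derivative F (at (x + s *\<^sub>R u)) (h *\<^sub>R u))) (at s)"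
    by simp
  moreover have "(\<lambda>h. frechet_derivative F (at (x + s *\<^sub>R u)) (h *\<^sub>R u)) = (*) (frechet_derivative F (at (x + s *\<^sub>R u)) u)"
    using linear_frechet_derivative[OF assms] by (auto simp: linear_cmul)
  ultimately show ?thesis by (simp add: has_field_derivative_def)
qed

text \<open>The mean value theorem is applied twice: along \<open>u\<close> to the difference of
  \<open>F\<close> across the displacement \<open>t v\<close>, then along \<open>v\<close> to the
  derivative so obtained.\<close>

lemma second_difference_mvt:
  fixes F :: "'a::real_normed_vector \<Rightarrow> real"
  assumes F: "smooth_on \<Omega> F" and t: "t > 0"
    and in\<Omega>: "\<And>a b. a \<in> {0..t} \<Longrightarrow> b \<in> {0..t} \<Longrightarrow> x + a *\<^sub>R u + b *\<^sub>R v \<in> \<Omega>"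
  shows "\<exists>a\<in>{0..t}. \<exists>b\<in>{0..t}.
    F (x + t *\<^sub>R u + t *\<^sub>R v) - F (x + t *\<^sub>R u) - F (x + t *\<^sub>R v) + F x
    = t * t * frechet_derivative (\<lambda>y. frechet_derivative F (at y) u) (at (x + a *\<^sub>R u + b *\<^sub>R v)) v"
proof -
  let ?D = "\<lambda>y. frechet_derivative F (at y) u"
  define \<phi> where "\<phi> = (\<lambda>s. F (x + t *\<^sub>R v + s *\<^sub>R u) - F (x + s *\<^sub>R u))"
  have d\<phi>: "(\<phi> has_real_derivative ?D (x + t *\<^sub>R v + s *\<^sub>R u) - ?D (x + s *\<^sub>R u)) (at s)"
    if "0 \<le> s" "s \<le> t" for s
    unfolding \<phi>_def
    by (intro DERIV_diff has_real_derivative_line smooth_on_differentiable[OF F])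
      (use in\<Omega>[of s t] in\<Omega>[of s 0] that t in \<open>auto simp: algebra_simps\<close>)
  have "\<exists>a>0. a < t \<and> \<phi> t - \<phi> 0 = (t - 0) * (?D (x + t *\<^sub>R v + a *\<^sub>R u) - ?D (x + a *\<^sub>R u))"
    by (rule MVT2[OF t d\<phi>])
  then obtain a where a: "0 < a" "a < t"
    "\<phi> t - \<phi> 0 = (t - 0) * (?D (x + t *\<^sub>R v + a *\<^sub>R u) - ?D (x + a *\<^sub>R u))"
    by (elim exE conjE) simp
  have d2: "((\<lambda>s. ?D (x + a *\<^sub>R u + s *\<^sub>R v)) has_real_derivative
      frechet_derivative ?D (at (x + a *\<^sub>R u + s *\<^sub>R v)) v) (at s)" if "0 \<le> s" "s \<le> t" for s
    by (intro has_real_derivative_line smooth_on_differentiable[OF smooth_on_frechet_derivative[OF F]])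
      (use in\<Omega>[of a s] that a in auto)
  have "\<exists>b>0. b < t \<and> ?D (x + a *\<^sub>R u + t *\<^sub>R v) - ?D (x + a *\<^sub>R u + 0 *\<^sub>R v)
     = (t - 0) * frechet_derivative ?D (at (x + a *\<^sub>R u + b *\<^sub>R v)) v"
    by (rule MVT2[OF t d2])
  then obtain b where b: "0 < b" "b < t" "?D (x + a *\<^sub>R u + t *\<^sub>R v) - ?D (x + a *\<^sub>R u + 0 *\<^sub>R v)
     = (t - 0) * frechet_derivative ?D (at (x + a *\<^sub>R u + b *\<^sub>R v)) v"
    by (elim exE conjE) simp
  have "\<phi> t - \<phi> 0 = F (x + t *\<^sub>R u + t *\<^sub>R v) - F (x + t *\<^sub>R u) - F (x + t *\<^sub>R v) + F x"
    unfolding \<phi>_def by (simp add: algebra_simps)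
  moreover have "x + t *\<^sub>R v + a *\<^sub>R u = x + a *\<^sub>R u + t *\<^sub>R v" by (simp add: algebra_simps)
  ultimately have "F (x + t *\<^sub>R u + t *\<^sub>R v) - F (x + t *\<^sub>R u) - F (x + t *\<^sub>R v) + F x
     = t * (t * frechet_derivative ?D (at (x + a *\<^sub>R u + b *\<^sub>R v)) v)"
    using a(3) b(3) by simp
  then show ?thesis using a(1,2) b(1,2) by (intro bexI[of _ a] bexI[of _ b]) (simp_all add: mult.assoc)
qed

text \<open>The second difference is symmetric in \<open>u\<close> and \<open>v\<close>, so the two
  mixed derivatives agree at some pair of points near \<open>x\<close>; continuity carries the
  equality to \<open>x\<close>. Values are real because the mean value theorem is used.\<close>

lemma frechet_derivative_commute_real:
  fixes F :: "'a::real_normed_vector \<Rightarrow> real"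
  assumes F: "smooth_on \<Omega> F" and "open \<Omega>" "x \<in> \<Omega>"
  shows "frechet_derivative (\<lambda>y. frechet_derivative F (at y) u) (at x) v
       = frechet_derivative (\<lambda>y. frechet_derivative F (at y) v) (at x) u"
proof (rule ccontr)
  let ?P = "\<lambda>y. frechet_derivative (\<lambda>y. frechet_derivative F (at y) u) (at y) v"
  let ?Q = "\<lambda>y. frechet_derivative (\<lambda>y. frechet_derivative F (at y) v) (at y) u"
  assume ne: "?P x \<noteq> ?Q x"
  define e where "e = \<bar>?P x - ?Q x\<bar> / 2"
  have e: "e > 0" using ne by (simp add: e_def)
  have cont: "isCont ?P x" "isCont ?Q x"
    using smooth_on_continuous[OF smooth_on_frechet_derivative[OF smooth_on_frechet_derivative[OF F]]]
      assms(2,3) by (simp_all add: continuous_on_eq_continuous_at)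
  have ed: "\<exists>d>0. \<forall>y. dist y x < d \<longrightarrow> dist (q y) (q x) < e" if "isCont q x" for q :: "'a \<Rightarrow> real"
    using that e by (simp add: continuous_at_eps_delta)
  obtain d1 where d1: "d1 > 0" "\<And>y. dist y x < d1 \<Longrightarrow> dist (?P y) (?P x) < e"
    using ed[OF cont(1)] by (elim exE conjE) simp
  obtain d2 where d2: "d2 > 0" "\<And>y. dist y x < d2 \<Longrightarrow> dist (?Q y) (?Q x) < e"
    using ed[OF cont(2)] by (elim exE conjE) simp
  obtain d3 where d3: "d3 > 0" "ball x d3 \<subseteq> \<Omega>" using assms(2,3) open_contains_ball by blast
  define d where "d = min d1 (min d2 d3)"
  have dpos: "d > 0" using d1(1) d2(1) d3 by (simp add: d_def)
  \<comment> \<open>Chosen so that the whole parallelogram with sides \<open>t u\<close> and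
    \<open>t v\<close> lies within distance d/2 of \<open>x\<close>; the summand 1 covers
    \<open>u = v = 0\<close>.\<close>
  define t where "t = d / (2 * (norm u + norm v + 1))"
  have t: "t > 0" using dpos by (auto simp: t_def intro!: divide_pos_pos add_nonneg_pos)
  have nuv: "norm u + norm v + 1 > 0" by (simp add: add_nonneg_pos)
  have close: "dist (x + a *\<^sub>R u + b *\<^sub>R v) x < d" if "a \<in> {0..t}" "b \<in> {0..t}" for a b
  proof -
    have "norm (a *\<^sub>R u + b *\<^sub>R v) \<le> a * norm u + b * norm v"
      using norm_triangle_ineq[of "a *\<^sub>R u" "b *\<^sub>R v"] that by simp
    also have "\<dots> \<le> t * norm u + t * norm v"
      using that by (intro add_mono mult_right_mono) auto
    also have "\<dots> \<le> t * (norm u + norm v + 1)" using t by (simp add: algebra_simps)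
    also have "\<dots> = d / 2" using nuv by (simp add: t_def field_simps)
    also have "\<dots> < d" using dpos by simp
    finally show ?thesis by (simp add: dist_norm add.assoc)
  qed
  have in\<Omega>: "x + a *\<^sub>R u + b *\<^sub>R v \<in> \<Omega>" if "a \<in> {0..t}" "b \<in> {0..t}" for a b
    using close[OF that] d3 by (auto simp: d_def mem_ball dist_commute)
  have in\<Omega>': "x + a *\<^sub>R v + b *\<^sub>R u \<in> \<Omega>" if "a \<in> {0..t}" "b \<in> {0..t}" for a b
    using in\<Omega>[OF that(2,1)] by (simp add: algebra_simps)
  obtain a b where ab: "a \<in> {0..t}" "b \<in> {0..t}"
    "F (x + t *\<^sub>R u + t *\<^sub>R v) - F (x + t *\<^sub>R u) - F (x + t *\<^sub>R v) + F x
     = t * t * ?P (x + a *\<^sub>R u + b *\<^sub>R v)"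
    using second_difference_mvt[OF F t, of x u v] in\<Omega> by auto
  obtain a' b' where ab': "a' \<in> {0..t}" "b' \<in> {0..t}"
    "F (x + t *\<^sub>R v + t *\<^sub>R u) - F (x + t *\<^sub>R v) - F (x + t *\<^sub>R u) + F x
     = t * t * ?Q (x + a' *\<^sub>R v + b' *\<^sub>R u)"
    using second_difference_mvt[OF F t, of x v u] in\<Omega>' by auto
  have "t * t * ?P (x + a *\<^sub>R u + b *\<^sub>R v) = t * t * ?Q (x + b' *\<^sub>R u + a' *\<^sub>R v)"
    using ab(3) ab'(3) by (simp add: algebra_simps)
  then have "?P (x + a *\<^sub>R u + b *\<^sub>R v) = ?Q (x + b' *\<^sub>R u + a' *\<^sub>R v)" using t by simp
  moreover have "dist (?P (x + a *\<^sub>R u + b *\<^sub>R v)) (?P x) < e"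
    by (rule d1(2)) (use close[OF ab(1,2)] in \<open>simp add: d_def\<close>)
  moreover have "dist (?Q (x + b' *\<^sub>R u + a' *\<^sub>R v)) (?Q x) < e"
    by (rule d2(2)) (use close[OF ab'(2,1)] in \<open>simp add: d_def\<close>)
  ultimately have "\<bar>?P x - ?Q x\<bar> < 2 * e" by (simp add: dist_real_def)
  then show False by (simp add: e_def)
qed

section \<open>Partial derivatives in coordinates\<close>

definition pd :: "'m::finite \<Rightarrow> (real^'m \<Rightarrow> 'b::real_normed_vector) \<Rightarrow> real^'m \<Rightarrow> 'b" where
  "pd i F x = frechet_derivative F (at x) (axis i 1)"

lemma frechet_derivative_cong_open:
  assumes "open S" "x \<in> S" "\<And>y. y \<in> S \<Longrightarrow> f y = g y"
  shows "frechet_derivative f (at x) = frechet_derivative g (at x)"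
proof -
  have "(f has_derivative f') (at x) \<longleftrightarrow> (g has_derivative f') (at x)" for f'
    using has_derivative_transform_within_open[OF _ assms(1,2), of f f' _ g]
      has_derivative_transform_within_open[OF _ assms(1,2), of g f' _ f] assms(3) by auto
  then show ?thesis by (simp add: frechet_derivative_def)
qed

text \<open>This licenses differentiating an identity that holds throughout an open set.\<close>

lemma pd_cong:
  assumes "open S" "x \<in> S" "\<And>y. y \<in> S \<Longrightarrow> f y = g y"
  shows "pd i f x = pd i g x"
  unfolding pd_def using frechet_derivative_cong_open[OF assms] by simp

lemma smooth_on_pd: "smooth_on S F \<Longrightarrow> smooth_on S (pd i F)"
  unfolding pd_def using smooth_on_frechet_derivative by blast

lemma pd_const: "pd i (\<lambda>x. c) x = 0"
  by (simp add: pd_def)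

lemma pd_add:
  assumes "f differentiable (at x)" "g differentiable (at x)"
  shows "pd i (\<lambda>x. f x + g x) x = pd i f x + pd i g x"
  unfolding pd_def
  by (subst frechet_derivative_eqI[OF has_derivative_add[OF has_frechet_derivative has_frechet_derivative]])
    (use assms in auto)

lemma pd_diff:
  assumes "f differentiable (at x)" "g differentiable (at x)"
  shows "pd i (\<lambda>x. f x - g x) x = pd i f x - pd i g x"
  unfolding pd_def
  by (subst frechet_derivative_eqI[OF has_derivative_diff[OF has_frechet_derivative has_frechet_derivative]])
    (use assms in auto)

lemma pd_sum:
  assumes "\<And>k. k \<in> I \<Longrightarrow> f k differentiable (at x)"
  shows "pd i (\<lambda>x. \<Sum>k\<in>I. f k x) x = (\<Sum>k\<in>I. pd i (f k) x)"
  unfolding pd_def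
  by (subst frechet_derivative_eqI[OF has_derivative_sum[OF has_frechet_derivative]])
    (use assms in auto)

lemma pd_linear:
  assumes "bounded_linear L" "f differentiable (at x)"
  shows "pd i (\<lambda>x. L (f x)) x = L (pd i f x)"
  unfolding pd_def
  by (subst frechet_derivative_eqI[OF bounded_linear.has_derivative[OF assms(1) has_frechet_derivative]])
    (use assms in auto)

lemma pd_bilinear:
  assumes "bounded_bilinear b" "f differentiable (at x)" "g differentiable (at x)"
  shows "pd i (\<lambda>x. b (f x) (g x)) x = b (f x) (pd i g x) + b (pd i f x) (g x)"
  unfolding pd_def
  by (subst bounded_bilinear.frechet_derivative_prod[OF assms]) simp

lemmas pd_scaleR = pd_bilinear[OF bounded_bilinear_scaleR]
lemmas pd_mult = pd_bilinear[OF bounded_bilinear_mult]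
lemmas pd_matrix_mult = pd_bilinear[OF bounded_bilinear_matrix_mult]
lemmas pd_matrix_vector_mult = pd_bilinear[OF bounded_bilinear_matrix_vector_mult]
lemmas pd_inner = pd_bilinear[OF bounded_bilinear_inner]
lemmas pd_transpose = pd_linear[OF bounded_linear_transpose]

lemma pd_nth: "f differentiable (at x) \<Longrightarrow> pd i f x $ k = pd i (\<lambda>x. f x $ k) x"
  using pd_linear[OF bounded_linear_vec_nth] by metis

lemma frechet_derivative_eq_sum_pd:
  assumes "F differentiable (at x)"
  shows "frechet_derivative F (at x) v = (\<Sum>i\<in>UNIV. (v $ i) *\<^sub>R pd i F x)"
proof -
  have "v = (\<Sum>i\<in>UNIV. (v $ i) *\<^sub>R axis i 1)"
    by (auto simp: vec_eq_iff axis_def if_distrib cong: if_cong)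
  then have "frechet_derivative F (at x) v = frechet_derivative F (at x) (\<Sum>i\<in>UNIV. (v $ i) *\<^sub>R axis i 1)"
    by simp
  then show ?thesis
    using linear_frechet_derivative[OF assms] by (simp add: pd_def linear_sum linear_cmul)
qed

lemma pd_chain:
  assumes "\<psi> differentiable (at x)" "F differentiable (at (\<psi> x))"
  shows "pd i (\<lambda>x. F (\<psi> x)) x = (\<Sum>e\<in>UNIV. (pd i \<psi> x $ e) *\<^sub>R pd e F (\<psi> x))"
proof -
  have "pd i (\<lambda>x. F (\<psi> x)) x = frechet_derivative F (at (\<psi> x)) (pd i \<psi> x)"
    using frechet_derivative_compose[OF assms] by (simp add: pd_def o_def)
  then show ?thesis by (simp add: frechet_derivative_eq_sum_pd[OF assms(2)])
qed

text \<open>Reduced to the real case by taking inner products with basis vectors, so that it also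
  covers matrix-valued functions.\<close>

lemma pd_commute:
  fixes F :: "real^'m \<Rightarrow> 'b::euclidean_space"
  assumes F: "smooth_on \<Omega> F" and \<Omega>: "open \<Omega>" "x \<in> \<Omega>"
  shows "pd i (pd j F) x = pd j (pd i F) x"
proof (rule euclidean_eqI)
  fix b :: 'b
  assume "b \<in> Basis"
  have bl: "bounded_linear (\<lambda>y::'b. y \<bullet> b)" by (rule bounded_linear_inner_left)
  have 1: "pd i (pd j F) x \<bullet> b = pd i (pd j (\<lambda>x. F x \<bullet> b)) x" for i j
  proof -
    have "pd i (pd j F) x \<bullet> b = pd i (\<lambda>x. pd j F x \<bullet> b) x"
      using pd_linear[OF bl smooth_on_differentiable[OF smooth_on_pd[OF F] \<Omega>(2)]] by simp
    also have "\<dots> = pd i (pd j (\<lambda>x. F x \<bullet> b)) x"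
      by (rule pd_cong[OF \<Omega>]) (simp add: pd_linear[OF bl smooth_on_differentiable[OF F]])
    finally show ?thesis .
  qed
  have "smooth_on \<Omega> (\<lambda>x. F x \<bullet> b)" by (rule smooth_on_bounded_linear[OF bl \<Omega>(1) F])
  from frechet_derivative_commute_real[OF this \<Omega>]
  show "pd i (pd j F) x \<bullet> b = pd j (pd i F) x \<bullet> b" unfolding 1 unfolding pd_def .
qed

text \<open>Restriction to lines through \<open>x\<close>: a negative second derivative along
  \<open>v\<close> would make the first derivative negative just to the right of 0, and the mean
  value theorem would then give a value below the minimum.\<close>

lemma local_min_pd:
  fixes s :: "real^'m \<Rightarrow> real"
  assumes s: "smooth_on \<Omega> s" and \<Omega>: "open \<Omega>" "x \<in> \<Omega>" and min: "\<And>y. y \<in> \<Omega> \<Longrightarrow> s x \<le> s y"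
  shows "pd i s x = 0" "(\<Sum>i\<in>UNIV. \<Sum>j\<in>UNIV. v $ i * v $ j * pd i (pd j s) x) \<ge> 0"
proof -
  obtain r where r: "r > 0" "ball x r \<subseteq> \<Omega>" using \<Omega> open_contains_ball by blast
  define D where "D v = (\<lambda>y. frechet_derivative s (at y) v)" for v
  have inb: "x + t *\<^sub>R v \<in> \<Omega>" if "\<bar>t\<bar> < r / (norm v + 1)" for t v
  proof -
    have p: "norm v + 1 > 0" by (simp add: add_nonneg_pos)
    have "\<bar>t\<bar> * norm v \<le> \<bar>t\<bar> * (norm v + 1)" by (simp add: mult_left_mono)
    also have "\<dots> < r" using that p by (simp add: field_simps)
    finally have "x + t *\<^sub>R v \<in> ball x r" by (simp add: dist_norm)
    then show ?thesis using r by blast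
  qed
  have rp: "r / (norm v + 1) > 0" for v :: "real^'m" using r by (simp add: add_nonneg_pos)
  have d1: "((\<lambda>t. s (x + t *\<^sub>R v)) has_real_derivative D v (x + t *\<^sub>R v)) (at t)"
    if "\<bar>t\<bar> < r / (norm v + 1)" for t v
    unfolding D_def by (intro has_real_derivative_line smooth_on_differentiable[OF s] inb that)
  have D0: "D v x = 0" for v
  proof -
    have "D v (x + 0 *\<^sub>R v) = 0"
      by (rule DERIV_local_min[where d = "r / (norm v + 1)", OF d1]) (use rp min inb in auto)
    then show ?thesis by simp
  qed
  then show "pd i s x = 0" by (simp add: pd_def D_def)
  have d2: "((\<lambda>t. D v (x + t *\<^sub>R v)) has_real_derivative frechet_derivative (D v) (at x) v) (at 0)"
    using has_real_derivative_line[of "D v" x 0 v] smooth_on_differentiable[OF smooth_on_frechet_derivative[OF s], of x v] \<Omega>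
    by (simp add: D_def)
  have nn: "frechet_derivative (D v) (at x) v \<ge> 0"
  proof (rule ccontr)
    assume "\<not> ?thesis"
    then obtain d where d: "d > 0" "\<And>h. 0 < h \<Longrightarrow> h < d \<Longrightarrow> D v (x + h *\<^sub>R v) < 0"
      using DERIV_neg_dec_right[OF d2] D0[of v] by auto
    obtain h where h: "h > 0" "h < d" "h < r / (norm v + 1)"
      using dense[of 0 "min d (r / (norm v + 1))"] d(1) rp[of v] by (metis min_less_iff_conj)
    have "\<exists>z>0. z < h \<and> s (x + h *\<^sub>R v) - s (x + 0 *\<^sub>R v) = (h - 0) * D v (x + z *\<^sub>R v)"
      by (rule MVT2[OF h(1) d1]) (use h in auto)
    then obtain z where z: "z > 0" "z < h" "s (x + h *\<^sub>R v) - s (x + 0 *\<^sub>R v) = (h - 0) * D v (x + z *\<^sub>R v)"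
      by (elim exE conjE) simp
    then have "s (x + h *\<^sub>R v) < s x"
      using d(2)[of z] h mult_pos_neg[of h "D v (x + z *\<^sub>R v)"] by simp
    moreover have "s x \<le> s (x + h *\<^sub>R v)" using h by (intro min inb) auto
    ultimately show False by simp
  qed
  have Dv: "D v y = (\<Sum>j\<in>UNIV. v $ j * pd j s y)" if "y \<in> \<Omega>" for y
    unfolding D_def using frechet_derivative_eq_sum_pd[OF smooth_on_differentiable[OF s that]] by simp
  have "frechet_derivative (D v) (at x) v = (\<Sum>i\<in>UNIV. v $ i * pd i (D v) x)"
    using frechet_derivative_eq_sum_pd[OF smooth_on_differentiable[OF smooth_on_frechet_derivative[OF s], of x v]] \<Omega>
    by (simp add: D_def)
  also have "\<dots> = (\<Sum>i\<in>UNIV. v $ i * (\<Sum>j\<in>UNIV. v $ j * pd i (pd j s) x))"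
  proof (intro sum.cong refl arg_cong2[where f = "(*)"])
    fix i
    have dj: "pd j s differentiable (at x)" for j
      by (rule smooth_on_differentiable[OF smooth_on_pd[OF s] \<Omega>(2)])
    have "pd i (D v) x = pd i (\<lambda>y. \<Sum>j\<in>UNIV. v $ j * pd j s y) x"
      by (rule pd_cong[OF \<Omega> Dv])
    also have "\<dots> = (\<Sum>j\<in>UNIV. pd i (\<lambda>y. v $ j * pd j s y) x)"
      using dj by (intro pd_sum) auto
    also have "\<dots> = (\<Sum>j\<in>UNIV. v $ j * pd i (pd j s) x)"
      using dj by (simp add: pd_linear[OF bounded_linear_mult_right])
    finally show "pd i (D v) x = (\<Sum>j\<in>UNIV. v $ j * pd i (pd j s) x)" .
  qed
  also have "\<dots> = (\<Sum>i\<in>UNIV. \<Sum>j\<in>UNIV. v $ i * v $ j * pd i (pd j s) x)"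
    by (simp add: sum_distrib_left mult.assoc)
  finally show "(\<Sum>i\<in>UNIV. \<Sum>j\<in>UNIV. v $ i * v $ j * pd i (pd j s) x) \<ge> 0" using nn by simp
qed

section \<open>Positive definite matrices\<close>

lemma matrix_mult_diff_left: "(A - B) ** (C :: real^'k^'m) = A ** C - B ** C"
  by (simp add: matrix_matrix_mult_def vec_eq_iff sum_subtractf left_diff_distrib)

lemma matrix_mult_diff_right: "(C :: real^'k^'m) ** (A - B) = C ** A - C ** B"
  by (simp add: matrix_matrix_mult_def vec_eq_iff sum_subtractf right_diff_distrib)

lemma matrix_mult_add_left: "(A + B) ** (C :: real^'k^'m) = A ** C + B ** C"
  by (simp add: matrix_matrix_mult_def vec_eq_iff sum.distrib distrib_right)

lemma matrix_mult_minus_left: "(- A) ** (C :: real^'k^'m) = - (A ** C)"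
  by (simp add: matrix_matrix_mult_def vec_eq_iff sum_negf)

lemma matrix_mult_minus_right: "(C :: real^'k^'m) ** (- A) = - (C ** A)"
  by (simp add: matrix_matrix_mult_def vec_eq_iff sum_negf)

lemma matrix_mult_0: "(0 :: real^'m^'n) ** A = 0" "A ** (0 :: real^'m^'n) = 0"
  by (simp_all add: matrix_matrix_mult_def vec_eq_iff)

lemma matrix_mult_sum_left: "(\<Sum>i\<in>I. f i) ** (C :: real^'k^'m) = (\<Sum>i\<in>I. f i ** C)"
  by (induction I rule: infinite_finite_induct) (auto simp: matrix_mult_add_left matrix_mult_0)

lemma matrix_mult_sum_right: "(C :: real^'k^'m) ** (\<Sum>i\<in>I. f i) = (\<Sum>i\<in>I. C ** f i)"
  by (induction I rule: infinite_finite_induct) (auto simp: matrix_add_ldistrib matrix_mult_0)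

lemma matrix_mult_scaleR: "(a *\<^sub>R A) ** (B :: real^'k^'m) = a *\<^sub>R (A ** B)"
    "A ** (a *\<^sub>R (B :: real^'k^'m)) = a *\<^sub>R (A ** B)"
  by (simp_all add: matrix_matrix_mult_def vec_eq_iff sum_distrib_left algebra_simps)

lemma transpose_linear:
  "transpose (A + B) = transpose A + transpose (B :: real^'m^'n)"
  "transpose (A - B) = transpose A - transpose (B :: real^'m^'n)"
  "transpose (- A) = - transpose (A :: real^'m^'n)"
  "transpose (0 :: real^'m^'n) = 0"
  by (simp_all add: transpose_def vec_eq_iff)

lemma transpose_sum: "transpose (\<Sum>i\<in>I. f i) = (\<Sum>i\<in>I. transpose (f i :: real^'m^'n))"
  by (induction I rule: infinite_finite_induct) (auto simp: transpose_linear)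

lemmas matrix_ring = matrix_mul_assoc matrix_add_ldistrib matrix_mult_add_left matrix_mult_diff_left
  matrix_mult_diff_right matrix_mult_minus_left matrix_mult_minus_right matrix_transpose_mul
  transpose_linear matrix_mult_0

lemma matrix_mult_nth: "(A ** B) $ i $ j = (\<Sum>k\<in>UNIV. A $ i $ k * B $ k $ j)"
  by (simp add: matrix_matrix_mult_def)

lemma matrix_vector_mult_nth: "(A *v x) $ i = (\<Sum>k\<in>UNIV. A $ i $ k * x $ k)"
  by (simp add: matrix_vector_mult_def)

lemma transpose_nth: "transpose A $ i $ j = A $ j $ i"
  by (simp add: transpose_def)

lemma inner_matrix: "(A :: real^'m^'n) \<bullet> B = (\<Sum>i\<in>UNIV. \<Sum>j\<in>UNIV. A $ i $ j * B $ i $ j)"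
  by (simp add: inner_vec_def)

text \<open>The inner product of matrices is the Frobenius product, so a metric trace is
  \<open>G \<bullet> T\<close>. This rule and \<open>inner_matrix_mult_left\<close> move factors
  across it, in the role of cyclicity of the trace.\<close>

lemma inner_matrix_mult_right: "(A ** B) \<bullet> (C :: real^'m^'n) = A \<bullet> (C ** transpose B)"
proof -
  have "(A ** B) \<bullet> C = (\<Sum>i\<in>UNIV. \<Sum>j\<in>UNIV. \<Sum>k\<in>UNIV. A $ i $ k * B $ k $ j * C $ i $ j)"
    by (simp add: inner_matrix matrix_mult_nth sum_distrib_right)
  also have "\<dots> = (\<Sum>i\<in>UNIV. \<Sum>k\<in>UNIV. \<Sum>j\<in>UNIV. A $ i $ k * B $ k $ j * C $ i $ j)"
    by (intro sum.cong refl sum.swap)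
  also have "\<dots> = A \<bullet> (C ** transpose B)"
    by (simp add: inner_matrix matrix_mult_nth sum_distrib_left transpose_nth algebra_simps)
  finally show ?thesis .
qed

lemma inner_transpose: "transpose A \<bullet> transpose B = (A :: real^'m^'n) \<bullet> B"
  unfolding inner_matrix transpose_nth by (rule sum.swap)

lemma inner_matrix_mult_left: "(A ** B) \<bullet> (C :: real^'m^'n) = B \<bullet> (transpose A ** C)"
proof -
  have "(A ** B) \<bullet> C = (transpose B ** transpose A) \<bullet> transpose C"
    by (metis inner_transpose matrix_transpose_mul)
  also have "\<dots> = transpose B \<bullet> transpose (transpose A ** C)"
    by (simp add: inner_matrix_mult_right matrix_transpose_mul)
  finally show ?thesis by (simp add: inner_transpose)
qed

lemma inner_transpose_matrix_vector: "x \<bullet> (transpose A *v y) = (A *v x) \<bullet> (y :: real^'n)"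
  by (metis dot_lmul_matrix inner_commute transpose_matrix_vector)

definition pos_def :: "real^'m^'m \<Rightarrow> bool" where
  "pos_def A \<longleftrightarrow> transpose A = A \<and> (\<forall>v. v \<noteq> 0 \<longrightarrow> v \<bullet> (A *v v) > 0)"

lemma pos_def_invertible: "pos_def A \<Longrightarrow> invertible A"
  unfolding invertible_left_inverse matrix_left_invertible_ker pos_def_def
  by (metis inner_zero_right less_irrefl)

lemma pos_def_nonneg: "pos_def A \<Longrightarrow> v \<bullet> (A *v v) \<ge> 0"
  unfolding pos_def_def by (cases "v = 0") (auto intro: less_imp_le)

lemma pos_def_inv:
  assumes "pos_def (A :: real^'m^'m)"
  shows "pos_def (matrix_inv A)"
proof -
  let ?G = "matrix_inv A"
  note inv = matrix_inv_inverse[OF pos_def_invertible[OF assms]]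
  have sym: "transpose ?G = ?G"
  proof -
    have "transpose ?G ** A = mat 1"
      using arg_cong[OF inv(1), of transpose] assms by (simp add: matrix_transpose_mul pos_def_def)
    then show ?thesis using inv by (metis matrix_mul_assoc matrix_mul_lid matrix_mul_rid)
  qed
  have "v \<bullet> (?G *v v) > 0" if "v \<noteq> 0" for v
  proof -
    have v: "A *v (?G *v v) = v" by (simp add: matrix_vector_mul_assoc inv)
    then have "?G *v v \<noteq> 0" using that by auto
    then have "(?G *v v) \<bullet> (A *v (?G *v v)) > 0" using assms by (auto simp: pos_def_def)
    then show ?thesis using v by (simp add: inner_commute)
  qed
  then show ?thesis using sym by (simp add: pos_def_def)
qed

text \<open>Lagrange reduction: completing the square in one index after the other.\<close>

lemma quadratic_form_sum_of_squares:
  fixes Q :: "'m::finite \<Rightarrow> 'm \<Rightarrow> real"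
  assumes "finite I" "\<And>i j. Q i j = Q j i" "\<And>i j. i \<notin> I \<Longrightarrow> Q i j = 0"
    "\<And>x. (\<exists>i\<in>I. x i \<noteq> 0) \<Longrightarrow> (\<Sum>i\<in>I. \<Sum>j\<in>I. x i * x j * Q i j) > 0"
  shows "\<exists>E. \<forall>i j. Q i j = (\<Sum>k\<in>I. E i k * E j k)"
  using assms
proof (induction I arbitrary: Q rule: finite_induct)
  case empty
  then show ?case by auto
next
  case (insert k I)
  define q where "q = Q k k"
  have q: "q > 0"
  proof -
    define x where "x = (\<lambda>i. if i = k then 1 else 0 :: real)"
    have z: "x i = 0" if "i \<in> I" for i using that insert.hyps by (auto simp: x_def)
    have xk: "x k = 1" by (simp add: x_def)
    have "(\<Sum>i\<in>insert k I. \<Sum>j\<in>insert k I. x i * x j * Q i j) = q"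
      using insert.hyps by (simp add: q_def z xk)
    then show ?thesis using insert.prems(3)[of x] xk by simp
  qed
  \<comment> \<open>The Schur complement: what remains of the form after the square in the variable
    \<open>k\<close> is split off.\<close>
  define Q' where "Q' i j = Q i j - Q i k * Q j k / q" for i j
  have "\<exists>E. \<forall>i j. Q' i j = (\<Sum>l\<in>I. E i l * E j l)"
  proof (rule insert.IH)
    show "Q' i j = Q' j i" for i j using insert.prems(1)[of i j] by (simp add: Q'_def)
    show "Q' i j = 0" if "i \<notin> I" for i j
    proof (cases "i = k")
      case True
      then show ?thesis using q insert.prems(1)[of j k] by (simp add: Q'_def q_def)
    next
      case False
      then show ?thesis using insert.prems(2)[of i] that by (simp add: Q'_def)
    qed
    fix x :: "'m \<Rightarrow> real"
    assume "\<exists>i\<in>I. x i \<noteq> 0"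
    define b where "b = (\<Sum>i\<in>I. x i * Q i k)"
    \<comment> \<open>The value -b/q minimises the form in the variable \<open>k\<close>, so
      inserting it into \<open>Q\<close> leaves exactly \<open>Q'\<close> evaluated at
      \<open>x\<close>.\<close>
    define y where "y = x(k := - b / q)"
    have yI: "y i = x i" if "i \<in> I" for i using that insert.hyps by (auto simp: y_def)
    have "\<exists>i\<in>insert k I. y i \<noteq> 0" using \<open>\<exists>i\<in>I. x i \<noteq> 0\<close> yI by force
    then have pos: "(\<Sum>i\<in>insert k I. \<Sum>j\<in>insert k I. y i * y j * Q i j) > 0" by (rule insert.prems(3))
    have "(\<Sum>j\<in>I. y k * x j * Q k j) = y k * b"
      using insert.prems(1) by (simp add: b_def sum_distrib_left mult.assoc)
    moreover have "(\<Sum>i\<in>I. x i * y k * Q i k) = y k * b"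
      by (simp add: b_def sum_distrib_left mult_ac)
    ultimately have "(\<Sum>i\<in>insert k I. \<Sum>j\<in>insert k I. y i * y j * Q i j)
        = y k * y k * q + 2 * (y k * b) + (\<Sum>i\<in>I. \<Sum>j\<in>I. x i * x j * Q i j)"
      using insert.hyps by (simp add: sum.distrib yI q_def)
    also have "\<dots> = (\<Sum>i\<in>I. \<Sum>j\<in>I. x i * x j * Q i j) - b * b / q"
      using q by (simp add: y_def field_simps)
    also have "b * b / q = (\<Sum>i\<in>I. \<Sum>j\<in>I. x i * x j * (Q i k * Q j k / q))"
      by (simp add: b_def sum_product sum_divide_distrib algebra_simps)
    also have "(\<Sum>i\<in>I. \<Sum>j\<in>I. x i * x j * Q i j) - \<dots> = (\<Sum>i\<in>I. \<Sum>j\<in>I. x i * x j * Q' i j)"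
      by (simp add: Q'_def sum_subtractf[symmetric] right_diff_distrib)
    finally show "(\<Sum>i\<in>I. \<Sum>j\<in>I. x i * x j * Q' i j) > 0" using pos by simp
  qed
  then obtain E where E: "\<And>i j. Q' i j = (\<Sum>l\<in>I. E i l * E j l)" by blast
  define E' where "E' i l = (if l = k then Q i k / sqrt q else E i l)" for i l
  have "Q i j = (\<Sum>l\<in>insert k I. E' i l * E' j l)" for i j
  proof -
    have "(\<Sum>l\<in>I. E' i l * E' j l) = Q' i j"
      unfolding E by (rule sum.cong) (use insert.hyps in \<open>auto simp: E'_def\<close>)
    then show ?thesis using insert.hyps q by (simp add: E'_def Q'_def)
  qed
  then show ?case by blast
qed

text \<open>When \<open>A\<close> is the inverse of a metric, the columns of \<open>E\<close> are an
  orthonormal frame for that metric.\<close>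

lemma pos_def_factor:
  assumes "pos_def (A :: real^'m^'m)"
  shows "\<exists>E :: real^'m^'m. A = E ** transpose E"
proof -
  have sym: "A $ i $ j = A $ j $ i" for i j
    using assms by (metis pos_def_def transpose_nth)
  have pos: "(\<Sum>i\<in>UNIV. \<Sum>j\<in>UNIV. x i * x j * A $ i $ j) > 0" if "\<exists>i\<in>UNIV. x i \<noteq> 0" for x
  proof -
    have "(\<chi> i. x i) \<noteq> 0" using that by (auto simp: vec_eq_iff)
    then have "(\<chi> i. x i) \<bullet> (A *v (\<chi> i. x i)) > 0" using assms by (auto simp: pos_def_def)
    then show ?thesis
      by (simp add: inner_vec_def matrix_vector_mult_nth sum_distrib_left algebra_simps)
  qed
  have "\<exists>E :: 'm \<Rightarrow> 'm \<Rightarrow> real. \<forall>i j. A $ i $ j = (\<Sum>k\<in>UNIV. E i k * E j k)"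
    by (rule quadratic_form_sum_of_squares[where I = UNIV and Q = "\<lambda>i j. A $ i $ j"])
      (use pos sym in auto)
  then obtain E :: "'m \<Rightarrow> 'm \<Rightarrow> real" where "\<forall>i j. A $ i $ j = (\<Sum>k\<in>UNIV. E i k * E j k)" ..
  then have "A = (\<chi> i k. E i k) ** transpose (\<chi> i k. E i k)"
    by (simp add: vec_eq_iff matrix_mult_nth transpose_nth)
  then show ?thesis by blast
qed

text \<open>With \<open>A = E ** transpose E\<close> the product is the sum of the quadratic form of
  \<open>H\<close> over the columns of \<open>E\<close>.\<close>

lemma pos_def_inner_nonneg:
  assumes "pos_def (A :: real^'m^'m)" "\<And>v. (\<Sum>i\<in>UNIV. \<Sum>j\<in>UNIV. v $ i * v $ j * H $ i $ j) \<ge> 0"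
  shows "A \<bullet> H \<ge> 0"
proof -
  obtain E :: "real^'m^'m" where E: "A = E ** transpose E" using pos_def_factor[OF assms(1)] by blast
  have "A \<bullet> H = (\<Sum>i\<in>UNIV. \<Sum>j\<in>UNIV. \<Sum>k\<in>UNIV. E $ i $ k * E $ j $ k * H $ i $ j)"
    by (simp add: E inner_matrix matrix_mult_nth transpose_nth sum_distrib_right)
  also have "\<dots> = (\<Sum>i\<in>UNIV. \<Sum>k\<in>UNIV. \<Sum>j\<in>UNIV. E $ i $ k * E $ j $ k * H $ i $ j)"
    by (intro sum.cong refl sum.swap)
  also have "\<dots> = (\<Sum>k\<in>UNIV. \<Sum>i\<in>UNIV. \<Sum>j\<in>UNIV. E $ i $ k * E $ j $ k * H $ i $ j)"
    by (rule sum.swap)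
  also have "\<dots> \<ge> 0"
  proof (rule sum_nonneg)
    show "(\<Sum>i\<in>UNIV. \<Sum>j\<in>UNIV. E $ i $ k * E $ j $ k * H $ i $ j) \<ge> 0" for k
      using assms(2)[of "\<chi> i. E $ i $ k"] by simp
  qed
  finally show ?thesis .
qed

text \<open>In an orthonormal frame this is \<open>(tr T)\<^sup>2 \<le> m |T|\<^sup>2\<close>.\<close>

lemma trace_squared_le:
  fixes A T :: "real^'m^'m"
  assumes "pos_def A" "transpose T = T"
  shows "(A \<bullet> T)\<^sup>2 \<le> real CARD('m) * (A \<bullet> (T ** A ** T))"
proof -
  obtain E :: "real^'m^'m" where E: "A = E ** transpose E" using pos_def_factor[OF assms(1)] by blast
  \<comment> \<open>The components of \<open>T\<close> in the frame \<open>E\<close>. The trace is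
    then the product with the identity matrix, and Cauchy-Schwarz against it produces the factor
    m.\<close>
  define W where "W = transpose E ** T ** E"
  have W: "mat 1 \<bullet> W = A \<bullet> T"
    unfolding E W_def
    by (metis inner_commute inner_matrix_mult_left inner_matrix_mult_right matrix_mul_lid matrix_mul_rid transpose_transpose)
  have WW: "W \<bullet> W = A \<bullet> (T ** A ** T)"
  proof -
    have "A \<bullet> (T ** A ** T) = E \<bullet> (T ** E ** W)"
      by (simp add: E W_def inner_matrix_mult_right matrix_mul_assoc)
    also have "\<dots> = (T ** E ** W) \<bullet> E" by (rule inner_commute)
    also have "\<dots> = W \<bullet> W"
      by (simp add: inner_matrix_mult_left W_def matrix_transpose_mul assms(2) matrix_mul_assoc)
    finally show ?thesis by simp
  qed
  have "(mat 1 \<bullet> W)\<^sup>2 \<le> (mat 1 \<bullet> (mat 1 :: real^'m^'m)) * (W \<bullet> W)"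
    using Cauchy_Schwarz_ineq[of "mat 1 :: real^'m^'m" W] by (simp only: power2_eq_square)
  moreover have "mat 1 \<bullet> (mat 1 :: real^'m^'m) = real CARD('m)"
    by (simp add: inner_matrix mat_def if_distrib[of "\<lambda>x. x * _"] cong: if_cong)
  ultimately show ?thesis by (simp add: W WW)
qed

section \<open>Tensor calculus on a coordinate domain\<close>

text \<open>As a simp rule it would rewrite \<open>transpose A *v x\<close> to \<open>x v* A\<close>
  and destroy the form in which covariant derivatives of 1-forms are written.\<close>

declare transpose_matrix_vector [simp del]

text \<open>\<open>conn g i\<close> is the matrix \<open>(\<Gamma>\<^sub>i)\<^sup>k\<^sub>j = \<Gamma>\<^sup>k\<^sub>i\<^sub>j\<close> of \<open>\<nabla>\<^sub>i\<close>, and \<open>curv g i j\<close> is the endomorphism \<open>R(\<partial>\<^sub>i, \<partial>\<^sub>j)\<close>. With a fixed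
  derivative index, \<open>cov1\<close> and \<open>cov2\<close> are the components of \<open>\<nabla>\<^sub>i\<close> on 1-forms and on 2-tensors, so that
  identities between them are identities in a matrix ring.\<close>

definition conn :: "(real^'m \<Rightarrow> real^'m^'m) \<Rightarrow> 'm::finite \<Rightarrow> real^'m \<Rightarrow> real^'m^'m" where
  "conn g i x = (\<chi> k j. 1/2 * (\<Sum>l\<in>UNIV. matrix_inv (g x) $ k $ l *
     (pd i (\<lambda>y. g y $ j $ l) x + pd j (\<lambda>y. g y $ i $ l) x - pd l (\<lambda>y. g y $ i $ j) x)))"

definition curv :: "(real^'m \<Rightarrow> real^'m^'m) \<Rightarrow> 'm::finite \<Rightarrow> 'm \<Rightarrow> real^'m \<Rightarrow> real^'m^'m" where
  "curv g i j x = pd i (conn g j) x - pd j (conn g i) x + conn g i x ** conn g j x - conn g j x ** conn g i x"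

definition ric :: "(real^'m \<Rightarrow> real^'m^'m) \<Rightarrow> real^'m \<Rightarrow> real^'m::finite^'m" where
  "ric g x = (\<chi> j k. \<Sum>i\<in>UNIV. curv g i j x $ i $ k)"

definition dl :: "(real^'m \<Rightarrow> real) \<Rightarrow> real^'m \<Rightarrow> real^'m::finite" where
  "dl f x = (\<chi> j. pd j f x)"

definition cov1 :: "(real^'m \<Rightarrow> real^'m^'m) \<Rightarrow> 'm::finite \<Rightarrow> (real^'m \<Rightarrow> real^'m) \<Rightarrow> real^'m \<Rightarrow> real^'m" where
  "cov1 g i w x = pd i w x - transpose (conn g i x) *v w x"

definition cov2 :: "(real^'m \<Rightarrow> real^'m^'m) \<Rightarrow> 'm::finite \<Rightarrow> (real^'m \<Rightarrow> real^'m^'m) \<Rightarrow> real^'m \<Rightarrow> real^'m^'m" where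
  "cov2 g i T x = pd i T x - transpose (conn g i x) ** T x - T x ** conn g i x"

definition hess :: "(real^'m \<Rightarrow> real^'m^'m) \<Rightarrow> (real^'m \<Rightarrow> real) \<Rightarrow> real^'m \<Rightarrow> real^'m::finite^'m" where
  "hess g f x = (\<chi> i. cov1 g i (dl f) x)"

definition lap :: "(real^'m \<Rightarrow> real^'m^'m) \<Rightarrow> (real^'m \<Rightarrow> real) \<Rightarrow> real^'m::finite \<Rightarrow> real" where
  "lap g f x = matrix_inv (g x) \<bullet> hess g f x"

text \<open>The first tensor slot is contracted and the second stays free, a convention that matters
  until symmetry of the tensor is known.\<close>

definition div2 :: "(real^'m \<Rightarrow> real^'m^'m) \<Rightarrow> (real^'m \<Rightarrow> real^'m^'m) \<Rightarrow> real^'m \<Rightarrow> real^'m::finite" where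
  "div2 g T x = (\<chi> k. \<Sum>i\<in>UNIV. \<Sum>j\<in>UNIV. matrix_inv (g x) $ i $ j * cov2 g i T x $ j $ k)"

locale coord_metric =
  fixes \<Omega> :: "(real^'m) set" and g :: "real^'m \<Rightarrow> real^'m::finite^'m"
  assumes open_\<Omega>: "open \<Omega>" and smooth_g: "smooth_on \<Omega> g"
    and pos_def_g: "\<And>x. x \<in> \<Omega> \<Longrightarrow> pos_def (g x)"
begin

abbreviation A where "A \<equiv> conn g"
abbreviation G where "G \<equiv> \<lambda>x. matrix_inv (g x)"

lemmas smooth_differentiable = smooth_on_differentiable[where S = \<Omega>]

lemma smooth_G: "smooth_on \<Omega> G"
  by (rule smooth_on_matrix_inv[OF open_\<Omega> smooth_g]) (simp add: pos_def_invertible pos_def_g)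

lemma smooth_conn: "smooth_on \<Omega> (A i)"
  by (rule smooth_on_vecI[OF open_\<Omega>], rule smooth_on_vecI[OF open_\<Omega>])
    (simp only: conn_def vec_lambda_beta, intro smooth_on_sum smooth_on_mult smooth_on_const smooth_on_diff smooth_on_add
      smooth_on_nth smooth_on_pd smooth_g smooth_G open_\<Omega>)

lemma smooth_curv: "smooth_on \<Omega> (curv g i j)"
  unfolding curv_def[abs_def]
  by (intro smooth_on_add smooth_on_diff smooth_on_matrix_mult smooth_on_pd smooth_conn open_\<Omega>)

lemma smooth_ric: "smooth_on \<Omega> (ric g)"
  by (rule smooth_on_vecI[OF open_\<Omega>], rule smooth_on_vecI[OF open_\<Omega>])
    (auto simp: ric_def intro!: smooth_on_sum smooth_on_nth smooth_curv open_\<Omega>)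

lemma smooth_dl: "smooth_on \<Omega> f \<Longrightarrow> smooth_on \<Omega> (dl f)"
  by (rule smooth_on_vecI[OF open_\<Omega>]) (simp add: dl_def smooth_on_pd)

lemma smooth_cov1: "smooth_on \<Omega> w \<Longrightarrow> smooth_on \<Omega> (cov1 g i w)"
  unfolding cov1_def[abs_def]
  by (intro smooth_on_diff smooth_on_matrix_vector_mult smooth_on_transpose smooth_on_pd smooth_conn open_\<Omega>)

lemma smooth_hess: "smooth_on \<Omega> f \<Longrightarrow> smooth_on \<Omega> (hess g f)"
  by (rule smooth_on_vecI[OF open_\<Omega>]) (simp add: hess_def smooth_cov1 smooth_dl)

lemma smooth_lap: "smooth_on \<Omega> f \<Longrightarrow> smooth_on \<Omega> (lap g f)"
  unfolding lap_def[abs_def]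
  by (intro smooth_on_bilinear[OF bounded_bilinear_inner] open_\<Omega> smooth_G smooth_hess)

lemma g_sym: "x \<in> \<Omega> \<Longrightarrow> g x $ i $ j = g x $ j $ i"
  using pos_def_g[of x] by (metis pos_def_def transpose_nth)

lemma pos_def_G: "x \<in> \<Omega> \<Longrightarrow> pos_def (G x)"
  by (rule pos_def_inv[OF pos_def_g])

lemma transpose_G: "x \<in> \<Omega> \<Longrightarrow> transpose (G x) = G x"
  using pos_def_G by (simp add: pos_def_def)

lemma G_sym: "x \<in> \<Omega> \<Longrightarrow> G x $ i $ j = G x $ j $ i"
  using transpose_G[of x] by (metis transpose_nth)

lemma gG: "x \<in> \<Omega> \<Longrightarrow> g x ** G x = mat 1" "x \<in> \<Omega> \<Longrightarrow> G x ** g x = mat 1"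
  using matrix_inv_inverse pos_def_invertible pos_def_g by blast+

lemma conn_sym:
  assumes "x \<in> \<Omega>"
  shows "A i x $ k $ j = A j x $ k $ i"
proof -
  have "pd l (\<lambda>y. g y $ i $ j) x = pd l (\<lambda>y. g y $ j $ i) x" for l
    by (rule pd_cong[OF open_\<Omega> assms g_sym])
  then show ?thesis by (simp add: conn_def algebra_simps)
qed

text \<open>Lowering the index cancels the inverse metric and leaves the Christoffel symbols of the
  first kind.\<close>

lemma lowered_conn:
  assumes "x \<in> \<Omega>"
  shows "(g x ** A i x) $ l $ j = 1/2 * (pd i (\<lambda>y. g y $ j $ l) x + pd j (\<lambda>y. g y $ i $ l) x - pd l (\<lambda>y. g y $ i $ j) x)"
proof -
  define c where "c = (\<chi> l j. 1/2 * (pd i (\<lambda>y. g y $ j $ l) x + pd j (\<lambda>y. g y $ i $ l) x - pd l (\<lambda>y. g y $ i $ j) x))"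
  have "A i x = G x ** c"
    by (simp add: vec_eq_iff conn_def c_def matrix_mult_nth sum_distrib_left)
  then have "g x ** A i x = c" using gG[OF assms] by (simp add: matrix_mul_assoc)
  then show ?thesis by (simp add: c_def)
qed

text \<open>This is \<nabla>g = 0: in the sum of two Christoffel symbols of the first kind with
  \<open>j\<close> and \<open>k\<close> exchanged, everything but
  \<open>\<partial>\<^sub>i g\<^sub>j\<^sub>k\<close> cancels.\<close>

lemma metric_compat:
  assumes "x \<in> \<Omega>"
  shows "pd i g x = transpose (A i x) ** g x + g x ** A i x"
proof -
  have "transpose (A i x) ** g x = transpose (g x ** A i x)"
    using pos_def_g[OF assms] by (simp add: matrix_transpose_mul pos_def_def)
  moreover have "pd i g x $ j $ k = (g x ** A i x) $ k $ j + (g x ** A i x) $ j $ k" for j k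
  proof -
    have s: "pd l (\<lambda>y. g y $ a $ b) x = pd l (\<lambda>y. g y $ b $ a) x" for l a b
      by (rule pd_cong[OF open_\<Omega> assms g_sym])
    have "pd i g x $ j $ k = pd i (\<lambda>y. g y $ j $ k) x"
      using pd_nth[OF smooth_differentiable[OF smooth_g assms], of i j]
        pd_nth[OF smooth_differentiable[OF smooth_on_nth[OF open_\<Omega> smooth_g] assms], of i j k] by simp
    then show ?thesis
      unfolding lowered_conn[OF assms] using s[of i k j] s[of k i j] s[of j i k] by (simp add: field_simps)
  qed
  ultimately show ?thesis by (simp add: vec_eq_iff transpose_nth)
qed

text \<open>Parallelism of the inverse metric, by differentiating
  \<open>g ** G = mat 1\<close>.\<close>

lemma pd_G:
  assumes "x \<in> \<Omega>"
  shows "pd i G x = - (A i x ** G x) - G x ** transpose (A i x)"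
proof -
  have "pd i (\<lambda>y. g y ** G y) x = pd i (\<lambda>y. mat 1) x"
    by (rule pd_cong[OF open_\<Omega> assms gG(1)])
  then have "g x ** pd i G x + pd i g x ** G x = 0"
    by (simp add: pd_const pd_matrix_mult smooth_differentiable[OF smooth_g assms] smooth_differentiable[OF smooth_G assms])
  then have "G x ** (g x ** pd i G x) = - (G x ** (pd i g x ** G x))"
    by (metis add_eq_0_iff2 matrix_mult_minus_right)
  then have "pd i G x = - (G x ** (pd i g x ** G x))"
    by (simp add: matrix_mul_assoc gG assms)
  also have "G x ** (pd i g x ** G x) = G x ** transpose (A i x) ** (g x ** G x) + (G x ** g x) ** A i x ** G x"
    by (simp add: metric_compat[OF assms] matrix_ring)
  finally show ?thesis by (simp add: gG assms)
qed

lemma pd_matrix_mult_smooth: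
  fixes P :: "real^'m \<Rightarrow> real^'b^'c" and Q :: "real^'m \<Rightarrow> real^'d^'b"
  assumes "smooth_on \<Omega> P" "smooth_on \<Omega> Q" "x \<in> \<Omega>"
  shows "pd i (\<lambda>x. P x ** Q x) x = P x ** pd i Q x + pd i P x ** Q x"
  by (rule pd_matrix_mult) (use assms smooth_differentiable in blast)+

lemma pd_matrix_vector_mult_smooth:
  fixes P :: "real^'m \<Rightarrow> real^'b^'c"
  assumes "smooth_on \<Omega> P" "smooth_on \<Omega> w" "x \<in> \<Omega>"
  shows "pd i (\<lambda>x. P x *v w x) x = P x *v pd i w x + pd i P x *v w x"
  by (rule pd_matrix_vector_mult) (use assms smooth_differentiable in blast)+

lemma pd_transpose_smooth:
  fixes P :: "real^'m \<Rightarrow> real^'b^'c"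
  shows "smooth_on \<Omega> P \<Longrightarrow> x \<in> \<Omega> \<Longrightarrow> pd i (\<lambda>x. transpose (P x)) x = transpose (pd i P x)"
  by (rule pd_transpose) (use smooth_differentiable in blast)

lemma pd_diff_smooth: "smooth_on \<Omega> P \<Longrightarrow> smooth_on \<Omega> Q \<Longrightarrow> x \<in> \<Omega> \<Longrightarrow> pd i (\<lambda>x. P x - Q x) x = pd i P x - pd i Q x"
  by (rule pd_diff) (use smooth_differentiable in blast)+

lemma pd_add_smooth: "smooth_on \<Omega> P \<Longrightarrow> smooth_on \<Omega> Q \<Longrightarrow> x \<in> \<Omega> \<Longrightarrow> pd i (\<lambda>x. P x + Q x) x = pd i P x + pd i Q x"
  by (rule pd_add) (use smooth_differentiable in blast)+

section \<open>Curvature, covariant derivatives and the Ricci identity\<close>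

lemma curv_antisym: "curv g j i x = - curv g i j x"
  by (simp add: curv_def)

text \<open>Second partial derivatives of \<open>G\<close> commute; expanded through
  \<open>pd_G\<close>, their commutator is the curvature acting on \<open>G\<close>, hence
  zero.\<close>

lemma curv_G_antisym:
  assumes "x \<in> \<Omega>"
  shows "curv g i j x ** G x + G x ** transpose (curv g i j x) = 0"
proof -
  have dd: "pd i (pd j G) x = - (A j x ** pd i G x + pd i (A j) x ** G x)
      - (G x ** transpose (pd i (A j) x) + pd i G x ** transpose (A j x))" for i j
  proof -
    have "pd i (pd j G) x = pd i (\<lambda>x. - (A j x ** G x) - G x ** transpose (A j x)) x"
      by (rule pd_cong[OF open_\<Omega> assms pd_G])
    also have "\<dots> = pd i (\<lambda>x. - (A j x ** G x)) x - pd i (\<lambda>x. G x ** transpose (A j x)) x"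
      by (intro pd_diff_smooth smooth_on_minus smooth_on_matrix_mult smooth_on_transpose smooth_conn smooth_G open_\<Omega> assms)
    also have "pd i (\<lambda>x. - (A j x ** G x)) x = - pd i (\<lambda>x. A j x ** G x) x"
      by (intro pd_linear[OF bounded_linear_minus[OF bounded_linear_ident]] smooth_differentiable assms
          smooth_on_matrix_mult smooth_conn smooth_G open_\<Omega>)
    finally show ?thesis
      by (simp add: pd_matrix_mult_smooth pd_transpose_smooth smooth_on_transpose smooth_conn smooth_G open_\<Omega> assms)
  qed
  have "pd i (pd j G) x = pd j (pd i G) x" by (rule pd_commute[OF smooth_G open_\<Omega> assms])
  then show ?thesis
    unfolding dd by (simp add: pd_G[OF assms] curv_def matrix_ring algebra_simps)
qed

lemma curv_G_antisym_nth:
  assumes "x \<in> \<Omega>"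
  shows "(curv g i j x ** G x) $ a $ b = - (curv g i j x ** G x) $ b $ a"
proof -
  have "G x ** transpose (curv g i j x) = transpose (curv g i j x ** G x)"
    by (simp add: matrix_transpose_mul transpose_G assms)
  then have "(curv g i j x ** G x) + transpose (curv g i j x ** G x) = 0"
    using curv_G_antisym[OF assms, of i j] by simp
  then have "((curv g i j x ** G x) + transpose (curv g i j x ** G x)) $ a $ b = 0" by simp
  then show ?thesis by (simp add: transpose_nth)
qed

text \<open>Since \<open>G\<close> is parallel, the metric trace commutes with \<nabla>.\<close>

lemma pd_contract:
  assumes T: "T differentiable (at x)" and x: "x \<in> \<Omega>"
  shows "pd k (\<lambda>x. G x \<bullet> T x) x = G x \<bullet> cov2 g k T x"
proof -
  have "pd k (\<lambda>x. G x \<bullet> T x) x = G x \<bullet> pd k T x + pd k G x \<bullet> T x"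
    by (rule pd_inner) (use smooth_differentiable T smooth_G x in blast)+
  then show ?thesis
    by (simp add: pd_G[OF x] cov2_def inner_diff_left inner_diff_right inner_matrix_mult_left[of "A k x"]
        inner_matrix_mult_right[of "G x"])
qed

text \<open>Leibniz rule for a 2-tensor applied to a vector field; the last bracket is the covariant
  derivative of \<open>X\<close>, whose connection term has the opposite sign to that of a
  1-form.\<close>

lemma cov1_mv:
  assumes "smooth_on \<Omega> T" "smooth_on \<Omega> X" "x \<in> \<Omega>"
  shows "cov1 g k (\<lambda>x. T x *v X x) x = cov2 g k T x *v X x + T x *v (pd k X x + A k x *v X x)"
  by (simp add: cov1_def cov2_def pd_matrix_vector_mult_smooth assms matrix_vector_mult_diff_rdistrib matrix_vector_right_distrib
      matrix_vector_mul_assoc)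

text \<open>Raising an index commutes with \<nabla>, again because \<open>G\<close> is
  parallel.\<close>

lemma pd_raise:
  assumes "smooth_on \<Omega> w" "x \<in> \<Omega>"
  shows "pd k (\<lambda>x. G x *v w x) x + A k x *v (G x *v w x) = G x *v cov1 g k w x"
  by (simp add: cov1_def pd_matrix_vector_mult_smooth smooth_G assms pd_G matrix_vector_mult_diff_rdistrib matrix_vector_mult_diff_distrib
      matrix_vector_mul_assoc) (simp add: matrix_vector_mult_diff_rdistrib[of 0, simplified])

text \<open>In \<open>cov1 g j w\<close> the index \<open>j\<close> is only a label, so this is the
  commutator of the operators \<open>\<nabla>\<^sub>i\<close> and \<open>\<nabla>\<^sub>j\<close>.
  The correction for \<open>j\<close> as a tensor index is added in
  \<open>cov2_hess_nth\<close>.\<close>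

lemma cov1_commutator:
  assumes w: "smooth_on \<Omega> w" and x: "x \<in> \<Omega>"
  shows "cov1 g i (cov1 g j w) x - cov1 g j (cov1 g i w) x = - (transpose (curv g i j x) *v w x)"
proof -
  have "cov1 g i (cov1 g j w) x = pd i (pd j w) x - (transpose (A j x) *v pd i w x + transpose (pd i (A j) x) *v w x)
     - (transpose (A i x) *v pd j w x - transpose (A j x ** A i x) *v w x)" for i j
  proof -
    have "pd i (cov1 g j w) x = pd i (pd j w) x - pd i (\<lambda>x. transpose (A j x) *v w x) x"
      unfolding cov1_def[abs_def]
      by (intro pd_diff_smooth smooth_on_pd smooth_on_matrix_vector_mult smooth_on_transpose smooth_conn open_\<Omega> w x)
    then show ?thesis
      unfolding cov1_def[of g i] 
      by (simp add: pd_matrix_vector_mult_smooth pd_transpose_smooth smooth_on_transpose smooth_conn open_\<Omega> w x cov1_def matrix_vector_mult_diff_distrib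
          matrix_vector_mul_assoc matrix_transpose_mul)
  qed
  moreover have "pd i (pd j w) x = pd j (pd i w) x" by (rule pd_commute[OF w open_\<Omega> x])
  ultimately show ?thesis
    by (simp add: curv_def transpose_linear matrix_vector_mult_diff_rdistrib matrix_vector_mult_add_rdistrib)
qed

text \<open>Symmetry of second partials together with absence of torsion,
  \<open>conn_sym\<close>.\<close>

lemma hess_sym:
  assumes f: "smooth_on \<Omega> f" and x: "x \<in> \<Omega>"
  shows "hess g f x $ i $ j = hess g f x $ j $ i"
proof -
  have "pd i (dl f) x $ j = pd j (dl f) x $ i"
    unfolding pd_nth[OF smooth_differentiable[OF smooth_dl[OF f] x]] using pd_commute[OF f open_\<Omega> x] by (simp add: dl_def)
  then show ?thesis
    by (simp add: hess_def cov1_def matrix_vector_mult_nth transpose_nth conn_sym[OF x, of i _ j])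
qed

lemma transpose_hess: "smooth_on \<Omega> f \<Longrightarrow> x \<in> \<Omega> \<Longrightarrow> transpose (hess g f x) = hess g f x"
  by (simp add: vec_eq_iff transpose_nth hess_sym)

lemma transpose_cov2:
  assumes T: "smooth_on \<Omega> T" "\<And>y. y \<in> \<Omega> \<Longrightarrow> transpose (T y) = T y" and x: "x \<in> \<Omega>"
  shows "transpose (cov2 g i T x) = cov2 g i T x"
proof -
  have "transpose (pd i T x) = pd i (\<lambda>y. transpose (T y)) x" using pd_transpose_smooth[OF T(1) x] by simp
  also have "\<dots> = pd i T x" by (rule pd_cong[OF open_\<Omega> x T(2)])
  finally show ?thesis by (simp add: cov2_def matrix_ring T(2) x)
qed

lemma cov2_hess_nth:
  assumes f: "smooth_on \<Omega> f" and x: "x \<in> \<Omega>"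
  shows "cov2 g i (hess g f) x $ j $ k
       = cov1 g i (cov1 g j (dl f)) x $ k - (\<Sum>l\<in>UNIV. A i x $ l $ j * hess g f x $ l $ k)"
proof -
  have "pd i (hess g f) x $ j = pd i (cov1 g j (dl f)) x"
    by (simp add: pd_nth[OF smooth_differentiable[OF smooth_hess[OF f] x]] hess_def)
  then show ?thesis
    by (simp add: cov2_def cov1_def[of g i "cov1 g j (dl f)"] matrix_mult_nth matrix_vector_mult_nth transpose_nth)
      (simp add: hess_def mult.commute)
qed

text \<open>The Ricci identity for df: the corrections for the middle index agree after
  \<open>i\<close> and \<open>j\<close> are exchanged, by \<open>conn_sym\<close>, and only the
  commutator survives.\<close>

lemma cov2_hess_commute:
  assumes f: "smooth_on \<Omega> f" and x: "x \<in> \<Omega>"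
  shows "cov2 g i (hess g f) x $ j $ k = cov2 g j (hess g f) x $ i $ k - (transpose (curv g i j x) *v dl f x) $ k"
  using arg_cong[OF cov1_commutator[OF smooth_dl[OF f] x, of i j], of "\<lambda>v. v $ k"]
  by (simp add: cov2_hess_nth f x conn_sym[OF x, of i _ j])

lemma ric_nth: "ric g x $ j $ k = (\<Sum>i\<in>UNIV. curv g i j x $ i $ k)"
  by (simp add: ric_def)

text \<open>Contraction of the Ricci identity for \<open>df\<close>.\<close>

lemma div2_hess:
  assumes f: "smooth_on \<Omega> f" and x: "x \<in> \<Omega>"
  shows "div2 g (hess g f) x = dl (lap g f) x + ric g x *v (G x *v dl f x)"
proof (rule vec_eq_iff[THEN iffD2], rule allI)
  fix k
  let ?H = "hess g f" and ?w = "dl f x"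
  have symH: "cov2 g i ?H x $ j $ k = cov2 g i ?H x $ k $ j" for i j
    using transpose_cov2[OF smooth_hess[OF f] transpose_hess[OF f] x, of i] by (metis transpose_nth)
  have "div2 g ?H x $ k = (\<Sum>i\<in>UNIV. \<Sum>j\<in>UNIV. G x $ i $ j * cov2 g i ?H x $ k $ j)"
    by (simp add: div2_def symH)
  \<comment> \<open>Commuting makes \<open>k\<close> the direction of differentiation, so that the
    trace over the other two indices can be taken inside the derivative.\<close>
  also have "\<dots> = (\<Sum>i\<in>UNIV. \<Sum>j\<in>UNIV. G x $ i $ j * cov2 g k ?H x $ i $ j)
      - (\<Sum>i\<in>UNIV. \<Sum>j\<in>UNIV. G x $ i $ j * (transpose (curv g i k x) *v ?w) $ j)"
    unfolding sum_subtractf[symmetric]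
    by (intro sum.cong refl) (simp add: cov2_hess_commute[OF f x, of _ k] right_diff_distrib)
  also have "(\<Sum>i\<in>UNIV. \<Sum>j\<in>UNIV. G x $ i $ j * cov2 g k ?H x $ i $ j) = dl (lap g f) x $ k"
    using pd_contract[OF smooth_differentiable[OF smooth_hess[OF f] x] x, of k] by (simp add: dl_def lap_def[abs_def] inner_matrix)
  also have "(\<Sum>i\<in>UNIV. \<Sum>j\<in>UNIV. G x $ i $ j * (transpose (curv g i k x) *v ?w) $ j)
      = (\<Sum>i\<in>UNIV. \<Sum>l\<in>UNIV. (curv g i k x ** G x) $ l $ i * ?w $ l)"
  proof (rule sum.cong[OF refl])
    fix i
    have "(\<Sum>j\<in>UNIV. G x $ i $ j * (transpose (curv g i k x) *v ?w) $ j)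
        = (\<Sum>j\<in>UNIV. \<Sum>l\<in>UNIV. curv g i k x $ l $ j * G x $ j $ i * ?w $ l)"
      by (simp add: matrix_vector_mult_nth transpose_nth sum_distrib_left G_sym[OF x, of i] mult_ac)
    also have "\<dots> = (\<Sum>l\<in>UNIV. \<Sum>j\<in>UNIV. curv g i k x $ l $ j * G x $ j $ i * ?w $ l)"
      by (rule sum.swap)
    finally show "(\<Sum>j\<in>UNIV. G x $ i $ j * (transpose (curv g i k x) *v ?w) $ j)
        = (\<Sum>l\<in>UNIV. (curv g i k x ** G x) $ l $ i * ?w $ l)"
      by (simp add: matrix_mult_nth sum_distrib_right)
  qed
  \<comment> \<open>Skewness exchanges \<open>l\<close> and \<open>i\<close> and turns the
    contraction into the one that defines \<open>ric\<close>.\<close>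
  also have "\<dots> = - (\<Sum>i\<in>UNIV. \<Sum>l\<in>UNIV. (curv g i k x ** G x) $ i $ l * ?w $ l)"
    unfolding sum_negf[symmetric]
    by (intro sum.cong refl, subst curv_G_antisym_nth[OF x]) simp
  also have "(\<Sum>i\<in>UNIV. \<Sum>l\<in>UNIV. (curv g i k x ** G x) $ i $ l * ?w $ l)
      = (\<Sum>i\<in>UNIV. ((curv g i k x ** G x) *v ?w) $ i)"
    by (simp add: matrix_vector_mult_nth)
  also have "\<dots> = (\<Sum>i\<in>UNIV. \<Sum>a\<in>UNIV. curv g i k x $ i $ a * (G x *v ?w) $ a)"
    by (simp add: matrix_vector_mul_assoc[symmetric] matrix_vector_mult_nth[of "curv _ _ _ _"])
  also have "\<dots> = (\<Sum>a\<in>UNIV. \<Sum>i\<in>UNIV. curv g i k x $ i $ a * (G x *v ?w) $ a)"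
    by (rule sum.swap)
  also have "\<dots> = (ric g x *v (G x *v ?w)) $ k"
    by (simp add: matrix_vector_mult_nth[of "ric g x"] ric_nth sum_distrib_right)
  finally show "div2 g ?H x $ k = (dl (lap g f) x + ric g x *v (G x *v ?w)) $ k" by simp
qed

end

text \<open>The covariant derivative of curvature as an endomorphism-valued 2-form: the commutator
  with the connection matrix accounts for the endomorphism, the two sums for the form indices
  \<open>i\<close> and \<open>j\<close>.\<close>

definition cov_curv :: "(real^'m \<Rightarrow> real^'m^'m) \<Rightarrow> 'm::finite \<Rightarrow> 'm \<Rightarrow> 'm \<Rightarrow> real^'m \<Rightarrow> real^'m^'m" where
  "cov_curv g m i j x = pd m (curv g i j) x + conn g m x ** curv g i j x - curv g i j x ** conn g m x
     - (\<Sum>l\<in>UNIV. conn g m x $ l $ i *\<^sub>R curv g l j x) - (\<Sum>l\<in>UNIV. conn g m x $ l $ j *\<^sub>R curv g i l x)"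

section \<open>The second Bianchi identity and its contractions\<close>

context coord_metric begin

lemma pd_curv:
  assumes x: "x \<in> \<Omega>"
  shows "pd m (curv g i j) x = pd m (pd i (A j)) x - pd m (pd j (A i)) x
     + (A i x ** pd m (A j) x + pd m (A i) x ** A j x) - (A j x ** pd m (A i) x + pd m (A j) x ** A i x)"
proof -
  note sm = smooth_on_pd smooth_conn smooth_on_matrix_mult smooth_on_add smooth_on_diff open_\<Omega> x
  have "pd m (curv g i j) x = pd m (\<lambda>x. pd i (A j) x - pd j (A i) x + A i x ** A j x) x - pd m (\<lambda>x. A j x ** A i x) x"
    unfolding curv_def[abs_def] by (rule pd_diff_smooth; intro sm)
  also have "pd m (\<lambda>x. pd i (A j) x - pd j (A i) x + A i x ** A j x) x
      = pd m (\<lambda>x. pd i (A j) x - pd j (A i) x) x + pd m (\<lambda>x. A i x ** A j x) x"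
    by (rule pd_add_smooth; intro sm)
  also have "pd m (\<lambda>x. pd i (A j) x - pd j (A i) x) x = pd m (pd i (A j)) x - pd m (pd j (A i)) x"
    by (rule pd_diff_smooth; intro sm)
  finally show ?thesis by (simp add: pd_matrix_mult_smooth smooth_conn x)
qed

text \<open>\<open>D m i j\<close> is the commutator of \<open>\<nabla>\<^sub>m\<close> with
  \<open>[\<nabla>\<^sub>i, \<nabla>\<^sub>j]\<close>, so this is the Jacobi identity; second
  partials of the connection cancel by commutation.\<close>

lemma curv_jacobi:
  assumes x: "x \<in> \<Omega>"
  defines "D \<equiv> \<lambda>m i j. pd m (curv g i j) x + A m x ** curv g i j x - curv g i j x ** A m x"
  shows "D m i j + D i j m + D j m i = 0"
proof -
  have c: "pd i (pd j (A k)) x = pd j (pd i (A k)) x" for i j k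
    by (rule pd_commute[OF smooth_conn open_\<Omega> x])
  show ?thesis
    unfolding D_def pd_curv[OF x] curv_def c[of i m] c[of j m] c[of j i]
    by (simp add: matrix_ring)
qed

text \<open>The Jacobi identity handles the commutator parts; the corrections for the form indices
  cancel in pairs by torsion-freeness and skewness of the curvature.\<close>

lemma second_bianchi:
  assumes x: "x \<in> \<Omega>"
  shows "cov_curv g m i j x + cov_curv g i j m x + cov_curv g j m i x = 0"
proof -
  have s: "(\<Sum>l\<in>UNIV. A a x $ l $ b *\<^sub>R curv g l c x) + (\<Sum>l\<in>UNIV. A b x $ l $ a *\<^sub>R curv g c l x) = 0" for a b c
    unfolding sum.distrib[symmetric] curv_antisym[of c] by (simp add: conn_sym[OF x, of b _ a])
  define D where "D m i j = pd m (curv g i j) x + A m x ** curv g i j x - curv g i j x ** A m x" for m i j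
  define X where "X a b c = (\<Sum>l\<in>UNIV. A a x $ l $ b *\<^sub>R curv g l c x)" for a b c
  define Y where "Y a b c = (\<Sum>l\<in>UNIV. A a x $ l $ b *\<^sub>R curv g c l x)" for a b c
  have "cov_curv g m i j x + cov_curv g i j m x + cov_curv g j m i x
      = (D m i j + D i j m + D j m i) - (X m i j + Y i m j) - (X i j m + Y j i m) - (X j m i + Y m j i)"
    by (simp add: cov_curv_def D_def[symmetric] X_def[symmetric] Y_def[symmetric])
  also have "\<dots> = 0"
    using curv_jacobi[OF x, of m i j] s by (simp add: D_def X_def Y_def)
  finally show ?thesis .
qed

lemma cov_curv_antisym:
  assumes x: "x \<in> \<Omega>"
  shows "cov_curv g m j i x = - cov_curv g m i j x"
proof -
  have "pd m (curv g j i) x = pd m (\<lambda>x. - curv g i j x) x"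
    by (rule pd_cong[OF open_\<Omega> x curv_antisym])
  also have "\<dots> = - pd m (curv g i j) x"
    by (rule pd_linear[OF bounded_linear_minus[OF bounded_linear_ident] smooth_differentiable[OF smooth_curv x]])
  finally show ?thesis
    unfolding cov_curv_def curv_antisym[of j i] curv_antisym[of _ i] curv_antisym[of j]
    by (simp add: matrix_ring sum_negf)
qed

text \<open>The skewness of \<open>curv_G_antisym\<close> is differentiated. As \<open>G\<close> is
  parallel it survives for the commutator part, and the correction sums inherit it term by
  term.\<close>

lemma cov_curv_G_antisym:
  assumes x: "x \<in> \<Omega>"
  shows "(cov_curv g m i j x ** G x) $ a $ b = - (cov_curv g m i j x ** G x) $ b $ a"
proof -
  define F where "F = curv g i j x"
  define F' where "F' = pd m (curv g i j) x"
  define P where "P = A m x"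
  define Q where "Q = G x"
  have FG: "curv g i j x ** Q = - (Q ** transpose (curv g i j x))" for i j
    using curv_G_antisym[OF x, of i j] unfolding Q_def by (simp add: eq_neg_iff_add_eq_0)
  have "pd m (\<lambda>x. curv g i j x ** G x + G x ** transpose (curv g i j x)) x = pd m (\<lambda>x. 0) x"
    by (rule pd_cong[OF open_\<Omega> x curv_G_antisym])
  also have "\<dots> = 0" by (rule pd_const)
  also have "pd m (\<lambda>x. curv g i j x ** G x + G x ** transpose (curv g i j x)) x
      = pd m (\<lambda>x. curv g i j x ** G x) x + pd m (\<lambda>x. G x ** transpose (curv g i j x)) x"
    by (intro pd_add_smooth smooth_on_matrix_mult smooth_on_transpose smooth_curv smooth_G open_\<Omega> x)
  finally have e: "F ** (- (P ** Q) - Q ** transpose P) + F' ** Q + (Q ** transpose F' + (- (P ** Q) - Q ** transpose P) ** transpose F) = 0"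
    by (simp add: pd_matrix_mult_smooth pd_transpose_smooth smooth_on_transpose smooth_curv smooth_G open_\<Omega> x F_def F'_def P_def Q_def pd_G)
  define N where "N = - (P ** Q) - Q ** transpose P"
  have "F' ** Q + Q ** transpose F' = (F ** N + F' ** Q + (Q ** transpose F' + N ** transpose F)) - F ** N - N ** transpose F"
    by simp
  then have e': "F' ** Q + Q ** transpose F' = - (F ** N) - N ** transpose F"
    using e by (simp add: N_def)
  define D where "D = F' + P ** F - F ** P"
  have "D ** Q + Q ** transpose D = (F' ** Q + Q ** transpose F') + P ** (F ** Q) - F ** P ** Q + Q ** transpose F ** transpose P - Q ** transpose P ** transpose F"
    by (simp add: D_def matrix_ring)
  also have "\<dots> = (F ** Q + Q ** transpose F) ** transpose P + P ** (Q ** transpose F + F ** Q)"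
    unfolding e' N_def by (simp add: matrix_ring)
  also have "\<dots> = 0" using FG[of i j] by (simp add: F_def matrix_ring)
  finally have DQ: "D ** Q = - (Q ** transpose D)" by (simp add: eq_neg_iff_add_eq_0)
  have "cov_curv g m i j x ** Q = - (Q ** transpose (cov_curv g m i j x))"
  proof -
    have t: "transpose (c *\<^sub>R B) = c *\<^sub>R transpose B" for c and B :: "real^'m^'m"
      by (rule transpose_scalar)
    have "cov_curv g m i j x = D - (\<Sum>l\<in>UNIV. P $ l $ i *\<^sub>R curv g l j x) - (\<Sum>l\<in>UNIV. P $ l $ j *\<^sub>R curv g i l x)"
      by (simp add: cov_curv_def D_def F_def F'_def P_def)
    then show ?thesis
      by (simp add: matrix_mult_diff_left matrix_mult_diff_right transpose_linear transpose_sum t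
          matrix_mult_sum_left matrix_mult_sum_right matrix_mult_scaleR DQ FG sum_negf)
  qed
  also have "Q ** transpose (cov_curv g m i j x) = transpose (cov_curv g m i j x ** Q)"
    by (simp add: matrix_transpose_mul Q_def transpose_G x)
  finally have h: "cov_curv g m i j x ** Q = - transpose (cov_curv g m i j x ** Q)" .
  show ?thesis using arg_cong[OF h, of "\<lambda>B. B $ a $ b"] by (simp add: Q_def transpose_nth)
qed

text \<open>Contraction commutes with \<nabla>: the connection terms at the two contracted indices
  cancel, and the others are those of \<open>cov2\<close>.\<close>

lemma cov_curv_contract:
  assumes x: "x \<in> \<Omega>"
  shows "(\<Sum>i\<in>UNIV. cov_curv g m i j x $ i $ k) = cov2 g m (ric g) x $ j $ k"
proof -
  have 1: "pd m (ric g) x $ j $ k = (\<Sum>i\<in>UNIV. pd m (curv g i j) x $ i $ k)"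
  proof -
    have "pd m (ric g) x $ j $ k = pd m (\<lambda>x. \<Sum>i\<in>UNIV. curv g i j x $ i $ k) x"
      using pd_nth[OF smooth_differentiable[OF smooth_ric x], of m j]
        pd_nth[OF smooth_differentiable[OF smooth_on_nth[OF open_\<Omega> smooth_ric] x], of m j k] by (simp add: ric_nth)
    also have "\<dots> = (\<Sum>i\<in>UNIV. pd m (\<lambda>x. curv g i j x $ i $ k) x)"
      by (intro pd_sum smooth_differentiable smooth_on_nth smooth_curv open_\<Omega> x)
    also have "\<dots> = (\<Sum>i\<in>UNIV. pd m (curv g i j) x $ i $ k)"
      using pd_nth[OF smooth_differentiable[OF smooth_curv x]] pd_nth[OF smooth_differentiable[OF smooth_on_nth[OF open_\<Omega> smooth_curv] x]]
      by simp
    finally show ?thesis .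
  qed
  have 2: "(\<Sum>i\<in>UNIV. (A m x ** curv g i j x) $ i $ k) = (\<Sum>i\<in>UNIV. \<Sum>l\<in>UNIV. A m x $ l $ i * curv g l j x $ i $ k)"
    unfolding matrix_mult_nth by (rule sum.swap)
  have 3: "(\<Sum>i\<in>UNIV. (curv g i j x ** A m x) $ i $ k) = (ric g x ** A m x) $ j $ k"
    unfolding matrix_mult_nth ric_nth sum_distrib_right by (rule sum.swap)
  have 4: "(\<Sum>i\<in>UNIV. \<Sum>l\<in>UNIV. A m x $ l $ j * curv g i l x $ i $ k) = (transpose (A m x) ** ric g x) $ j $ k"
    unfolding matrix_mult_nth ric_nth sum_distrib_left transpose_nth by (rule sum.swap)
  show ?thesis
    unfolding cov_curv_def cov2_def
    using 1 2 3 4 by (simp add: sum.distrib sum_subtractf)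
qed

text \<open>Two contractions of the second Bianchi identity. The third cyclic term becomes, by
  skewness with respect to \<open>G\<close>, a second copy of the divergence, whence the factor
  2.\<close>

lemma contracted_bianchi:
  assumes x: "x \<in> \<Omega>"
  shows "pd m (\<lambda>x. G x \<bullet> ric g x) x
    = 2 * (\<Sum>j\<in>UNIV. \<Sum>k\<in>UNIV. G x $ j $ k * cov2 g j (ric g) x $ m $ k)"
proof -
  let ?N = "\<lambda>m i j. cov_curv g m i j x" and ?r = "\<lambda>m. cov2 g m (ric g) x"
  have 1: "?r m $ j $ k + (\<Sum>i\<in>UNIV. ?N i j m $ i $ k) - ?r j $ m $ k = 0" for j k
  proof -
    have "?N m i j $ i $ k + ?N i j m $ i $ k - ?N j i m $ i $ k = 0" for i
      using arg_cong[OF second_bianchi[OF x, of m i j], of "\<lambda>B. B $ i $ k"] cov_curv_antisym[OF x, of j m i] by simp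
    then have "(\<Sum>i\<in>UNIV. ?N m i j $ i $ k + ?N i j m $ i $ k - ?N j i m $ i $ k) = 0" by simp
    then show ?thesis by (simp add: sum.distrib sum_subtractf cov_curv_contract[OF x])
  qed
  have 2: "(\<Sum>j\<in>UNIV. \<Sum>k\<in>UNIV. G x $ j $ k * (\<Sum>i\<in>UNIV. ?N i j m $ i $ k))
      = - (\<Sum>j\<in>UNIV. \<Sum>k\<in>UNIV. G x $ j $ k * ?r j $ m $ k)"
  proof -
    have "(\<Sum>j\<in>UNIV. \<Sum>k\<in>UNIV. G x $ j $ k * (\<Sum>i\<in>UNIV. ?N i j m $ i $ k))
      = (\<Sum>j\<in>UNIV. \<Sum>k\<in>UNIV. \<Sum>i\<in>UNIV. ?N i j m $ i $ k * G x $ k $ j)"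
      by (simp add: sum_distrib_left G_sym[OF x, of _ j for j] mult.commute)
    also have "\<dots> = (\<Sum>j\<in>UNIV. \<Sum>i\<in>UNIV. \<Sum>k\<in>UNIV. ?N i j m $ i $ k * G x $ k $ j)"
      by (intro sum.cong refl sum.swap)
    also have "\<dots> = (\<Sum>j\<in>UNIV. \<Sum>i\<in>UNIV. (?N i j m ** G x) $ i $ j)"
      by (simp add: matrix_mult_nth)
    also have "\<dots> = - (\<Sum>j\<in>UNIV. \<Sum>i\<in>UNIV. (?N i j m ** G x) $ j $ i)"
      unfolding sum_negf[symmetric] by (intro sum.cong refl cov_curv_G_antisym[OF x])
    also have "(\<Sum>j\<in>UNIV. \<Sum>i\<in>UNIV. (?N i j m ** G x) $ j $ i)
        = (\<Sum>i\<in>UNIV. \<Sum>j\<in>UNIV. \<Sum>b\<in>UNIV. ?N i j m $ j $ b * G x $ b $ i)"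
      unfolding matrix_mult_nth by (rule sum.swap)
    also have "\<dots> = (\<Sum>i\<in>UNIV. \<Sum>b\<in>UNIV. \<Sum>j\<in>UNIV. ?N i j m $ j $ b * G x $ b $ i)"
      by (intro sum.cong refl sum.swap)
    also have "\<dots> = (\<Sum>i\<in>UNIV. \<Sum>b\<in>UNIV. G x $ i $ b * ?r i $ m $ b)"
      by (simp add: sum_distrib_right[symmetric] cov_curv_contract[OF x])
        (intro sum.cong refl, subst G_sym[OF x], simp)
    finally show ?thesis .
  qed
  have "pd m (\<lambda>x. G x \<bullet> ric g x) x = (\<Sum>j\<in>UNIV. \<Sum>k\<in>UNIV. G x $ j $ k * ?r m $ j $ k)"
    using pd_contract[OF smooth_differentiable[OF smooth_ric x] x] by (simp add: inner_matrix)
  also have "\<dots> = (\<Sum>j\<in>UNIV. \<Sum>k\<in>UNIV. G x $ j $ k * ?r j $ m $ k)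
     - (\<Sum>j\<in>UNIV. \<Sum>k\<in>UNIV. G x $ j $ k * (\<Sum>i\<in>UNIV. ?N i j m $ i $ k))"
    unfolding sum_subtractf[symmetric] right_diff_distrib[symmetric]
    by (intro sum.cong refl arg_cong2[where f = "(*)"]) (use 1 in \<open>simp add: algebra_simps\<close>)
  finally show ?thesis by (simp add: 2)
qed

text \<open>The free index sits in the first slot in \<open>contracted_bianchi\<close> and in the
  second in \<open>div2\<close>; \<open>sym\<close> reconciles them and is supplied for solitons by
  \<open>transpose_ric\<close>.\<close>

lemma div2_ric:
  assumes x: "x \<in> \<Omega>" and sym: "\<And>y. y \<in> \<Omega> \<Longrightarrow> transpose (ric g y) = ric g y"
  shows "dl (\<lambda>x. G x \<bullet> ric g x) x = 2 *\<^sub>R div2 g (ric g) x"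
proof -
  have "cov2 g j (ric g) x $ m $ k = cov2 g j (ric g) x $ k $ m" for j m k
    using transpose_cov2[OF smooth_ric sym x, of j] by (metis transpose_nth)
  then show ?thesis
    by (simp add: vec_eq_iff dl_def div2_def contracted_bianchi[OF x])
qed

end

section \<open>Maps and isometries between coordinate domains\<close>

definition jac :: "(real^'m \<Rightarrow> real^'n) \<Rightarrow> real^'m::finite \<Rightarrow> real^'m^'n" where
  "jac u x = (\<chi> a i. pd i u x $ a)"

text \<open>The connection matrix of the pulled-back bundle u^*TN in the direction
  \<open>i\<close>.\<close>

definition pull_conn :: "(real^'n \<Rightarrow> real^'n^'n) \<Rightarrow> (real^'m \<Rightarrow> real^'n) \<Rightarrow> 'm::finite \<Rightarrow> real^'m \<Rightarrow> real^'n::finite^'n" where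
  "pull_conn h u i x = (\<Sum>e\<in>UNIV. (pd i u x $ e) *\<^sub>R conn h e (u x))"

text \<open>Fixing the first argument of \<nabla>du makes it a matrix: rows carry the target index,
  columns the second argument.\<close>

definition sff :: "(real^'m \<Rightarrow> real^'m^'m) \<Rightarrow> (real^'n \<Rightarrow> real^'n^'n) \<Rightarrow> (real^'m \<Rightarrow> real^'n) \<Rightarrow> 'm::finite \<Rightarrow> real^'m \<Rightarrow> real^'m^'n::finite" where
  "sff g h u i x = pd i (jac u) x - jac u x ** conn g i x + pull_conn h u i x ** jac u x"

definition tens :: "(real^'m \<Rightarrow> real^'m^'m) \<Rightarrow> (real^'n \<Rightarrow> real^'n^'n) \<Rightarrow> (real^'m \<Rightarrow> real^'n) \<Rightarrow> real^'m::finite \<Rightarrow> real^'n::finite" where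
  "tens g h u x = (\<chi> a. \<Sum>i\<in>UNIV. \<Sum>j\<in>UNIV. matrix_inv (g x) $ i $ j * sff g h u i x $ a $ j)"

definition pb :: "(real^'n \<Rightarrow> real^'n^'n) \<Rightarrow> (real^'m \<Rightarrow> real^'n) \<Rightarrow> real^'m \<Rightarrow> real^'m::finite^'m" where
  "pb h u x = transpose (jac u x) ** h (u x) ** jac u x"

lemma differentiable_bilinear:
  "bounded_bilinear b \<Longrightarrow> f differentiable (at x) \<Longrightarrow> g differentiable (at x) \<Longrightarrow> (\<lambda>x. b (f x) (g x)) differentiable (at x)"
  using bounded_bilinear.FDERIV unfolding differentiable_def by blast

lemmas differentiable_matrix_mult = differentiable_bilinear[OF bounded_bilinear_matrix_mult]

locale coord_map = dom: coord_metric \<Omega> g + cod: coord_metric \<Omega>' h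
  for \<Omega> :: "(real^'m::finite) set" and g and \<Omega>' :: "(real^'n::finite) set" and h +
  fixes u :: "real^'m \<Rightarrow> real^'n"
  assumes smooth_u: "smooth_on \<Omega> u" and u_in: "\<And>x. x \<in> \<Omega> \<Longrightarrow> u x \<in> \<Omega>'"
begin

lemma smooth_jac: "smooth_on \<Omega> (jac u)"
  by (rule smooth_on_vecI[OF dom.open_\<Omega>], rule smooth_on_vecI[OF dom.open_\<Omega>])
    (simp add: jac_def smooth_on_nth smooth_on_pd smooth_u dom.open_\<Omega>)

lemma diff_comp:
  assumes "smooth_on \<Omega>' F" "x \<in> \<Omega>"
  shows "(\<lambda>x. F (u x)) differentiable (at x)"
  using differentiable_chain_at[of u x F] dom.smooth_differentiable[OF smooth_u assms(2)] cod.smooth_differentiable[OF assms(1) u_in[OF assms(2)]]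
  by (simp add: o_def)

lemma pd_comp:
  assumes "smooth_on \<Omega>' F" "x \<in> \<Omega>"
  shows "pd i (\<lambda>x. F (u x)) x = (\<Sum>e\<in>UNIV. (pd i u x $ e) *\<^sub>R pd e F (u x))"
  by (rule pd_chain) (use dom.smooth_differentiable[OF smooth_u assms(2)] cod.smooth_differentiable[OF assms(1) u_in[OF assms(2)]] in auto)

lemma pd_h:
  assumes x: "x \<in> \<Omega>"
  shows "pd i (\<lambda>x. h (u x)) x = transpose (pull_conn h u i x) ** h (u x) + h (u x) ** pull_conn h u i x"
  unfolding pd_comp[OF cod.smooth_g x] pull_conn_def
  by (simp add: cod.metric_compat[OF u_in[OF x]] transpose_sum transpose_scalar matrix_mult_sum_left
      matrix_mult_sum_right matrix_mult_scaleR sum.distrib scaleR_add_right)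

lemma diff_pb:
  assumes x: "x \<in> \<Omega>"
  shows "pb h u differentiable (at x)"
  unfolding pb_def[abs_def]
  by (intro differentiable_matrix_mult diff_comp[OF cod.smooth_g x]
      dom.smooth_differentiable[OF smooth_on_transpose[OF dom.open_\<Omega> smooth_jac] x] dom.smooth_differentiable[OF smooth_jac x])

lemma transpose_h: "x \<in> \<Omega> \<Longrightarrow> transpose (h (u x)) = h (u x)"
  using cod.pos_def_g[OF u_in] by (simp add: pos_def_def)

text \<open>Leibniz rule for u^*h; the derivative of the middle factor is absorbed because the
  pulled-back connection is compatible with \<open>h\<close>.\<close>

lemma cov2_pb:
  assumes x: "x \<in> \<Omega>"
  shows "cov2 g i (pb h u) x = transpose (sff g h u i x) ** h (u x) ** jac u x
       + transpose (jac u x) ** h (u x) ** sff g h u i x"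
proof -
  have d: "(\<lambda>x. transpose (jac u x)) differentiable (at x)" "jac u differentiable (at x)"
    "(\<lambda>x. h (u x)) differentiable (at x)"
    by (intro dom.smooth_differentiable[OF smooth_on_transpose[OF dom.open_\<Omega> smooth_jac] x] dom.smooth_differentiable[OF smooth_jac x]
        diff_comp[OF cod.smooth_g x])+
  have "pd i (pb h u) x = transpose (jac u x) ** h (u x) ** pd i (jac u) x
      + (transpose (jac u x) ** pd i (\<lambda>x. h (u x)) x + transpose (pd i (jac u) x) ** h (u x)) ** jac u x"
    unfolding pb_def[abs_def]
    by (simp add: pd_matrix_mult d differentiable_matrix_mult dom.pd_transpose_smooth[OF smooth_jac x])
  then show ?thesis
    by (simp add: cov2_def pb_def sff_def pd_h[OF x] matrix_ring)
qed

text \<open>Mixed partials of \<open>u\<close> commute and both Levi-Civita connections are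
  torsion-free.\<close>

lemma sff_sym:
  assumes x: "x \<in> \<Omega>"
  shows "sff g h u i x $ a $ j = sff g h u j x $ a $ i"
proof -
  have 1: "pd i (jac u) x $ a $ j = pd i (pd j u) x $ a" for i j
    using pd_nth[OF dom.smooth_differentiable[OF smooth_jac x], of i a]
      pd_nth[OF dom.smooth_differentiable[OF smooth_on_nth[OF dom.open_\<Omega> smooth_jac] x], of i a j]
      pd_nth[OF dom.smooth_differentiable[OF smooth_on_pd[OF smooth_u] x], of i j a] by (simp add: jac_def)
  have 2: "(pull_conn h u i x ** jac u x) $ a $ j
      = (\<Sum>e\<in>UNIV. \<Sum>b\<in>UNIV. pd i u x $ e * conn h e (u x) $ a $ b * pd j u x $ b)" for i j
    unfolding matrix_mult_nth pull_conn_def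
    by (simp add: sum_distrib_right jac_def) (rule sum.swap)
  have "(\<Sum>e\<in>UNIV. \<Sum>b\<in>UNIV. pd i u x $ e * conn h e (u x) $ a $ b * pd j u x $ b)
      = (\<Sum>b\<in>UNIV. \<Sum>e\<in>UNIV. pd j u x $ b * conn h b (u x) $ a $ e * pd i u x $ e)"
    by (subst sum.swap, intro sum.cong refl, subst cod.conn_sym[OF u_in[OF x]]) (simp add: mult_ac)
  then show ?thesis
    using pd_commute[OF smooth_u dom.open_\<Omega> x, of i j]
    by (simp add: sff_def 1 2) (simp add: matrix_mult_nth dom.conn_sym[OF x, of i _ j])
qed

lemma pd_energy:
  assumes x: "x \<in> \<Omega>"
  shows "pd k (\<lambda>x. matrix_inv (g x) \<bullet> pb h u x) x
       = 2 * (matrix_inv (g x) \<bullet> (transpose (jac u x) ** h (u x) ** sff g h u k x))"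
proof -
  let ?B = "transpose (jac u x) ** h (u x) ** sff g h u k x"
  have "transpose (sff g h u k x) ** h (u x) ** jac u x = transpose ?B"
    by (simp add: matrix_transpose_mul transpose_h x matrix_mul_assoc)
  moreover have "matrix_inv (g x) \<bullet> transpose ?B = matrix_inv (g x) \<bullet> ?B"
    using inner_transpose[of "matrix_inv (g x)" ?B] dom.transpose_G[OF x] by simp
  ultimately show ?thesis
    using dom.pd_contract[OF diff_pb[OF x] x] by (simp add: cov2_pb[OF x] inner_add_right)
qed

text \<open>Of the two terms of \<open>cov2_pb\<close>, the first contracts to the tension field. In
  the second, \<open>sff_sym\<close> makes the free index the direction of differentiation, which
  gives half the differential of |du|^2.\<close>

lemma div2_pb:
  assumes x: "x \<in> \<Omega>"
  shows "div2 g (pb h u) x = transpose (jac u x) *v (h (u x) *v tens g h u x)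
    + (1/2) *\<^sub>R dl (\<lambda>x. matrix_inv (g x) \<bullet> pb h u x) x"
proof (rule vec_eq_iff[THEN iffD2], rule allI)
  fix k
  let ?G = "matrix_inv (g x)" and ?B = "\<lambda>i. sff g h u i x" and ?U = "jac u x" and ?h = "h (u x)"
  have hs: "?h $ a $ b = ?h $ b $ a" for a b using transpose_h[OF x] by (metis transpose_nth)
  have 1: "(\<Sum>i\<in>UNIV. \<Sum>j\<in>UNIV. ?G $ i $ j * (transpose (?B i) ** ?h ** ?U) $ j $ k)
      = (transpose ?U *v (?h *v tens g h u x)) $ k"
  proof -
    have a: "(transpose (?B i) ** ?h ** ?U) $ j $ k = (\<Sum>a\<in>UNIV. ?B i $ a $ j * (?h ** ?U) $ a $ k)" for i j
      unfolding matrix_mul_assoc[symmetric] by (simp add: matrix_mult_nth[of "transpose (?B i)"] transpose_nth)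
    have "(\<Sum>i\<in>UNIV. \<Sum>j\<in>UNIV. ?G $ i $ j * (transpose (?B i) ** ?h ** ?U) $ j $ k)
        = (\<Sum>i\<in>UNIV. \<Sum>j\<in>UNIV. \<Sum>a\<in>UNIV. (?h ** ?U) $ a $ k * (?G $ i $ j * ?B i $ a $ j))"
      by (simp add: a sum_distrib_left mult_ac)
    also have "\<dots> = (\<Sum>i\<in>UNIV. \<Sum>a\<in>UNIV. \<Sum>j\<in>UNIV. (?h ** ?U) $ a $ k * (?G $ i $ j * ?B i $ a $ j))"
      by (intro sum.cong refl sum.swap)
    also have "\<dots> = (\<Sum>a\<in>UNIV. \<Sum>i\<in>UNIV. \<Sum>j\<in>UNIV. (?h ** ?U) $ a $ k * (?G $ i $ j * ?B i $ a $ j))"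
      by (rule sum.swap)
    also have "\<dots> = (transpose (?h ** ?U) *v tens g h u x) $ k"
      by (simp add: tens_def matrix_vector_mult_nth[of "transpose (?h ** ?U)"] transpose_nth sum_distrib_left)
    finally show ?thesis by (simp add: matrix_transpose_mul transpose_h x matrix_vector_mul_assoc)
  qed
  have 2: "(\<Sum>i\<in>UNIV. \<Sum>j\<in>UNIV. ?G $ i $ j * (transpose ?U ** ?h ** ?B i) $ j $ k)
      = ?G \<bullet> (transpose ?U ** ?h ** ?B k)"
  proof -
    have "(transpose ?U ** ?h ** ?B i) $ j $ k = transpose (transpose ?U ** ?h ** ?B k) $ i $ j" for i j
      unfolding transpose_nth matrix_mult_nth[of "transpose ?U ** ?h"] by (simp add: sff_sym[OF x, of i _ k])
    then have "(\<Sum>i\<in>UNIV. \<Sum>j\<in>UNIV. ?G $ i $ j * (transpose ?U ** ?h ** ?B i) $ j $ k)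
      = ?G \<bullet> transpose (transpose ?U ** ?h ** ?B k)" by (simp add: inner_matrix)
    then show ?thesis using inner_transpose[of ?G "transpose ?U ** ?h ** ?B k"] dom.transpose_G[OF x] by simp
  qed
  show "div2 g (pb h u) x $ k = (transpose ?U *v (?h *v tens g h u x)
    + (1/2) *\<^sub>R dl (\<lambda>x. matrix_inv (g x) \<bullet> pb h u x) x) $ k"
    using 1 2 by (simp add: div2_def cov2_pb[OF x] distrib_left sum.distrib dl_def pd_energy[OF x])
qed

end

text \<open>An isometry has vanishing second fundamental form: \<open>h(\<nabla>du(i,j), du(k))\<close> is symmetric in
  \<open>i, j\<close> and skew in \<open>j, k\<close>. This replaces the transformation law of the Christoffel symbols.\<close>

locale coord_isometry = coord_map \<Omega> g \<Omega>' h u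
  for \<Omega> :: "(real^'m::finite) set" and g and \<Omega>' :: "(real^'m::finite) set" and h u +
  assumes isometry: "\<And>x. x \<in> \<Omega> \<Longrightarrow> g x = pb h u x"
begin

lemma sff_eq_0:
  assumes x: "x \<in> \<Omega>"
  shows "sff g h u i x = 0"
proof -
  let ?B = "\<lambda>i. sff g h u i x" and ?U = "jac u x" and ?h = "h (u x)"
  define b where "b i = transpose (?B i) ** (?h ** ?U)" for i
  have sym: "b i $ j $ k = b j $ i $ k" for i j k
    unfolding b_def matrix_mult_nth[of "transpose (?B _)"] transpose_nth by (simp add: sff_sym[OF x, of i _ j])
  have skew: "b i $ j $ k = - b i $ k $ j" for i j k
  proof -
    have "pd i (pb h u) x = pd i g x"
      by (rule pd_cong[OF dom.open_\<Omega> x]) (simp add: isometry)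
    then have "cov2 g i (pb h u) x = cov2 g i g x" by (simp add: cov2_def isometry x)
    also have "\<dots> = 0" by (simp add: cov2_def dom.metric_compat[OF x])
    finally have "b i + transpose (b i) = 0"
      by (simp add: cov2_pb[OF x] b_def matrix_transpose_mul transpose_h x matrix_mul_assoc)
    from arg_cong[OF this, of "\<lambda>B. B $ j $ k"] show ?thesis by (simp add: transpose_nth)
  qed
  \<comment> \<open>Alternating the symmetry and the skewness returns to the same entry with the
    opposite sign.\<close>
  have "b i $ j $ k = 0" for j k
  proof -
    have "b i $ j $ k = - b i $ k $ j" by (rule skew)
    also have "\<dots> = - b k $ i $ j" by (simp only: sym[of i])
    also have "\<dots> = b k $ j $ i" by (simp only: skew[of k i j] minus_minus)
    also have "\<dots> = b j $ k $ i" by (rule sym)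
    also have "\<dots> = - b j $ i $ k" by (rule skew)
    also have "\<dots> = - b i $ j $ k" by (simp only: sym[of j])
    finally show ?thesis by simp
  qed
  then have "b i = 0" by (simp add: vec_eq_iff)
  \<comment> \<open>The right factor in \<open>b i\<close> is invertible because
    \<open>transpose U ** h ** U\<close> is the metric \<open>g\<close>; it can be
    cancelled.\<close>
  moreover have "(?h ** ?U) ** (matrix_inv (g x) ** transpose ?U) = mat 1"
    unfolding matrix_left_right_inverse[of "?h ** ?U"]
  proof -
    have "matrix_inv (g x) ** transpose ?U ** (?h ** ?U) = matrix_inv (g x) ** g x"
      by (simp add: isometry[OF x] pb_def matrix_mul_assoc)
    then show "matrix_inv (g x) ** transpose ?U ** (?h ** ?U) = mat 1" by (simp add: dom.gG x)
  qed
  ultimately have "transpose (?B i) = 0"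
    unfolding b_def by (metis matrix_mul_assoc matrix_mul_rid matrix_mult_0(1))
  then show ?thesis by (metis transpose_linear(4) transpose_transpose)
qed

text \<open>In the chain rule the second derivatives of \<open>u\<close> are replaced through
  \<open>sff_eq_0\<close>, and they cancel the source Christoffel terms and supply the target ones.
  \<open>FC\<close> is kept apart from the composite because a chart expression agrees with it only
  on an overlap.\<close>

lemma hess_comp:
  assumes F: "smooth_on \<Omega>' F" and FC: "smooth_on \<Omega> FC" "\<And>y. y \<in> \<Omega> \<Longrightarrow> FC y = F (u y)" and x: "x \<in> \<Omega>"
  shows "hess g FC x = transpose (jac u x) ** hess h F (u x) ** jac u x"
proof -
  let ?J = "jac u x" and ?w = "dl F (u x)"
  have dl: "dl FC y = transpose (jac u y) *v dl F (u y)" if y: "y \<in> \<Omega>" for y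
  proof (rule vec_eq_iff[THEN iffD2], rule allI)
    fix k
    have "pd k FC y = pd k (\<lambda>y. F (u y)) y" by (rule pd_cong[OF dom.open_\<Omega> y FC(2)])
    then show "dl FC y $ k = (transpose (jac u y) *v dl F (u y)) $ k"
      by (simp add: dl_def matrix_vector_mult_nth transpose_nth jac_def pd_comp[OF F y])
  qed
  have "hess g FC x $ i = (\<Sum>e\<in>UNIV. (pd i u x $ e) *\<^sub>R (transpose ?J *v (hess h F (u x) $ e)))" for i
  proof -
    have B: "pd i (jac u) x = ?J ** conn g i x - pull_conn h u i x ** ?J"
    proof -
      have "pd i (jac u) x = sff g h u i x + ?J ** conn g i x - pull_conn h u i x ** ?J" by (simp add: sff_def)
      then show ?thesis by (simp add: sff_eq_0[OF x])
    qed
    have "pd i (dl FC) x = pd i (\<lambda>y. transpose (jac u y) *v dl F (u y)) x"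
      by (rule pd_cong[OF dom.open_\<Omega> x dl])
    also have "\<dots> = transpose ?J *v pd i (\<lambda>y. dl F (u y)) x + transpose (pd i (jac u) x) *v ?w"
      by (subst pd_matrix_vector_mult[OF dom.smooth_differentiable[OF smooth_on_transpose[OF dom.open_\<Omega> smooth_jac] x]
            diff_comp[OF cod.smooth_dl[OF F] x]])
        (simp add: dom.pd_transpose_smooth[OF smooth_jac x])
    finally have "hess g FC x $ i = transpose ?J *v (pd i (\<lambda>y. dl F (u y)) x - transpose (pull_conn h u i x) *v ?w)"
      by (simp add: hess_def cov1_def dl[OF x] B matrix_ring matrix_vector_mul_assoc matrix_vector_mult_diff_distrib
          matrix_vector_mult_diff_rdistrib)
    also have "pd i (\<lambda>y. dl F (u y)) x - transpose (pull_conn h u i x) *v ?w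
        = (\<Sum>e\<in>UNIV. (pd i u x $ e) *\<^sub>R (hess h F (u x) $ e))"
    proof -
      have "transpose (pull_conn h u i x) *v ?w = (\<Sum>e\<in>UNIV. (pd i u x $ e) *\<^sub>R (transpose (conn h e (u x)) *v ?w))"
        unfolding pull_conn_def transpose_sum transpose_scalar
        by (induction rule: infinite_finite_induct[of _ UNIV])
          (simp_all add: matrix_vector_mult_add_rdistrib scaleR_matrix_vector_assoc)
      then show ?thesis
        by (simp add: pd_comp[OF cod.smooth_dl[OF F] x] hess_def cov1_def sum_subtractf[symmetric] scaleR_diff_right)
    qed
    finally show ?thesis
      by (simp add: linear_sum[OF matrix_vector_mul_linear] linear_cmul[OF matrix_vector_mul_linear])
  qed
  then have "hess g FC x $ i $ j = (\<Sum>e\<in>UNIV. ?J $ e $ i * (\<Sum>b\<in>UNIV. ?J $ b $ j * hess h F (u x) $ e $ b))" for i j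
    by (simp add: matrix_vector_mult_nth transpose_nth) (simp add: jac_def)
  then show ?thesis
    by (simp add: vec_eq_iff matrix_mul_assoc[symmetric] matrix_mult_nth transpose_nth mult.commute)
qed

text \<open>An isometry between domains of equal dimension pushes the inverse metric forward:
  \<open>J ** G ** transpose J\<close> is the inverse of \<open>h\<close>, so the traces of the
  Hessians agree.\<close>

lemma lap_comp:
  assumes F: "smooth_on \<Omega>' F" and FC: "smooth_on \<Omega> FC" "\<And>y. y \<in> \<Omega> \<Longrightarrow> FC y = F (u y)" and x: "x \<in> \<Omega>"
  shows "lap g FC x = lap h F (u x)"
proof -
  let ?G = "matrix_inv (g x)" and ?J = "jac u x" and ?h = "h (u x)"
  have hi: "?h ** matrix_inv ?h = mat 1" by (rule cod.gG(1)[OF u_in[OF x]])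
  have "?G ** (transpose ?J ** ?h ** ?J) = mat 1" using dom.gG(2)[OF x] isometry[OF x] by (simp add: pb_def)
  then have "(?G ** transpose ?J ** ?h) ** ?J = mat 1" by (simp add: matrix_mul_assoc)
  then have "?J ** (?G ** transpose ?J ** ?h) = mat 1" using matrix_left_right_inverse by blast
  then have "(?J ** ?G ** transpose ?J) ** ?h ** matrix_inv ?h = matrix_inv ?h" by (simp add: matrix_mul_assoc)
  then have inv: "?J ** ?G ** transpose ?J = matrix_inv ?h" by (simp add: matrix_mul_assoc[symmetric] hi)
  have "lap g FC x = ?G \<bullet> (transpose ?J ** hess h F (u x) ** ?J)"
    by (simp add: lap_def hess_comp[OF assms])
  also have "\<dots> = (?J ** ?G ** transpose ?J) \<bullet> hess h F (u x)"
    by (simp add: inner_matrix_mult_right[of "?J ** ?G"] inner_matrix_mult_left[of ?J] matrix_mul_assoc)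
  finally show ?thesis by (simp add: inv lap_def)
qed

end

section \<open>The soliton equations on a coordinate domain\<close>

context coord_metric begin

text \<open>At a critical point the Christoffel terms vanish and the Hessian is the matrix of second
  partials, which is positive semidefinite at a minimum.\<close>

lemma lap_nonneg_at_min:
  assumes s: "smooth_on \<Omega> s" and B: "open B" "B \<subseteq> \<Omega>" "x \<in> B" and min: "\<And>y. y \<in> B \<Longrightarrow> s x \<le> s y"
  shows "dl s x = 0" "lap g s x \<ge> 0"
proof -
  have x: "x \<in> \<Omega>" using B by auto
  note lm = local_min_pd[OF smooth_on_subset[OF s B(2)] B(1,3) min]
  show 0: "dl s x = 0" by (simp add: vec_eq_iff dl_def lm)
  have "hess g s x $ i $ j = pd i (pd j s) x" for i j
    using pd_nth[OF smooth_differentiable[OF smooth_dl[OF s] x], of i j] by (simp add: hess_def cov1_def 0) (simp add: dl_def)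
  then show "lap g s x \<ge> 0"
    unfolding lap_def by (intro pos_def_inner_nonneg pos_def_G x) (simp add: lm(2))
qed

lemma inner_G_g: "x \<in> \<Omega> \<Longrightarrow> G x \<bullet> g x = real CARD('m)"
proof -
  assume x: "x \<in> \<Omega>"
  have "G x \<bullet> g x = (\<Sum>i\<in>UNIV. (G x ** g x) $ i $ i)"
    by (simp add: inner_matrix matrix_mult_nth) (intro sum.cong refl, subst g_sym[OF x], simp)
  then show ?thesis by (simp add: gG x mat_def)
qed

lemma smooth_scaled: "smooth_on \<Omega> F \<Longrightarrow> smooth_on \<Omega> (\<lambda>x. c *\<^sub>R F x)"
  by (intro smooth_on_scaleR smooth_on_const open_\<Omega>)

lemma pd_scaled: "F differentiable (at x) \<Longrightarrow> pd i (\<lambda>x. c *\<^sub>R F x) x = c *\<^sub>R pd i F x"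
  by (rule pd_linear[OF bounded_linear_scaleR_right])

lemma cov2_cong:
  assumes "x \<in> \<Omega>" "\<And>y. y \<in> \<Omega> \<Longrightarrow> T y = T' y"
  shows "cov2 g i T x = cov2 g i T' x"
  using pd_cong[OF open_\<Omega> assms, where i = i] assms by (simp add: cov2_def)

lemma cov2_lincomb:
  assumes "T differentiable (at x)" "T' differentiable (at x)"
  shows "cov2 g i (\<lambda>x. a *\<^sub>R T x - b *\<^sub>R T' x) x = a *\<^sub>R cov2 g i T x - b *\<^sub>R cov2 g i T' x"
proof -
  have "pd i (\<lambda>x. a *\<^sub>R T x - b *\<^sub>R T' x) x = a *\<^sub>R pd i T x - b *\<^sub>R pd i T' x"
    using assms by (simp add: pd_diff pd_scaled)
  then show ?thesis
    by (simp add: cov2_def matrix_mult_diff_left matrix_mult_diff_right matrix_mult_scaleR scaleR_diff_right)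
qed

lemma div2_lincomb:
  assumes "T differentiable (at x)" "T' differentiable (at x)"
  shows "div2 g (\<lambda>x. a *\<^sub>R T x - b *\<^sub>R T' x) x = a *\<^sub>R div2 g T x - b *\<^sub>R div2 g T' x"
  by (simp add: vec_eq_iff div2_def cov2_lincomb[OF assms] right_diff_distrib sum_subtractf sum_distrib_left
      mult.left_commute[of _ a] mult.left_commute[of _ b])

lemma div2_cong:
  assumes "x \<in> \<Omega>" "\<And>y. y \<in> \<Omega> \<Longrightarrow> T y = T' y"
  shows "div2 g T x = div2 g T' x"
  by (simp add: div2_def cov2_cong[OF assms])

lemma dl_lincomb:
  assumes "F differentiable (at x)" "F' differentiable (at x)"
  shows "dl (\<lambda>x. a * F x - b * F' x) x = a *\<^sub>R dl F x - b *\<^sub>R dl F' x"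
proof -
  have "pd i (\<lambda>x. a * F x - b * F' x) x = a * pd i F x - b * pd i F' x" for i
    using assms by (simp add: pd_diff pd_linear[OF bounded_linear_mult_right])
  then show ?thesis by (simp add: vec_eq_iff dl_def)
qed

lemma dl_cong: "x \<in> \<Omega> \<Longrightarrow> (\<And>y. y \<in> \<Omega> \<Longrightarrow> F y = F' y) \<Longrightarrow> dl F x = dl F' x"
  using pd_cong[OF open_\<Omega>, of x F F'] by (simp add: dl_def)

lemma div2_metric: "x \<in> \<Omega> \<Longrightarrow> div2 g g x = 0"
  by (simp add: vec_eq_iff div2_def cov2_def metric_compat)

end

text \<open>Here \<sigma> is frozen to the constant \<open>c\<close>: the domain will be the
  coordinate image of a neighbourhood on which \<sigma> is constant.\<close>

locale coord_soliton = coord_map \<Omega> g \<Omega>' h u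
  for \<Omega> :: "(real^'m::finite) set" and g and \<Omega>' :: "(real^'n::finite) set" and h u +
  fixes f :: "real^'m \<Rightarrow> real" and \<alpha> c :: real
  assumes smooth_f: "smooth_on \<Omega> f" and \<alpha>: "\<alpha> > 0"
    and soliton: "\<And>x. x \<in> \<Omega> \<Longrightarrow> ric g x - \<alpha> *\<^sub>R pb h u x + hess g f x = c *\<^sub>R g x"
    and harmonic: "\<And>x. x \<in> \<Omega> \<Longrightarrow> tens g h u x = jac u x *v (matrix_inv (g x) *v dl f x)"
begin

text \<open>The Hessian side of the soliton equation serves as definition, making smoothness and
  symmetry immediate; \<open>T_eq\<close> gives the curvature side.\<close>

definition T where "T x = c *\<^sub>R g x - hess g f x"
definition S where "S x = real CARD('m) * c - lap g f x"
definition X where "X x = matrix_inv (g x) *v dl f x"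

lemma smooth_T: "smooth_on \<Omega> T"
  unfolding T_def[abs_def]
  by (intro smooth_on_diff dom.smooth_scaled dom.smooth_hess dom.smooth_g smooth_f dom.open_\<Omega>)

lemma smooth_S: "smooth_on \<Omega> S"
  unfolding S_def[abs_def] by (intro smooth_on_diff smooth_on_const dom.smooth_lap smooth_f dom.open_\<Omega>)

lemma T_eq: "x \<in> \<Omega> \<Longrightarrow> T x = ric g x - \<alpha> *\<^sub>R pb h u x"
  using soliton[of x] by (simp add: T_def algebra_simps)

lemma transpose_T: "x \<in> \<Omega> \<Longrightarrow> transpose (T x) = T x"
  using dom.pos_def_g[of x]
  by (simp add: T_def transpose_linear transpose_scalar dom.transpose_hess smooth_f pos_def_def)

lemma transpose_pb: "x \<in> \<Omega> \<Longrightarrow> transpose (pb h u x) = pb h u x"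
  by (simp add: pb_def matrix_transpose_mul transpose_h matrix_mul_assoc)

text \<open>Read off from the soliton equation, whose remaining terms are symmetric.\<close>

lemma transpose_ric:
  assumes x: "x \<in> \<Omega>"
  shows "transpose (ric g x) = ric g x"
proof -
  have r: "ric g x = T x + \<alpha> *\<^sub>R pb h u x" using T_eq[OF x] by simp
  show ?thesis
    unfolding r by (simp add: transpose_linear transpose_scalar transpose_T transpose_pb x)
qed

lemma trace_T: "x \<in> \<Omega> \<Longrightarrow> matrix_inv (g x) \<bullet> T x = S x"
  by (simp add: T_def S_def lap_def inner_diff_right dom.inner_G_g)

lemma dl_S: "x \<in> \<Omega> \<Longrightarrow> dl S x = - dl (lap g f) x"
  unfolding S_def[abs_def] dl_def
  by (simp add: vec_eq_iff pd_diff pd_const dom.smooth_differentiable[OF dom.smooth_lap[OF smooth_f]])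

text \<open>The first formula uses the Hessian form of \<open>T\<close>, where \<open>c g\<close> is
  parallel; the second uses the curvature form, contracted Bianchi and
  \<open>div2_pb\<close>.\<close>

lemma div_T:
  assumes x: "x \<in> \<Omega>"
  shows "div2 g T x = dl S x - ric g x *v X x" "div2 g T x = (1/2) *\<^sub>R dl S x - \<alpha> *\<^sub>R (pb h u x *v X x)"
proof -
  have "div2 g T x = c *\<^sub>R div2 g g x - 1 *\<^sub>R div2 g (hess g f) x"
    using dom.div2_lincomb[OF dom.smooth_differentiable[OF dom.smooth_g x] dom.smooth_differentiable[OF dom.smooth_hess[OF smooth_f] x], of c 1]
    by (simp add: T_def[abs_def])
  then show "div2 g T x = dl S x - ric g x *v X x"
    by (simp add: dom.div2_metric x dom.div2_hess smooth_f dl_S X_def)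
  have dE: "(\<lambda>x. matrix_inv (g x) \<bullet> pb h u x) differentiable (at x)"
    and dR: "(\<lambda>x. matrix_inv (g x) \<bullet> ric g x) differentiable (at x)"
    by (intro differentiable_bilinear[OF bounded_bilinear_inner] dom.smooth_differentiable[OF dom.smooth_G x] diff_pb[OF x]
        dom.smooth_differentiable[OF dom.smooth_ric x])+
  have "dl S x = dl (\<lambda>x. 1 * (matrix_inv (g x) \<bullet> ric g x) - \<alpha> * (matrix_inv (g x) \<bullet> pb h u x)) x"
    by (rule dom.dl_cong[OF x]) (simp add: trace_T[symmetric] T_eq inner_diff_right)
  also have "\<dots> = dl (\<lambda>x. matrix_inv (g x) \<bullet> ric g x) x - \<alpha> *\<^sub>R dl (\<lambda>x. matrix_inv (g x) \<bullet> pb h u x) x"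
    using dom.dl_lincomb[OF dR dE, of 1 \<alpha>] by simp
  finally have S: "dl S x = 2 *\<^sub>R div2 g (ric g) x - \<alpha> *\<^sub>R dl (\<lambda>x. matrix_inv (g x) \<bullet> pb h u x) x"
    by (simp add: dom.div2_ric[OF x transpose_ric])
  have "div2 g T x = div2 g (\<lambda>x. 1 *\<^sub>R ric g x - \<alpha> *\<^sub>R pb h u x) x"
    by (rule dom.div2_cong[OF x]) (simp add: T_eq)
  also have "\<dots> = div2 g (ric g) x - \<alpha> *\<^sub>R div2 g (pb h u) x"
    using dom.div2_lincomb[OF dom.smooth_differentiable[OF dom.smooth_ric x] diff_pb[OF x], of 1 \<alpha>] by simp
  also have "\<dots> = (1/2) *\<^sub>R dl S x - \<alpha> *\<^sub>R (transpose (jac u x) *v (h (u x) *v tens g h u x))"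
    unfolding S by (simp add: div2_pb[OF x] algebra_simps)
  \<comment> \<open>The harmonic map equation replaces the tension field by du(\<nabla>f), so that
    u^*h appears as in \<open>T\<close>.\<close>
  also have "transpose (jac u x) *v (h (u x) *v tens g h u x) = pb h u x *v X x"
    by (simp add: harmonic[OF x] X_def pb_def matrix_vector_mul_assoc matrix_mul_assoc)
  finally show "div2 g T x = (1/2) *\<^sub>R dl S x - \<alpha> *\<^sub>R (pb h u x *v X x)" .
qed

lemma dl_S_eq:
  assumes x: "x \<in> \<Omega>"
  shows "dl S x = 2 *\<^sub>R (T x *v X x)"
proof -
  have "(1/2) *\<^sub>R dl S x = dl S x - (1/2) *\<^sub>R dl S x"
    by (simp add: vec_eq_iff)
  also have "\<dots> = ric g x *v X x - \<alpha> *\<^sub>R (pb h u x *v X x)"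
    using div_T[OF x] by (simp add: algebra_simps)
  also have "\<dots> = T x *v X x"
    by (simp add: T_eq[OF x] matrix_vector_mult_diff_rdistrib scaleR_matrix_vector_assoc)
  finally have "2 *\<^sub>R ((1/2) *\<^sub>R dl S x) = 2 *\<^sub>R (T x *v X x)" by simp
  then show ?thesis by simp
qed

text \<open>Divergence of dS = 2 T(\<nabla>f): differentiating \<open>T\<close> gives its
  divergence, differentiating \<nabla>f gives the product of \<open>T\<close> with Hess f = c g - T,
  that is c S - |T|^2.\<close>

lemma lap_S:
  assumes x: "x \<in> \<Omega>"
  shows "lap g S x = 2 * (div2 g T x \<bullet> X x + c * S x - matrix_inv (g x) \<bullet> (T x ** matrix_inv (g x) ** T x))"
proof -
  let ?G = "matrix_inv (g x)" and ?H = "hess g f x"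
  have sX: "smooth_on \<Omega> X"
    unfolding X_def[abs_def]
    by (intro smooth_on_matrix_vector_mult dom.smooth_G dom.smooth_dl smooth_f dom.open_\<Omega>)
  have hs: "hess g S x $ i = 2 *\<^sub>R (cov2 g i T x *v X x + (T x ** ?G) *v ?H $ i)" for i
  proof -
    have "pd i (dl S) x = pd i (\<lambda>x. 2 *\<^sub>R (T x *v X x)) x"
      by (rule pd_cong[OF dom.open_\<Omega> x dl_S_eq])
    also have "\<dots> = 2 *\<^sub>R pd i (\<lambda>x. T x *v X x) x"
      by (intro dom.pd_scaled dom.smooth_differentiable x smooth_on_matrix_vector_mult smooth_T sX dom.open_\<Omega>)
    finally have "hess g S x $ i = 2 *\<^sub>R cov1 g i (\<lambda>x. T x *v X x) x"
      by (simp add: hess_def cov1_def dl_S_eq[OF x] matrix_vector_mult_scaleR scaleR_diff_right)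
    also have "cov1 g i (\<lambda>x. T x *v X x) x = cov2 g i T x *v X x + T x *v (?G *v ?H $ i)"
      unfolding dom.cov1_mv[OF smooth_T sX x]
      using dom.pd_raise[OF dom.smooth_dl[OF smooth_f] x, of i] by (simp add: X_def[abs_def] hess_def)
    finally show ?thesis by (simp add: matrix_vector_mul_assoc)
  qed
  have 1: "(\<Sum>i\<in>UNIV. \<Sum>j\<in>UNIV. ?G $ i $ j * (cov2 g i T x *v X x) $ j) = div2 g T x \<bullet> X x"
  proof -
    have "div2 g T x \<bullet> X x = (\<Sum>k\<in>UNIV. \<Sum>i\<in>UNIV. \<Sum>j\<in>UNIV. ?G $ i $ j * cov2 g i T x $ j $ k * X x $ k)"
      by (simp add: inner_vec_def div2_def sum_distrib_right)
    also have "\<dots> = (\<Sum>i\<in>UNIV. \<Sum>k\<in>UNIV. \<Sum>j\<in>UNIV. ?G $ i $ j * cov2 g i T x $ j $ k * X x $ k)"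
      by (rule sum.swap)
    also have "\<dots> = (\<Sum>i\<in>UNIV. \<Sum>j\<in>UNIV. \<Sum>k\<in>UNIV. ?G $ i $ j * cov2 g i T x $ j $ k * X x $ k)"
      by (intro sum.cong refl sum.swap)
    finally show ?thesis by (simp add: matrix_vector_mult_nth sum_distrib_left mult_ac)
  qed
  have 2: "(\<Sum>i\<in>UNIV. \<Sum>j\<in>UNIV. ?G $ i $ j * ((T x ** ?G) *v ?H $ i) $ j) = ?G \<bullet> (?H ** transpose (T x ** ?G))"
    unfolding inner_matrix matrix_vector_mult_nth matrix_mult_nth[of ?H] transpose_nth by (simp add: mult.commute)
  have 3: "?H ** transpose (T x ** ?G) = c *\<^sub>R T x - T x ** ?G ** T x"
  proof -
    have "?H = c *\<^sub>R g x - T x" by (simp add: T_def)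
    then show ?thesis
      by (simp add: matrix_transpose_mul transpose_T x dom.transpose_G matrix_mult_diff_left matrix_mult_scaleR
          matrix_mul_assoc dom.gG)
  qed
  have "lap g S x = 2 * ((\<Sum>i\<in>UNIV. \<Sum>j\<in>UNIV. ?G $ i $ j * (cov2 g i T x *v X x) $ j)
      + (\<Sum>i\<in>UNIV. \<Sum>j\<in>UNIV. ?G $ i $ j * ((T x ** ?G) *v ?H $ i) $ j))"
    unfolding lap_def inner_matrix hs
    by (simp add: sum.distrib[symmetric] sum_distrib_left algebra_simps)
  then show ?thesis by (simp add: 1 2 3 inner_diff_right trace_T[OF x])
qed

text \<open>At a minimum of \<open>S\<close> the gradient identity gives \<open>T(\<nabla>f) = 0\<close>, and the remaining terms of
  \<open>\<Delta>S = \<langle>\<nabla>S, \<nabla>f\<rangle> - 2\<alpha>|\<tau>|\<^sup>2 + 2cS - 2|T|\<^sup>2\<close> force \<open>S\<^sup>2 / m \<le> |T|\<^sup>2 \<le> cS\<close>.\<close>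

lemma local_min_S:
  assumes x: "x \<in> \<Omega>" and min: "\<And>y. y \<in> \<Omega> \<Longrightarrow> S x \<le> S y"
  shows "(S x)\<^sup>2 \<le> real CARD('m) * c * S x"
proof -
  let ?G = "matrix_inv (g x)" and ?v = "jac u x *v X x"
  note m = dom.lap_nonneg_at_min[OF smooth_S dom.open_\<Omega> subset_refl x min]
  \<comment> \<open>As dS vanishes here, the second formula of \<open>div_T\<close> leaves only
    -\<alpha> u^*h(\<nabla>f).\<close>
  have "div2 g T x \<bullet> X x = - \<alpha> * ((pb h u x *v X x) \<bullet> X x)"
    using div_T(2)[OF x] m(1) by simp
  also have "(pb h u x *v X x) \<bullet> X x = ?v \<bullet> (h (u x) *v ?v)"
  proof -
    have "(pb h u x *v X x) \<bullet> X x = X x \<bullet> (transpose (jac u x) *v (h (u x) *v ?v))"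
      by (simp add: pb_def matrix_vector_mul_assoc matrix_mul_assoc inner_commute)
    then show ?thesis by (simp add: inner_transpose_matrix_vector)
  qed
  also have "- \<alpha> * (?v \<bullet> (h (u x) *v ?v)) \<le> 0"
    using \<alpha> pos_def_nonneg[OF cod.pos_def_g[OF u_in[OF x]], of ?v] by (simp add: mult_nonneg_nonneg)
  finally have "?G \<bullet> (T x ** ?G ** T x) \<le> c * S x"
    using m(2) lap_S[OF x] by simp
  then have le: "real CARD('m) * (?G \<bullet> (T x ** ?G ** T x)) \<le> real CARD('m) * (c * S x)"
    by (intro mult_left_mono) auto
  have "(S x)\<^sup>2 \<le> real CARD('m) * (?G \<bullet> (T x ** ?G ** T x))"
    using trace_squared_le[OF dom.pos_def_G[OF x] transpose_T[OF x]] by (simp only: trace_T[OF x])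
  also note le
  finally show ?thesis by (simp add: mult.assoc)
qed

end

section \<open>The strong maximum principle\<close>

context coord_metric begin

lemma dl_square: "smooth_on \<Omega> F \<Longrightarrow> x \<in> \<Omega> \<Longrightarrow> dl (\<lambda>x. F x * F x) x = (2 * F x) *\<^sub>R dl F x"
  by (simp add: vec_eq_iff dl_def pd_mult smooth_differentiable)

lemma lap_lincomb:
  assumes F: "smooth_on \<Omega> F" "smooth_on \<Omega> K" and x: "x \<in> \<Omega>"
  shows "lap g (\<lambda>x. a * F x - b * K x) x = a * lap g F x - b * lap g K x"
proof -
  note d = smooth_differentiable[OF smooth_dl[OF F(1)] x] smooth_differentiable[OF smooth_dl[OF F(2)] x]
  have dl: "dl (\<lambda>x. a * F x - b * K x) y = a *\<^sub>R dl F y - b *\<^sub>R dl K y" if "y \<in> \<Omega>" for y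
    by (intro dl_lincomb smooth_differentiable F that)
  have "pd i (dl (\<lambda>x. a * F x - b * K x)) x = a *\<^sub>R pd i (dl F) x - b *\<^sub>R pd i (dl K) x" for i
  proof -
    have "pd i (dl (\<lambda>x. a * F x - b * K x)) x = pd i (\<lambda>x. a *\<^sub>R dl F x - b *\<^sub>R dl K x) x"
      by (rule pd_cong[OF open_\<Omega> x dl])
    also have "\<dots> = a *\<^sub>R pd i (dl F) x - b *\<^sub>R pd i (dl K) x"
      using d by (simp add: pd_diff pd_scaled)
    finally show ?thesis .
  qed
  then have "hess g (\<lambda>x. a * F x - b * K x) x = a *\<^sub>R hess g F x - b *\<^sub>R hess g K x"
    by (simp add: vec_eq_iff hess_def cov1_def dl[OF x] matrix_vector_mult_diff_distrib matrix_vector_mult_scaleR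
        algebra_simps)
  then show ?thesis by (simp add: lap_def inner_diff_right)
qed

text \<open>The gradient term is what makes the quadratic part of the barrier strictly subharmonic
  where it is needed.\<close>

lemma lap_square:
  assumes F: "smooth_on \<Omega> F" and x: "x \<in> \<Omega>"
  shows "lap g (\<lambda>x. F x * F x) x = 2 * F x * lap g F x + 2 * (dl F x \<bullet> (G x *v dl F x))"
proof -
  let ?w = "dl F x"
  have "pd i (dl (\<lambda>x. F x * F x)) x = (2 * F x) *\<^sub>R pd i (dl F) x + (2 * pd i F x) *\<^sub>R ?w" for i
  proof -
    have "pd i (dl (\<lambda>x. F x * F x)) x = pd i (\<lambda>x. (2 * F x) *\<^sub>R dl F x) x"
      by (rule pd_cong[OF open_\<Omega> x dl_square[OF F]])
    also have "\<dots> = (2 * F x) *\<^sub>R pd i (dl F) x + pd i (\<lambda>x. 2 * F x) x *\<^sub>R ?w"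
      by (intro pd_scaleR smooth_differentiable[OF _ x] smooth_on_mult smooth_on_const smooth_dl F open_\<Omega>)
    also have "pd i (\<lambda>x. 2 * F x) x = 2 * pd i F x"
      by (rule pd_linear[OF bounded_linear_mult_right smooth_differentiable[OF F x]])
    finally show ?thesis .
  qed
  then have h: "hess g (\<lambda>x. F x * F x) x $ i = (2 * F x) *\<^sub>R hess g F x $ i + (2 * ?w $ i) *\<^sub>R ?w" for i
    by (simp add: hess_def cov1_def dl_square[OF F x] matrix_vector_mult_scaleR algebra_simps)
      (simp add: dl_def)
  have "(\<Sum>i\<in>UNIV. \<Sum>j\<in>UNIV. G x $ i $ j * (2 * ?w $ i * ?w $ j)) = 2 * (?w \<bullet> (G x *v ?w))"
    by (simp add: inner_vec_def matrix_vector_mult_nth sum_distrib_left algebra_simps)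
  then show ?thesis
    unfolding lap_def inner_matrix h
    by (simp add: sum_distrib_left distrib_left sum.distrib algebra_simps)
qed

end

text \<open>A ball inside another of twice the radius touches its boundary at one point only: by the
  parallelogram law for \<open>w\<close> and \<open>x - y\<close>, equality would force
  \<open>x - y = - w\<close>.\<close>

lemma internally_tangent_ball:
  fixes y :: "'a::real_inner"
  assumes "dist y x \<le> r" "x \<noteq> y - w" "norm w = r"
  shows "dist (y + w) x < 2 * r"
proof -
  define v where "v = x - y"
  have r: "r \<ge> 0" using assms(3) by auto
  have "norm v \<le> r" using assms(1) by (simp add: v_def dist_norm norm_minus_commute)
  then have "(norm v)\<^sup>2 \<le> r\<^sup>2" by (simp add: power_mono)
  moreover have "(norm (w - v))\<^sup>2 + (norm (w + v))\<^sup>2 = 2 * (norm w)\<^sup>2 + 2 * (norm v)\<^sup>2"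
    by (simp add: power2_norm_eq_inner inner_diff inner_add inner_commute algebra_simps)
  moreover have "norm (w + v) > 0" using assms(2) by (auto simp: v_def algebra_simps)
  then have "(norm (w + v))\<^sup>2 > 0" by simp
  moreover note this
  ultimately have "(norm (w - v))\<^sup>2 < 4 * r\<^sup>2" unfolding assms(3) by linarith
  then have "(norm (w - v))\<^sup>2 < (2 * r)\<^sup>2" by (simp add: power_mult_distrib)
  then have "norm (w - v) < 2 * r" by (rule power2_less_imp_less) (use r in simp)
  then show ?thesis by (simp add: dist_norm v_def algebra_simps)
qed

context coord_metric begin

text \<open>The barrier on a small ball around the touching point \<open>z\<close> is \<open>\<phi> + k\<phi>\<^sup>2\<close> with \<open>\<phi> x = r\<^sup>2 - |x - y|\<^sup>2\<close> and \<open>k\<close> large.\<close>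

lemma no_touching_sphere:
  assumes s: "smooth_on \<Omega> s" and r: "r > 0" and z: "z \<in> \<Omega>" "dist y z = r"
    and sup: "\<And>x. x \<in> \<Omega> \<Longrightarrow> lap g s x \<le> 0" "\<And>x. x \<in> \<Omega> \<Longrightarrow> s z \<le> s x"
    and pos: "\<And>x. x \<in> \<Omega> \<Longrightarrow> dist y x \<le> r \<Longrightarrow> x \<noteq> z \<Longrightarrow> s z < s x"
  shows False
proof -
  define \<phi> where "\<phi> x = r\<^sup>2 - (x - y) \<bullet> (x - y)" for x
  have sub: "smooth_on \<Omega> (\<lambda>x. x - y)"
    by (intro smooth_on_diff smooth_on_id smooth_on_const open_\<Omega>)
  have s\<phi>: "smooth_on \<Omega> \<phi>"
    unfolding \<phi>_def[abs_def]
    by (intro smooth_on_diff smooth_on_const smooth_on_bilinear[OF bounded_bilinear_inner] sub open_\<Omega>)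
  have \<phi>_dist: "\<phi> x = r\<^sup>2 - (dist y x)\<^sup>2" for x
    by (simp add: \<phi>_def dist_norm power2_norm_eq_inner norm_minus_commute)
  have dl\<phi>: "dl \<phi> x = (-2) *\<^sub>R (x - y)" if x: "x \<in> \<Omega>" for x
  proof -
    have d: "pd i (\<lambda>x. x - y) x = axis i 1" for i
      unfolding pd_def by (subst frechet_derivative_eqI[where f' = "\<lambda>h. h"]) (auto intro!: derivative_eq_intros)
    have "pd i \<phi> x = - 2 * (x - y) $ i" for i
    proof -
      have "pd i \<phi> x = pd i (\<lambda>x. r\<^sup>2) x - pd i (\<lambda>x. (x - y) \<bullet> (x - y)) x"
        unfolding \<phi>_def[abs_def]
        by (intro pd_diff smooth_differentiable[OF _ x] smooth_on_const smooth_on_bilinear[OF bounded_bilinear_inner] sub open_\<Omega>)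
      also have "pd i (\<lambda>x. (x - y) \<bullet> (x - y)) x = (x - y) \<bullet> axis i 1 + axis i 1 \<bullet> (x - y)"
        using pd_inner[OF smooth_differentiable[OF sub x] smooth_differentiable[OF sub x], of i] by (simp add: d)
      finally show ?thesis by (simp add: pd_const inner_axis inner_axis')
    qed
    then show ?thesis by (simp add: vec_eq_iff dl_def)
  qed
  obtain R where R: "R > 0" "cball z R \<subseteq> \<Omega>" using open_\<Omega> z(1) open_contains_cball by blast
  \<comment> \<open>The bound r/2 keeps the centre \<open>y\<close>, where the gradient of \<phi>
    vanishes, out of the ball.\<close>
  define \<rho>0 where "\<rho>0 = min R (r/2)"
  have \<rho>0: "\<rho>0 > 0" "cball z \<rho>0 \<subseteq> \<Omega>" using R r by (auto simp: \<rho>0_def)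
  have sG: "smooth_on \<Omega> (\<lambda>x. dl \<phi> x \<bullet> (G x *v dl \<phi> x))"
    by (intro smooth_on_bilinear[OF bounded_bilinear_inner] smooth_on_matrix_vector_mult smooth_dl smooth_G s\<phi> open_\<Omega>)
  have ne: "cball z \<rho>0 \<noteq> {}" using \<rho>0 by simp
  obtain xm where xm: "xm \<in> cball z \<rho>0"
    "\<And>x. x \<in> cball z \<rho>0 \<Longrightarrow> dl \<phi> xm \<bullet> (G xm *v dl \<phi> xm) \<le> dl \<phi> x \<bullet> (G x *v dl \<phi> x)"
    using continuous_attains_inf[OF compact_cball ne continuous_on_subset[OF smooth_on_continuous[OF sG] \<rho>0(2)]]
    by (elim bexE) simp
  define \<mu> where "\<mu> = dl \<phi> xm \<bullet> (G xm *v dl \<phi> xm)"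
  have \<mu>: "\<mu> > 0"
  proof -
    have "dist z xm \<le> r/2" using xm(1) by (simp add: \<rho>0_def)
    then have "xm \<noteq> y" using z(2) r by (auto simp: dist_commute)
    moreover have "xm \<in> \<Omega>" using xm(1) \<rho>0 by auto
    ultimately have "dl \<phi> xm \<noteq> 0" by (simp add: dl\<phi>)
    then show ?thesis using pos_def_G[OF \<open>xm \<in> \<Omega>\<close>] by (simp add: \<mu>_def pos_def_def)
  qed
  obtain xM where xM: "xM \<in> cball z \<rho>0" "\<And>x. x \<in> cball z \<rho>0 \<Longrightarrow> lap g \<phi> xM \<le> lap g \<phi> x"
    using continuous_attains_inf[OF compact_cball ne continuous_on_subset[OF smooth_on_continuous[OF smooth_lap[OF s\<phi>]] \<rho>0(2)]]
    by (elim bexE) simp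
  define C where "C = max 0 (- lap g \<phi> xM)"
  have C: "C \<ge> 0" "\<And>x. x \<in> cball z \<rho>0 \<Longrightarrow> lap g \<phi> x \<ge> - C" using xM by (force simp: C_def)+
  \<comment> \<open>Makes 2k|\<nabla>\<phi>|^2 at least 2(C + 1), which outweighs the other part (1
    + 2k\<phi>)\<Delta>\<phi>; that part is at least -3C/2 once k|\<phi>| < 1/4.\<close>
  define k where "k = (C + 1) / \<mu>"
  have k: "k > 0" using C \<mu> by (simp add: k_def)
  define w where "w x = \<phi> x + k * (\<phi> x * \<phi> x)" for x
  have \<phi>z: "\<phi> z = 0" using z by (simp add: \<phi>_dist)
  have "isCont \<phi> z" using smooth_on_continuous[OF s\<phi>] open_\<Omega> z(1) by (simp add: continuous_on_eq_continuous_at)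
  moreover have "1 / (4 * k) > 0" using k by simp
  ultimately have "\<exists>d>0. \<forall>x. dist x z < d \<longrightarrow> dist (\<phi> x) (\<phi> z) < 1 / (4 * k)"
    unfolding continuous_at_eps_delta by blast
  then obtain d where d: "d > 0" "\<And>x. dist x z < d \<Longrightarrow> \<bar>\<phi> x\<bar> < 1 / (4 * k)"
    by (auto simp: \<phi>z dist_real_def)
  define \<rho> where "\<rho> = min \<rho>0 (d/2)"
  have \<rho>: "\<rho> > 0" "cball z \<rho> \<subseteq> cball z \<rho>0" using d \<rho>0 by (auto simp: \<rho>_def)
  have small: "k * \<bar>\<phi> x\<bar> < 1/4" if "x \<in> cball z \<rho>" for x
  proof -
    have "dist z x \<le> d/2" using that by (simp add: \<rho>_def)
    then have "\<bar>\<phi> x\<bar> < 1 / (4 * k)" using d by (simp add: dist_commute)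
    then show ?thesis using k by (simp add: field_simps)
  qed
  have sw: "smooth_on \<Omega> w"
    unfolding w_def[abs_def] by (intro smooth_on_add smooth_on_mult smooth_on_const s\<phi> open_\<Omega>)
  have lapw: "lap g w x > 0" if x: "x \<in> cball z \<rho>" for x
  proof -
    have x\<Omega>: "x \<in> \<Omega>" and x0: "x \<in> cball z \<rho>0" using x \<rho> \<rho>0 by auto
    have "lap g w x = lap g (\<lambda>x. 1 * \<phi> x - (-k) * (\<phi> x * \<phi> x)) x" by (simp add: w_def[abs_def])
    also have "\<dots> = 1 * lap g \<phi> x - (-k) * lap g (\<lambda>x. \<phi> x * \<phi> x) x"
      by (intro lap_lincomb s\<phi> smooth_on_mult open_\<Omega> x\<Omega>)
    also have "\<dots> = (1 + 2 * (k * \<phi> x)) * lap g \<phi> x + 2 * k * (dl \<phi> x \<bullet> (G x *v dl \<phi> x))"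
      by (simp add: lap_square[OF s\<phi> x\<Omega>] algebra_simps)
    finally have eq: "lap g w x = (1 + 2 * (k * \<phi> x)) * lap g \<phi> x + 2 * k * (dl \<phi> x \<bullet> (G x *v dl \<phi> x))" .
    have "k * \<mu> = C + 1" using \<mu> by (simp add: k_def)
    moreover have "k * (dl \<phi> x \<bullet> (G x *v dl \<phi> x)) \<ge> k * \<mu>"
      using xm(2)[OF x0] k by (simp add: \<mu>_def)
    ultimately have 1: "2 * k * (dl \<phi> x \<bullet> (G x *v dl \<phi> x)) \<ge> 2 * (C + 1)" by simp
    have ab: "\<bar>k * \<phi> x\<bar> < 1/4" using small[OF x] k by (simp add: abs_mult)
    then have b: "0 \<le> 1 + 2 * (k * \<phi> x)" "1 + 2 * (k * \<phi> x) \<le> 3/2" by linarith+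
    have "(1 + 2 * (k * \<phi> x)) * (- C) \<le> (1 + 2 * (k * \<phi> x)) * lap g \<phi> x"
      by (rule mult_left_mono[OF C(2)[OF x0] b(1)])
    moreover have "(1 + 2 * (k * \<phi> x)) * C \<le> 3/2 * C" by (rule mult_right_mono[OF b(2) C(1)])
    ultimately show ?thesis using eq 1 C(1) by simp
  qed
  \<comment> \<open>On this compact cap s - s(z) has a positive minimum, so a small multiple of the
    barrier stays below it. On the rest of the small sphere \<phi> and hence the barrier are
    negative.\<close>
  define E where "E = sphere z \<rho> \<inter> cball y r"
  have E\<Omega>: "E \<subseteq> \<Omega>" using \<rho> \<rho>0 by (auto simp: E_def)
  have cE: "compact E" by (simp add: E_def compact_Int_closed)
  have "\<exists>\<epsilon>>0. \<forall>x\<in>E. \<epsilon> * w x < s x - s z"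
  proof (cases "E = {}")
    case True
    then show ?thesis by (intro exI[of _ 1]) auto
  next
    case False
    obtain x1 where x1: "x1 \<in> E" "\<And>x. x \<in> E \<Longrightarrow> s x1 \<le> s x"
      using continuous_attains_inf[OF cE False continuous_on_subset[OF smooth_on_continuous[OF s] E\<Omega>]]
      by (elim bexE) simp
    obtain x2 where x2: "x2 \<in> E" "\<And>x. x \<in> E \<Longrightarrow> w x \<le> w x2"
      using continuous_attains_sup[OF cE False continuous_on_subset[OF smooth_on_continuous[OF sw] E\<Omega>]]
      by (elim bexE) simp
    have m: "s x1 - s z > 0"
      using pos[of x1] x1(1) E\<Omega> \<rho>(1) by (auto simp: E_def)
    define W where "W = max 0 (w x2) + 1"
    have W: "W > 0" "\<And>x. x \<in> E \<Longrightarrow> w x < W" using x2 by (force simp: W_def)+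
    have "(s x1 - s z) / W * w x < s x - s z" if "x \<in> E" for x
    proof -
      have "(s x1 - s z) / W * w x < (s x1 - s z) / W * W"
        using W(1) W(2)[OF that] m by (intro mult_strict_left_mono) auto
      also have "\<dots> \<le> s x - s z" using W(1) x1(2)[OF that] by simp
      finally show ?thesis .
    qed
    then show ?thesis using m W(1) by (intro exI[of _ "(s x1 - s z) / W"]) auto
  qed
  then obtain \<epsilon> where \<epsilon>: "\<epsilon> > 0" "\<And>x. x \<in> E \<Longrightarrow> \<epsilon> * w x < s x - s z" by blast
  \<comment> \<open>Its boundary values exceed its value at the centre while its Laplacian is
    negative, so its minimum over the small ball can lie nowhere. The factor 1 fits
    \<open>lap_lincomb\<close>.\<close>
  define q where "q x = 1 * s x - \<epsilon> * w x" for x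
  have sq: "smooth_on \<Omega> q"
    unfolding q_def[abs_def] by (intro smooth_on_diff smooth_on_mult smooth_on_const s sw open_\<Omega>)
  have bd: "q x > q z" if x: "x \<in> sphere z \<rho>" for x
  proof -
    have qz: "q z = s z" by (simp add: q_def w_def \<phi>z)
    have x\<Omega>: "x \<in> \<Omega>" and xc: "x \<in> cball z \<rho>" using x \<rho> \<rho>0 by auto
    show ?thesis
    proof (cases "dist y x \<le> r")
      case True
      then show ?thesis using \<epsilon>(2)[of x] x by (simp add: E_def qz) (simp add: q_def)
    next
      case False
      then have "r\<^sup>2 < (dist y x)\<^sup>2" using r by (intro power_strict_mono) auto
      then have neg: "\<phi> x < 0" by (simp add: \<phi>_dist)
      have "\<bar>k * \<phi> x\<bar> < 1/4" using small[OF xc] k by (simp add: abs_mult)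
      then have "1 + k * \<phi> x > 0" by linarith
      then have "\<phi> x * (1 + k * \<phi> x) < 0" using neg by (simp add: mult_neg_pos)
      then have "w x < 0" by (simp add: w_def algebra_simps)
      then have "\<epsilon> * w x < 0" using \<epsilon>(1) by (simp add: mult_pos_neg)
      then show ?thesis using sup(2)[OF x\<Omega>] by (simp add: qz) (simp add: q_def)
    qed
  qed
  have c\<Omega>: "cball z \<rho> \<subseteq> \<Omega>" using \<rho> \<rho>0 by auto
  have ne': "cball z \<rho> \<noteq> {}" using \<rho> by simp
  obtain x0 where x0: "x0 \<in> cball z \<rho>" "\<And>x. x \<in> cball z \<rho> \<Longrightarrow> q x0 \<le> q x"
    using continuous_attains_inf[OF compact_cball ne' continuous_on_subset[OF smooth_on_continuous[OF sq] c\<Omega>]]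
    by (elim bexE) simp
  have "q x0 \<le> q z" using x0(2)[of z] \<rho> by simp
  then have "x0 \<notin> sphere z \<rho>" using bd[of x0] by auto
  then have x0b: "x0 \<in> ball z \<rho>" using x0(1) by auto
  have "lap g q x0 \<ge> 0"
    by (rule lap_nonneg_at_min(2)[OF sq open_ball _ x0b]) (use x0 c\<Omega> in auto)
  moreover have "lap g q x0 = 1 * lap g s x0 - \<epsilon> * lap g w x0"
    unfolding q_def[abs_def] by (rule lap_lincomb[OF s sw]) (use x0 c\<Omega> in auto)
  moreover have "\<epsilon> * lap g w x0 > 0" using \<epsilon>(1) lapw[OF x0(1)] by simp
  moreover have "lap g s x0 \<le> 0" using sup(1)[of x0] x0 c\<Omega> by auto
  ultimately show False by simp
qed

lemma coord_metric_subset: "open B \<Longrightarrow> B \<subseteq> \<Omega> \<Longrightarrow> coord_metric B g"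
  by unfold_locales (use smooth_on_subset[OF smooth_g] pos_def_g in auto)

text \<open>If s(x1) differs from s(p), let \<open>z\<close> be a point nearest to \<open>x1\<close>
  where s = s(p). As \<open>p\<close> competes, \<open>z\<close> is closer than R/3, so the open
  ball about \<open>x1\<close> reaching to \<open>z\<close> stays within 2R/3 of \<open>p\<close>
  and there s > s(p). This contradicts \<open>no_touching_sphere\<close>.\<close>

lemma strong_maximum_principle:
  assumes s: "smooth_on \<Omega> s" and R: "ball p R \<subseteq> \<Omega>"
    and sup: "\<And>x. x \<in> \<Omega> \<Longrightarrow> lap g s x \<le> 0" and min: "\<And>x. x \<in> ball p R \<Longrightarrow> s p \<le> s x"
    and x1: "x1 \<in> ball p (R/3)"
  shows "s x1 = s p"
proof (rule ccontr)
  assume neq: "s x1 \<noteq> s p"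
  have Rp: "R > 0" using x1 zero_le_dist[of p x1] unfolding mem_ball by linarith
  have c\<Omega>: "cball p (2*R/3) \<subseteq> \<Omega>" using R Rp by (auto simp: subset_eq)
  define Z where "Z = {x \<in> cball p (2*R/3). s x = s p}"
  have "closed Z"
  proof -
    have "Z = cball p (2*R/3) \<inter> s -` {s p}" by (auto simp: Z_def)
    then show ?thesis
      using continuous_closed_preimage[OF continuous_on_subset[OF smooth_on_continuous[OF s] c\<Omega>] closed_cball closed_singleton]
      by simp
  qed
  moreover have pZ: "p \<in> Z" using Rp by (simp add: Z_def)
  ultimately obtain z where z: "z \<in> Z" "\<And>x. x \<in> Z \<Longrightarrow> dist x1 z \<le> dist x1 x"
    using distance_attains_inf[of Z x1] by auto
  define d where "d = dist x1 z"
  have dpos: "d > 0" using neq z(1) by (auto simp: d_def Z_def)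
  have dR: "d < R/3" using z(2)[OF pZ] x1 by (simp add: d_def dist_commute)
  have gt: "s p < s x" if "dist x1 x < d" for x
  proof -
    have "dist p x < 2*R/3" using dist_triangle[of p x x1] x1 that dR by simp
    moreover have "x \<notin> Z" using z(2)[of x] that by (auto simp: d_def)
    ultimately show ?thesis using min[of x] Rp by (auto simp: Z_def order_less_le)
  qed
  \<comment> \<open>The ball about the midpoint of \<open>x1\<close> and \<open>z\<close> with half
    the radius meets the level set only at \<open>z\<close>, as strict touching requires.\<close>
  define y where "y = (1/2) *\<^sub>R (x1 + z)"
  define w where "w = (1/2) *\<^sub>R (x1 - z)"
  have yw: "y + w = x1" "y - w = z"
    by (simp_all add: y_def w_def scaleR_add_right scaleR_diff_right flip: scaleR_left.add)
  have nw: "norm w = d/2" by (simp add: w_def d_def dist_norm)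
  interpret B: coord_metric "ball p R" g by (rule coord_metric_subset[OF open_ball R])
  show False
  proof (rule B.no_touching_sphere[OF smooth_on_subset[OF s R]])
    show "0 < d/2" using dpos by simp
    show "z \<in> ball p R" using z(1) Rp by (auto simp: Z_def)
    have "dist y z = norm w" unfolding yw(2)[symmetric] by (simp add: dist_norm)
    then show "dist y z = d/2" using nw by simp
    show "lap g s x \<le> 0" if "x \<in> ball p R" for x using sup that R by auto
    have sz: "s z = s p" using z(1) by (simp add: Z_def)
    show "s z \<le> s x" if "x \<in> ball p R" for x using min[OF that] sz by simp
    show "s z < s x" if "dist y x \<le> d/2" "x \<noteq> z" for x
      using gt[of x] internally_tangent_ball[OF that(1) _ nw] that(2) yw sz by simp
  qed
qed

end

section \<open>Riemannian manifolds\<close>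

lemma continuous_map_locally:
  assumes "\<And>p. p \<in> topspace X \<Longrightarrow> \<exists>W. openin X W \<and> p \<in> W \<and> continuous_map (subtopology X W) Y F"
  shows "continuous_map X Y F"
  unfolding continuous_map_def
proof (intro conjI allI impI)
  show "F \<in> topspace X \<rightarrow> topspace Y"
  proof
    fix p assume p: "p \<in> topspace X"
    then obtain W where "p \<in> W" "continuous_map (subtopology X W) Y F" using assms by blast
    then show "F p \<in> topspace Y" using p by (auto simp: continuous_map_def)
  qed
  fix U assume U: "openin Y U"
  show "openin X {x \<in> topspace X. F x \<in> U}"
  proof (subst openin_subopen, intro ballI)
    fix p assume p: "p \<in> {x \<in> topspace X. F x \<in> U}"
    then obtain W where W: "openin X W" "p \<in> W" "continuous_map (subtopology X W) Y F" using assms by blast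
    have "openin (subtopology X W) {x \<in> topspace (subtopology X W). F x \<in> U}"
      using openin_continuous_map_preimage[OF W(3) U] .
    then have "openin X {x \<in> topspace (subtopology X W). F x \<in> U}" using W(1) openin_trans_full by blast
    then show "\<exists>T. openin X T \<and> p \<in> T \<and> T \<subseteq> {x \<in> topspace X. F x \<in> U}"
      using p W(2) by (intro exI[of _ "{x \<in> topspace (subtopology X W). F x \<in> U}"]) auto
  qed
qed

lemma compactin_attains_min:
  fixes F :: "'a \<Rightarrow> real"
  assumes "compactin X K" "K \<noteq> {}" "continuous_map X euclideanreal F"
  shows "\<exists>p\<in>K. \<forall>q\<in>K. F p \<le> F q"
proof -
  have "compact (F ` K)" using image_compactin[OF assms(1,3)] by simp
  then show ?thesis using compact_attains_inf[of "F ` K"] assms(2) by auto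
qed

locale riem =
  fixes M :: "('a, 'm::finite) manifold" and g :: "('a, 'm) tensor2"
  assumes riem: "riemannian_manifold M g"
begin

abbreviation loc_metric where "loc_metric c \<equiv> g c \<circ> chart_inv c"

section \<open>Charts and their topology\<close>

lemma charts:
  assumes "c \<in> atlas M"
  shows "openin (mtop M) (fst c)" "open (snd c ` fst c)"
    "homeomorphic_map (subtopology (mtop M) (fst c)) (top_of_set (snd c ` fst c)) (snd c)"
  using riem assms unfolding riemannian_manifold_def smooth_manifold_def is_chart_def by auto

lemma chart_topspace: "c \<in> atlas M \<Longrightarrow> topspace (subtopology (mtop M) (fst c)) = fst c"
  by (simp add: Int_absorb1 openin_subset charts(1))

lemma chart_inj: "c \<in> atlas M \<Longrightarrow> inj_on (snd c) (fst c)"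
  using homeomorphic_imp_injective_map[OF charts(3)] chart_topspace by metis

lemma chart_inv_left: "c \<in> atlas M \<Longrightarrow> p \<in> fst c \<Longrightarrow> chart_inv c (snd c p) = p"
  unfolding chart_inv_def by (simp add: chart_inj)

lemma chart_inv_right: "x \<in> snd c ` fst c \<Longrightarrow> snd c (chart_inv c x) = x"
  unfolding chart_inv_def by (rule f_inv_into_f)

lemma chart_inv_in: "x \<in> snd c ` fst c \<Longrightarrow> chart_inv c x \<in> fst c"
  unfolding chart_inv_def by (rule inv_into_into)

lemma chart_exists: "p \<in> points M \<Longrightarrow> \<exists>c\<in>atlas M. p \<in> fst c"
  using riem unfolding riemannian_manifold_def smooth_manifold_def by blast

lemma chart_at: "p \<in> points M \<Longrightarrow> chart_at M p \<in> atlas M \<and> p \<in> fst (chart_at M p)"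
  unfolding chart_at_def using someI_ex[of "\<lambda>c. c \<in> atlas M \<and> p \<in> fst c"] chart_exists by blast

lemma chart_in_points: "c \<in> atlas M \<Longrightarrow> p \<in> fst c \<Longrightarrow> p \<in> points M"
  using openin_subset[OF charts(1)] by blast

lemma chart_open_image:
  assumes c: "c \<in> atlas M" and W: "openin (mtop M) W" "W \<subseteq> fst c"
  shows "open (snd c ` W)"
proof -
  have "openin (subtopology (mtop M) (fst c)) W" using W openin_subset_topspace_eq openin_subtopology by (metis inf.absorb1)
  then have "openin (top_of_set (snd c ` fst c)) (snd c ` W)"
    using homeomorphic_imp_open_map[OF charts(3)[OF c]] unfolding open_map_def by blast
  then show ?thesis using charts(2)[OF c] by (simp add: openin_open_eq)
qed

lemma chart_open_preimage:
  assumes c: "c \<in> atlas M" and B: "open B"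
  shows "openin (mtop M) {p \<in> fst c. snd c p \<in> B}"
proof -
  have "openin (subtopology (mtop M) (fst c)) {p \<in> topspace (subtopology (mtop M) (fst c)). snd c p \<in> (snd c ` fst c) \<inter> B}"
    by (rule openin_continuous_map_preimage[OF homeomorphic_imp_continuous_map[OF charts(3)[OF c]]])
      (use B in \<open>simp add: openin_open_Int\<close>)
  then have "openin (subtopology (mtop M) (fst c)) {p \<in> fst c. snd c p \<in> B}"
    unfolding chart_topspace[OF c] by (rule back_subst[of "openin _"]) auto
  then show ?thesis using openin_trans_full charts(1)[OF c] by blast
qed

lemma metric:
  assumes "c \<in> atlas M"
  shows "smooth_on (snd c ` fst c) (loc_metric c)" "p \<in> fst c \<Longrightarrow> pos_def (g c p)"
  using riem assms unfolding riemannian_manifold_def riemannian_metric_def pos_def_def by auto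

lemma coord_metric_chart:
  assumes c: "c \<in> atlas M"
  shows "coord_metric (snd c ` fst c) (loc_metric c)"
proof unfold_locales
  show "open (snd c ` fst c)" by (rule charts(2)[OF c])
  show "smooth_on (snd c ` fst c) (loc_metric c)" by (rule metric(1)[OF c])
  show "pos_def (loc_metric c x)" if "x \<in> snd c ` fst c" for x
    using metric(2)[OF c chart_inv_in[OF that]] by simp
qed

lemma smooth_fun_chart: "smooth_fun M F \<Longrightarrow> c \<in> atlas M \<Longrightarrow> smooth_on (snd c ` fst c) (F \<circ> chart_inv c)"
  by (simp add: smooth_fun_def)

section \<open>Translation of the chart-wise definitions into coordinate operators\<close>

lemma chart_deriv_pd: "chart_deriv c i F p = pd i (F \<circ> chart_inv c) (snd c p)"
  by (simp add: chart_deriv_def pd_def)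

lemma metric_trace_inner: "metric_trace g c p T = matrix_inv (g c p) \<bullet> T"
  by (simp add: metric_trace_def inner_matrix)

lemma christoffel_conn:
  assumes "c \<in> atlas M" "p \<in> fst c"
  shows "christoffel g c k i j p = conn (loc_metric c) i (snd c p) $ k $ j"
  by (simp add: christoffel_def conn_def chart_deriv_pd chart_inv_left[OF assms] o_def)

lemma ricci_ric:
  assumes c: "c \<in> atlas M" and p: "p \<in> fst c"
  shows "ricci g c p = ric (loc_metric c) (snd c p)"
proof -
  interpret coord_metric "snd c ` fst c" "loc_metric c" by (rule coord_metric_chart[OF c])
  have x: "snd c p \<in> snd c ` fst c" using p by simp
  have "chart_deriv c i (christoffel g c l j k) p = pd i (conn (loc_metric c) j) (snd c p) $ l $ k" for i j k l
  proof -
    have "chart_deriv c i (christoffel g c l j k) p = pd i (\<lambda>x. conn (loc_metric c) j x $ l $ k) (snd c p)"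
      unfolding chart_deriv_pd
      by (rule pd_cong[OF open_\<Omega> x]) (simp add: christoffel_conn[OF c chart_inv_in] chart_inv_right)
    then show ?thesis
      using pd_nth[OF smooth_differentiable[OF smooth_conn x]] pd_nth[OF smooth_differentiable[OF smooth_on_nth[OF open_\<Omega> smooth_conn] x]] by simp
  qed
  then show ?thesis
    by (simp add: vec_eq_iff ricci_def ric_def riemann_def curv_def christoffel_conn[OF c p] matrix_mult_nth sum_subtractf sum.distrib)
qed

lemma hessian_hess:
  assumes c: "c \<in> atlas M" and p: "p \<in> fst c" and F: "smooth_fun M F"
  shows "hessian g c F p = hess (loc_metric c) (F \<circ> chart_inv c) (snd c p)"
proof -
  interpret coord_metric "snd c ` fst c" "loc_metric c" by (rule coord_metric_chart[OF c])
  have x: "snd c p \<in> snd c ` fst c" using p by simp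
  have "chart_deriv c i (chart_deriv c j F) p = pd i (dl (F \<circ> chart_inv c)) (snd c p) $ j" for i j
  proof -
    have "chart_deriv c i (chart_deriv c j F) p = pd i (\<lambda>x. dl (F \<circ> chart_inv c) x $ j) (snd c p)"
      unfolding chart_deriv_pd[of _ i]
      by (rule pd_cong[OF open_\<Omega> x]) (simp add: chart_deriv_pd chart_inv_right dl_def)
    then show ?thesis
      using pd_nth[OF smooth_differentiable[OF smooth_dl[OF smooth_fun_chart[OF F c]] x]] by simp
  qed
  then show ?thesis
    by (simp add: vec_eq_iff hessian_def hess_def cov1_def matrix_vector_mult_nth transpose_nth
        christoffel_conn[OF c p] chart_deriv_pd dl_def)
qed

lemma gradient_dl:
  "gradient g c F p = matrix_inv (g c p) *v dl (F \<circ> chart_inv c) (snd c p)"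
  by (simp add: gradient_def chart_deriv_pd dl_def)

text \<open>The transformation law of the metric says that the transition map is an isometry of the
  coordinate metrics, so \<open>lap_comp\<close> applies on the overlap.\<close>

lemma lap_chart_change:
  assumes c: "c \<in> atlas M" and d: "d \<in> atlas M" and p: "p \<in> fst c" "p \<in> fst d" and F: "smooth_fun M F"
  shows "lap (loc_metric c) (F \<circ> chart_inv c) (snd c p) = lap (loc_metric d) (F \<circ> chart_inv d) (snd d p)"
proof -
  let ?\<Omega> = "snd c ` (fst c \<inter> fst d)" and ?\<psi> = "snd d \<circ> chart_inv c"
  interpret C: coord_metric "snd c ` fst c" "loc_metric c" by (rule coord_metric_chart[OF c])
  interpret D: coord_metric "snd d ` fst d" "loc_metric d" by (rule coord_metric_chart[OF d])
  have op: "open ?\<Omega>" by (intro chart_open_image[OF c] openin_Int charts(1) c d Int_lower1)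
  interpret S: coord_metric ?\<Omega> "loc_metric c" by (rule C.coord_metric_subset[OF op]) auto
  have sm: "smooth_on ?\<Omega> ?\<psi>"
    using riem c d unfolding riemannian_manifold_def smooth_manifold_def by blast
  have inv: "chart_inv c x \<in> fst c \<inter> fst d" "snd c (chart_inv c x) = x" if "x \<in> ?\<Omega>" for x
    using that chart_inv_left[OF c] by auto
  interpret I: coord_isometry ?\<Omega> "loc_metric c" "snd d ` fst d" "loc_metric d" ?\<psi>
  proof unfold_locales
    show "smooth_on ?\<Omega> ?\<psi>" by (rule sm)
    show "?\<psi> x \<in> snd d ` fst d" if "x \<in> ?\<Omega>" for x using inv[OF that] by auto
    show "loc_metric c x = pb (loc_metric d) ?\<psi> x" if x: "x \<in> ?\<Omega>" for x
    proof -
      have J: "jacobian ?\<psi> (at x) = jac ?\<psi> x"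
        by (simp add: jacobian_def matrix_def jac_def pd_def)
      have "g c (chart_inv c x) = transpose (jacobian ?\<psi> (at (snd c (chart_inv c x)))) ** g d (chart_inv c x)
          ** jacobian ?\<psi> (at (snd c (chart_inv c x)))"
        using riem c d inv(1)[OF x] unfolding riemannian_manifold_def riemannian_metric_def Let_def by blast
      then show ?thesis
        using inv[OF x] by (simp add: J pb_def chart_inv_left[OF d])
    qed
  qed
  have x: "snd c p \<in> ?\<Omega>" using p by auto
  have "lap (loc_metric c) (F \<circ> chart_inv c) (snd c p) = lap (loc_metric d) (F \<circ> chart_inv d) (?\<psi> (snd c p))"
  proof (rule I.lap_comp[OF smooth_fun_chart[OF F d] smooth_on_subset[OF smooth_fun_chart[OF F c]] _ x])
    show "(F \<circ> chart_inv c) y = (F \<circ> chart_inv d) (?\<psi> y)" if "y \<in> ?\<Omega>" for y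
      using inv[OF that] by (simp add: chart_inv_left[OF d])
  qed auto
  then show ?thesis by (simp add: chart_inv_left[OF c p(1)])
qed

lemma laplacian_lap:
  assumes c: "c \<in> atlas M" and p: "p \<in> fst c" and F: "smooth_fun M F"
  shows "laplacian M g F p = lap (loc_metric c) (F \<circ> chart_inv c) (snd c p)"
proof -
  let ?d = "chart_at M p"
  have d: "?d \<in> atlas M" "p \<in> fst ?d" using chart_at chart_in_points[OF c p] by auto
  have "laplacian M g F p = lap (loc_metric ?d) (F \<circ> chart_inv ?d) (snd ?d p)"
    by (simp add: laplacian_def Let_def metric_trace_inner hessian_hess[OF d F] lap_def chart_inv_left[OF d])
  then show ?thesis using lap_chart_change[OF c d(1) p d(2) F] by simp
qed

lemma continuous_map_chart:
  assumes "\<And>c. c \<in> atlas M \<Longrightarrow> continuous_on (snd c ` fst c) (F \<circ> chart_inv c)"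
  shows "continuous_map (mtop M) euclidean F"
proof (rule continuous_map_locally)
  fix p assume "p \<in> points M"
  then obtain c where c: "c \<in> atlas M" "p \<in> fst c" using chart_exists by blast
  have "continuous_map (subtopology (mtop M) (fst c)) euclidean ((F \<circ> chart_inv c) \<circ> snd c)"
    by (rule continuous_map_compose[OF homeomorphic_imp_continuous_map[OF charts(3)[OF c(1)]]])
      (use assms[OF c(1)] in simp)
  then have "continuous_map (subtopology (mtop M) (fst c)) euclidean F"
    by (rule continuous_map_eq) (use chart_topspace[OF c(1)] chart_inv_left[OF c(1)] in auto)
  then show "\<exists>W. openin (mtop M) W \<and> p \<in> W \<and> continuous_map (subtopology (mtop M) W) euclidean F"
    using charts(1) c by blast
qed

lemma continuous_smooth_fun: "smooth_fun M F \<Longrightarrow> continuous_map (mtop M) euclidean F"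
  by (rule continuous_map_chart) (rule smooth_on_continuous[OF smooth_fun_chart])

text \<open>The chosen chart may jump with the point; chart independence allows one fixed chart to
  be used on its whole domain.\<close>

lemma continuous_laplacian:
  assumes F: "smooth_fun M F"
  shows "continuous_map (mtop M) euclidean (laplacian M g F)"
proof (rule continuous_map_chart)
  fix c assume c: "c \<in> atlas M"
  interpret coord_metric "snd c ` fst c" "loc_metric c" by (rule coord_metric_chart[OF c])
  have "continuous_on (snd c ` fst c) (lap (loc_metric c) (F \<circ> chart_inv c))"
    by (rule smooth_on_continuous[OF smooth_lap[OF smooth_fun_chart[OF F c]]])
  then show "continuous_on (snd c ` fst c) (laplacian M g F \<circ> chart_inv c)"
    by (rule continuous_on_eq) (simp add: laplacian_lap[OF c chart_inv_in F] chart_inv_right)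
qed

text \<open>If the set \<open>K\<close> of points where \<open>s\<close> is not locally constant were nonempty, then a minimum of
  \<open>s\<close> over the compact \<open>K\<close> would be a local minimum of \<open>s\<close>: level sets below this minimum miss
  \<open>K\<close>, so they are open and closed in each coordinate ball.\<close>

lemma superharmonic_locally_constant:
  assumes cpt: "compact_space (mtop M)" and s: "smooth_fun M s"
    and sup: "\<And>p. p \<in> points M \<Longrightarrow> laplacian M g s p \<le> 0" and p0: "p0 \<in> points M"
  shows "\<exists>W. openin (mtop M) W \<and> p0 \<in> W \<and> (\<forall>q\<in>W. s q = s p0)"
proof (rule ccontr)
  assume no: "\<not> ?thesis"
  let ?lc = "\<lambda>W. openin (mtop M) W \<and> (\<forall>q\<in>W. \<forall>q'\<in>W. s q = s q')"
  define K where "K = points M - \<Union>{W. ?lc W}"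
  have "openin (mtop M) (\<Union>{W. ?lc W})" by (rule openin_Union) auto
  then have "closedin (mtop M) K" unfolding K_def by (simp add: closedin_diff)
  then have cK: "compactin (mtop M) K" by (rule closedin_compact_space[OF cpt])
  have "p0 \<in> K" using no p0 by (auto simp: K_def)
  then obtain p where p: "p \<in> K" "\<And>q. q \<in> K \<Longrightarrow> s p \<le> s q"
    using compactin_attains_min[OF cK _ continuous_smooth_fun[OF s]] by blast
  have pM: "p \<in> points M" using p(1) by (simp add: K_def)
  obtain c where c: "c \<in> atlas M" "p \<in> fst c" using chart_exists[OF pM] by blast
  let ?s = "s \<circ> chart_inv c" and ?x0 = "snd c p"
  interpret coord_metric "snd c ` fst c" "loc_metric c" by (rule coord_metric_chart[OF c(1)])
  have ss: "smooth_on (snd c ` fst c) ?s" by (rule smooth_fun_chart[OF s c(1)])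
  have sx0: "?s ?x0 = s p" by (simp add: chart_inv_left[OF c])
  obtain R where R: "R > 0" "ball ?x0 R \<subseteq> snd c ` fst c"
    using open_\<Omega> c(2) open_contains_ball by blast
  have min: "?s ?x0 \<le> ?s x" if x: "x \<in> ball ?x0 R" for x
  proof (rule ccontr)
    assume lt: "\<not> ?thesis"
    define L where "L = {y \<in> ball ?x0 R. ?s y = ?s x}"
    have "openin (top_of_set (ball ?x0 R)) L"
    proof (subst openin_subopen, intro ballI)
      fix y assume y: "y \<in> L"
      then have yD: "y \<in> snd c ` fst c" using R by (auto simp: L_def)
      then have q: "chart_inv c y \<in> fst c" "snd c (chart_inv c y) = y"
        by (rule chart_inv_in, rule chart_inv_right)
      have "s (chart_inv c y) < s p" using y lt sx0 by (simp add: L_def)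
      then have "chart_inv c y \<notin> K" using p(2)[of "chart_inv c y"] by fastforce
      then obtain W where W: "?lc W" "chart_inv c y \<in> W"
        using chart_in_points[OF c(1) q(1)] by (auto simp: K_def)
      define V where "V = ball ?x0 R \<inter> snd c ` (W \<inter> fst c)"
      have "open V" unfolding V_def
        by (intro open_Int open_ball chart_open_image[OF c(1)]) (use W charts(1)[OF c(1)] in auto)
      moreover have "y \<in> V" using y q W(2) by (auto simp: V_def L_def intro!: rev_image_eqI[of "chart_inv c y"])
      moreover have "V \<subseteq> L"
      proof
        fix v assume "v \<in> V"
        then obtain r where r: "r \<in> W" "r \<in> fst c" "v = snd c r" "v \<in> ball ?x0 R" by (auto simp: V_def)
        have "s r = s (chart_inv c y)" using W r(1) by blast
        then show "v \<in> L" using r y by (simp add: L_def chart_inv_left[OF c(1)])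
      qed
      ultimately show "\<exists>T. openin (top_of_set (ball ?x0 R)) T \<and> y \<in> T \<and> T \<subseteq> L"
        by (intro exI[of _ V]) (auto simp: V_def openin_open_eq)
    qed
    moreover have "closedin (top_of_set (ball ?x0 R)) L"
      unfolding L_def
      using continuous_closedin_preimage_constant[OF continuous_on_subset[OF smooth_on_continuous[OF ss] R(2)]] by simp
    moreover have "x \<in> L" using x by (simp add: L_def)
    ultimately have "L = ball ?x0 R"
      using connected_ball[of ?x0 R] unfolding connected_clopen by blast
    then have "?x0 \<in> L" using R by simp
    then show False using lt by (simp add: L_def)
  qed
  have const: "?s y = ?s ?x0" if "y \<in> ball ?x0 (R/3)" for y
  proof (rule strong_maximum_principle[OF ss R(2) _ min that])
    show "lap (loc_metric c) ?s x \<le> 0" if x: "x \<in> snd c ` fst c" for x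
      using sup[OF chart_in_points[OF c(1) chart_inv_in[OF x]]] laplacian_lap[OF c(1) chart_inv_in[OF x] s]
      by (simp add: chart_inv_right[OF x])
  qed
  \<comment> \<open>A neighbourhood of \<open>p\<close> on which \<open>s\<close> is constant, which
    contradicts \<open>p \<in> K\<close>.\<close>
  define W where "W = {q \<in> fst c. snd c q \<in> ball ?x0 (R/3)}"
  have wc: "s q = s p" if "q \<in> W" for q
    using const[of "snd c q"] that chart_inv_left[OF c] chart_inv_left[OF c(1), of q] by (simp add: W_def)
  have "\<forall>q\<in>W. \<forall>q'\<in>W. s q = s q'"
    by (intro ballI) (rule trans[OF wc wc[symmetric]])
  moreover have "openin (mtop M) W" unfolding W_def by (rule chart_open_preimage[OF c(1) open_ball])
  moreover have "p \<in> W" using c R by (simp add: W_def)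
  ultimately have "p \<in> \<Union>{W. ?lc W}" by blast
  then show False using p(1) by (simp add: K_def)
qed

end

section \<open>Solitons on manifolds\<close>

locale riem_map = dom: riem M g + cod: riem N h
  for M :: "('a, 'm::finite) manifold" and g and N :: "('b, 'n::finite) manifold" and h +
  fixes u :: "'a \<Rightarrow> 'b"
  assumes smooth_map: "smooth_map M N u"
begin

definition loc_map where "loc_map c d = snd d \<circ> u \<circ> chart_inv c"

lemma map_in_points: "p \<in> points M \<Longrightarrow> u p \<in> points N"
  using smooth_map unfolding smooth_map_def continuous_map_def by auto

lemma openin_map_preimage:
  assumes "c \<in> atlas M" "d \<in> atlas N"
  shows "openin (mtop M) (fst c \<inter> u -` fst d)"
proof -
  have "openin (mtop M) {p \<in> points M. u p \<in> fst d}"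
    using openin_continuous_map_preimage cod.charts(1)[OF assms(2)] smooth_map unfolding smooth_map_def by blast
  then have "openin (mtop M) (fst c \<inter> {p \<in> points M. u p \<in> fst d})"
    using dom.charts(1)[OF assms(1)] by (rule openin_Int[rotated])
  moreover have "fst c \<inter> {p \<in> points M. u p \<in> fst d} = fst c \<inter> u -` fst d"
    using dom.chart_in_points[OF assms(1)] by auto
  ultimately show ?thesis by simp
qed

lemma smooth_loc_map: "c \<in> atlas M \<Longrightarrow> d \<in> atlas N \<Longrightarrow> smooth_on (snd c ` (fst c \<inter> u -` fst d)) (loc_map c d)"
  using smooth_map unfolding smooth_map_def loc_map_def by blast

text \<open>The set \<open>W\<close> is left free so that it can later be cut down to where \<sigma>
  is constant.\<close>

lemma coord_map_chart:
  assumes c: "c \<in> atlas M" and d: "d \<in> atlas N" and W: "openin (mtop M) W" "W \<subseteq> fst c \<inter> u -` fst d"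
  shows "coord_map (snd c ` W) (dom.loc_metric c) (snd d ` fst d) (cod.loc_metric d) (loc_map c d)"
proof -
  interpret C: coord_metric "snd c ` fst c" "dom.loc_metric c" by (rule dom.coord_metric_chart[OF c])
  interpret D: coord_metric "snd d ` fst d" "cod.loc_metric d" by (rule cod.coord_metric_chart[OF d])
  have "open (snd c ` W)" by (rule dom.chart_open_image[OF c W(1)]) (use W in blast)
  then interpret S: coord_metric "snd c ` W" "dom.loc_metric c"
    by (rule C.coord_metric_subset) (use W in blast)
  show ?thesis
  proof unfold_locales
    show "smooth_on (snd c ` W) (loc_map c d)"
      by (rule smooth_on_subset[OF smooth_loc_map[OF c d]]) (use W in blast)
    show "loc_map c d x \<in> snd d ` fst d" if "x \<in> snd c ` W" for x
    proof -
      from that obtain p where p: "p \<in> W" "x = snd c p" by blast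
      then have "p \<in> fst c" "u p \<in> fst d" using W by auto
      then show ?thesis by (simp add: loc_map_def p(2) dom.chart_inv_left[OF c])
    qed
  qed
qed

context
  fixes c d p
  assumes c: "c \<in> atlas M" and d: "d \<in> atlas N" and p: "p \<in> fst c" "u p \<in> fst d"
begin

lemma loc_map_eq: "loc_map c d (snd c p) = snd d (u p)"
  by (simp add: loc_map_def dom.chart_inv_left[OF c p(1)])

lemma map_deriv_jac: "map_deriv c d u p = jac (loc_map c d) (snd c p)"
proof -
  let ?W = "fst c \<inter> u -` fst d"
  interpret S: coord_map "snd c ` ?W" "dom.loc_metric c" "snd d ` fst d" "cod.loc_metric d" "loc_map c d"
    by (rule coord_map_chart[OF c d openin_map_preimage[OF c d] subset_refl])
  have x: "snd c p \<in> snd c ` ?W" using p by auto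
  show ?thesis
    using pd_nth[OF S.dom.smooth_differentiable[OF S.smooth_u x]]
    by (simp add: vec_eq_iff map_deriv_def jac_def dom.chart_deriv_pd loc_map_def o_def)
qed

lemma pullback_pb: "pullback h c d u p = pb (cod.loc_metric d) (loc_map c d) (snd c p)"
  by (simp add: pullback_def pb_def map_deriv_jac loc_map_eq cod.chart_inv_left[OF d p(2)])

lemma second_fundamental_form_sff:
  "second_fundamental_form g h c d u a p $ i $ j
     = sff (dom.loc_metric c) (cod.loc_metric d) (loc_map c d) i (snd c p) $ a $ j"
proof -
  let ?W = "fst c \<inter> u -` fst d" and ?x = "snd c p"
  interpret S: coord_map "snd c ` ?W" "dom.loc_metric c" "snd d ` fst d" "cod.loc_metric d" "loc_map c d"
    by (rule coord_map_chart[OF c d openin_map_preimage[OF c d] subset_refl])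
  have x: "?x \<in> snd c ` ?W" using p by auto
  have 1: "chart_deriv c i (chart_deriv c j (\<lambda>q. snd d (u q) $ a)) p = pd i (jac (loc_map c d)) ?x $ a $ j"
  proof -
    have "chart_deriv c i (chart_deriv c j (\<lambda>q. snd d (u q) $ a)) p = pd i (\<lambda>x. jac (loc_map c d) x $ a $ j) ?x"
      unfolding dom.chart_deriv_pd[of _ i]
    proof (rule pd_cong[OF S.dom.open_\<Omega> x])
      fix y assume y: "y \<in> snd c ` ?W"
      then have "snd c (chart_inv c y) = y" by (intro dom.chart_inv_right) auto
      then show "(chart_deriv c j (\<lambda>q. snd d (u q) $ a) \<circ> chart_inv c) y = jac (loc_map c d) y $ a $ j"
        using pd_nth[OF S.dom.smooth_differentiable[OF S.smooth_u y]]
        by (simp add: dom.chart_deriv_pd jac_def loc_map_def o_def)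
    qed
    then show ?thesis
      using pd_nth[OF S.dom.smooth_differentiable[OF S.smooth_jac x]]
        pd_nth[OF S.dom.smooth_differentiable[OF smooth_on_nth[OF S.dom.open_\<Omega> S.smooth_jac] x]] by simp
  qed
  have 2: "(\<Sum>b\<in>UNIV. \<Sum>e\<in>UNIV. christoffel h d a b e (u p) * jac (loc_map c d) ?x $ b $ i * jac (loc_map c d) ?x $ e $ j)
      = (pull_conn (cod.loc_metric d) (loc_map c d) i ?x ** jac (loc_map c d) ?x) $ a $ j"
    unfolding matrix_mult_nth pull_conn_def
    by (simp add: cod.christoffel_conn[OF d p(2)] sum_distrib_right loc_map_eq)
      (subst sum.swap, simp add: jac_def mult_ac)
  show ?thesis
    unfolding second_fundamental_form_def Let_def map_deriv_jac sff_def
    by (simp add: 1 2 dom.christoffel_conn[OF c p(1)] matrix_mult_nth[of "jac _ _"]) (simp add: mult.commute)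
qed

lemma tension_tens:
  "tension g h c d u p = tens (dom.loc_metric c) (cod.loc_metric d) (loc_map c d) (snd c p)"
  by (simp add: vec_eq_iff tension_def tens_def metric_trace_def second_fundamental_form_sff
      dom.chart_inv_left[OF c p(1)])

end

end

locale riem_soliton = riem_map M g N h u
  for M :: "('a, 'm::finite) manifold" and g and N :: "('b, 'n::finite) manifold" and h and u +
  fixes \<alpha> :: real and f \<sigma> :: "'a \<Rightarrow> real"
  assumes \<alpha>: "\<alpha> > 0" and soliton: "gradient_almost_RH_soliton \<alpha> M N h g u f \<sigma>"
begin

lemma smooth_f: "smooth_fun M f" and smooth_\<sigma>: "smooth_fun M \<sigma>"
  using soliton by (simp_all add: gradient_almost_RH_soliton_def)

lemma soliton_eq:
  assumes "c \<in> atlas M" "d \<in> atlas N" "p \<in> fst c" "u p \<in> fst d"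
  shows "ricci g c p - \<alpha> *\<^sub>R pullback h c d u p + hessian g c f p = \<sigma> p *\<^sub>R g c p"
    "tension g h c d u p = map_deriv c d u p *v gradient g c f p"
  using soliton assms unfolding gradient_almost_RH_soliton_def by auto

text \<open>The trace of the soliton equation in the chosen charts. It trades curvature and energy
  for a Laplacian, already known to be chart independent and continuous.\<close>

lemma soliton_S_eq:
  assumes p: "p \<in> points M"
  shows "soliton_S \<alpha> M N h g u p = real CARD('m) * \<sigma> p - laplacian M g f p"
proof -
  let ?c = "chart_at M p" and ?d = "chart_at N (u p)"
  have c: "?c \<in> atlas M" "p \<in> fst ?c" and d: "?d \<in> atlas N" "u p \<in> fst ?d"
    using dom.chart_at[OF p] cod.chart_at[OF map_in_points[OF p]] by auto
  interpret coord_metric "snd ?c ` fst ?c" "dom.loc_metric ?c" by (rule dom.coord_metric_chart[OF c(1)])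
  have "matrix_inv (g ?c p) \<bullet> g ?c p = real CARD('m)"
    using inner_G_g[of "snd ?c p"] c by (simp add: dom.chart_inv_left[OF c])
  moreover have "ricci g ?c p - \<alpha> *\<^sub>R pullback h ?c ?d u p = \<sigma> p *\<^sub>R g ?c p - hessian g ?c f p"
    using soliton_eq(1)[OF c(1) d(1) c(2) d(2)] by (simp add: algebra_simps)
  then have "matrix_inv (g ?c p) \<bullet> ricci g ?c p - \<alpha> * (matrix_inv (g ?c p) \<bullet> pullback h ?c ?d u p)
      = \<sigma> p * (matrix_inv (g ?c p) \<bullet> g ?c p) - matrix_inv (g ?c p) \<bullet> hessian g ?c f p"
    by (metis inner_diff_right inner_scaleR_right)
  ultimately show ?thesis
    by (simp add: soliton_S_def scalar_curvature_def energy_density_def laplacian_def Let_def dom.metric_trace_inner)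
qed

text \<open>Transfers \<open>local_min_S\<close>: on a small enough \<open>V\<close> one chart of
  each manifold suffices and \<sigma> is the constant \<open>\<sigma> p\<close>.\<close>

lemma soliton_S_local_min:
  assumes W: "openin (mtop M) W" "p \<in> W"
    and const: "\<And>q. q \<in> W \<Longrightarrow> \<sigma> q = \<sigma> p"
    and min: "\<And>q. q \<in> W \<Longrightarrow> soliton_S \<alpha> M N h g u p \<le> soliton_S \<alpha> M N h g u q"
  shows "(soliton_S \<alpha> M N h g u p)\<^sup>2 \<le> real CARD('m) * \<sigma> p * soliton_S \<alpha> M N h g u p"
proof -
  have pM: "p \<in> points M" using openin_subset W by blast
  obtain c where c: "c \<in> atlas M" "p \<in> fst c" using dom.chart_exists[OF pM] by blast
  obtain d where d: "d \<in> atlas N" "u p \<in> fst d" using cod.chart_exists[OF map_in_points[OF pM]] by blast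
  define V where "V = W \<inter> (fst c \<inter> u -` fst d)"
  have V: "openin (mtop M) V" "V \<subseteq> fst c \<inter> u -` fst d" "p \<in> V"
    unfolding V_def using W openin_map_preimage[OF c(1) d(1)] c d by (auto intro: openin_Int)
  interpret I: coord_map "snd c ` V" "dom.loc_metric c" "snd d ` fst d" "cod.loc_metric d" "loc_map c d"
    by (rule coord_map_chart[OF c(1) d(1) V(1,2)])
  let ?f = "f \<circ> chart_inv c"
  interpret L: coord_soliton "snd c ` V" "dom.loc_metric c" "snd d ` fst d" "cod.loc_metric d" "loc_map c d" ?f \<alpha> "\<sigma> p"
  proof unfold_locales
    show "smooth_on (snd c ` V) ?f"
      by (rule smooth_on_subset[OF dom.smooth_fun_chart[OF smooth_f c(1)]]) (use V in blast)
    show "\<alpha> > 0" by (rule \<alpha>)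
    fix x assume "x \<in> snd c ` V"
    then obtain q where q: "q \<in> V" "x = snd c q" by blast
    then have qc: "q \<in> fst c" "u q \<in> fst d" "q \<in> W" using V by (auto simp: V_def)
    note eq = soliton_eq[OF c(1) d(1) qc(1,2)]
    show "ric (dom.loc_metric c) x - \<alpha> *\<^sub>R pb (cod.loc_metric d) (loc_map c d) x + hess (dom.loc_metric c) ?f x
        = \<sigma> p *\<^sub>R dom.loc_metric c x"
      using eq(1) unfolding dom.ricci_ric[OF c(1) qc(1)] pullback_pb[OF c(1) d(1) qc(1,2)]
        dom.hessian_hess[OF c(1) qc(1) smooth_f] const[OF qc(3)]
      by (simp add: q(2) dom.chart_inv_left[OF c(1) qc(1)])
    show "tens (dom.loc_metric c) (cod.loc_metric d) (loc_map c d) x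
        = jac (loc_map c d) x *v (matrix_inv (dom.loc_metric c x) *v dl ?f x)"
      using eq(2) unfolding tension_tens[OF c(1) d(1) qc(1,2)] map_deriv_jac[OF c(1) d(1) qc(1,2)] dom.gradient_dl
      by (simp add: q(2) dom.chart_inv_left[OF c(1) qc(1)])
  qed
  have S: "L.S (snd c q) = soliton_S \<alpha> M N h g u q" if q: "q \<in> V" for q
  proof -
    have qc: "q \<in> fst c" "q \<in> W" using q V by (auto simp: V_def)
    show ?thesis
      using soliton_S_eq[OF dom.chart_in_points[OF c(1) qc(1)]] const[OF qc(2)]
      by (simp add: L.S_def dom.laplacian_lap[OF c(1) qc(1) smooth_f])
  qed
  have "(L.S (snd c p))\<^sup>2 \<le> real CARD('m) * \<sigma> p * L.S (snd c p)"
  proof (rule L.local_min_S)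
    show "snd c p \<in> snd c ` V" using V by blast
    show "L.S (snd c p) \<le> L.S y" if "y \<in> snd c ` V" for y
    proof -
      from that obtain q where q: "q \<in> V" "y = snd c q" by blast
      then have "q \<in> W" by (simp add: V_def)
      then show ?thesis using min S[OF q(1)] S[OF V(3)] q(2) by simp
    qed
  qed
  then show ?thesis by (simp add: S[OF V(3)])
qed

lemma continuous_soliton_S: "continuous_map (mtop M) euclidean (soliton_S \<alpha> M N h g u)"
proof (rule continuous_map_eq)
  show "continuous_map (mtop M) euclidean (\<lambda>p. real CARD('m) * \<sigma> p - laplacian M g f p)"
    by (intro continuous_map_diff continuous_map_real_mult continuous_map_const[THEN iffD2]
        dom.continuous_smooth_fun smooth_\<sigma> dom.continuous_laplacian smooth_f) auto
qed (simp add: soliton_S_eq)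

end

text \<open>The hypothesis says a(a - b) <= 0.\<close>

lemma between_0_if_square_le:
  fixes a b :: real
  assumes "a\<^sup>2 \<le> b * a"
  shows "b = 0 \<Longrightarrow> a = 0" "b > 0 \<Longrightarrow> 0 \<le> a \<and> a \<le> b" "b < 0 \<Longrightarrow> b \<le> a \<and> a \<le> 0"
proof -
  have "a * (a - b) \<le> 0" using assms by (simp add: power2_eq_square algebra_simps)
  then show "b = 0 \<Longrightarrow> a = 0" "b > 0 \<Longrightarrow> 0 \<le> a \<and> a \<le> b" "b < 0 \<Longrightarrow> b \<le> a \<and> a \<le> 0"
    by (auto simp: mult_le_0_iff)
qed

theorem theorem2p1:
  fixes M :: "('a, 'm::finite) manifold" and g :: "('a, 'm) tensor2"
    and N :: "('b, 'n::finite) manifold" and h :: "('b, 'n) tensor2"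
    and \<alpha> :: real and u :: "'a \<Rightarrow> 'b" and f \<sigma> S :: "'a \<Rightarrow> real"
    and m S_min \<sigma>_inf \<sigma>_sup :: real
  assumes "riemannian_manifold M g" and "compact_space (mtop M)" and "points M \<noteq> {}"
    and "riemannian_manifold N h"
    and "\<alpha> > 0"
    and "gradient_almost_RH_soliton \<alpha> M N h g u f \<sigma>"
    and "\<forall>p\<in>points M. laplacian M g \<sigma> p \<le> 0"
  defines "m \<equiv> real CARD('m)"
    and "S \<equiv> soliton_S \<alpha> M N h g u"
    and "S_min \<equiv> (LEAST s. s \<in> S ` points M)"
    and "\<sigma>_inf \<equiv> (INF p\<in>points M. \<sigma> p)"
    and "\<sigma>_sup \<equiv> (SUP p\<in>points M. \<sigma> p)"
  shows "(steady M \<sigma> \<longrightarrow> S_min = 0)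
    \<and> (shrinking M \<sigma> \<and> (\<forall>p\<in>points M. 0 < \<sigma> p \<and> \<sigma> p \<le> \<sigma>_sup) \<longrightarrow>
         0 \<le> S_min \<and> S_min \<le> m * \<sigma>_sup \<and> (\<forall>p\<in>points M. 0 \<le> S p))
    \<and> (expanding M \<sigma> \<and> (\<forall>p\<in>points M. \<sigma>_inf \<le> \<sigma> p \<and> \<sigma> p < 0) \<longrightarrow>
         m * \<sigma>_inf \<le> S_min \<and> S_min \<le> 0 \<and> (\<forall>p\<in>points M. m * \<sigma> p \<le> S p))"
proof -
  interpret riem_soliton M g N h u \<alpha> f \<sigma>
    by unfold_locales (use assms(1,4-6) in \<open>simp_all add: gradient_almost_RH_soliton_def\<close>)
  have m0: "m > 0" by (simp add: m_def)
  have cpt: "compactin (mtop M) (points M)" using assms(2) by (simp add: compact_space_def)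
  have locconst: "\<exists>W. openin (mtop M) W \<and> p \<in> W \<and> (\<forall>q\<in>W. \<sigma> q = \<sigma> p)" if "p \<in> points M" for p
    using dom.superharmonic_locally_constant[OF assms(2) smooth_\<sigma> _ that] assms(7) by blast
  have sq: "(S p)\<^sup>2 \<le> (m * \<sigma> p) * S p"
    if p: "p \<in> points M" and W: "openin (mtop M) W" "p \<in> W" "\<And>q. q \<in> W \<Longrightarrow> \<sigma> q = \<sigma> p \<and> S p \<le> S q" for p W
    using soliton_S_local_min[OF W(1,2)] W(3) by (simp add: S_def m_def)
  obtain p0 where p0: "p0 \<in> points M" "\<And>q. q \<in> points M \<Longrightarrow> S p0 \<le> S q"
    using compactin_attains_min[OF cpt assms(3) continuous_soliton_S] by (auto simp: S_def)
  \<comment> \<open>\<open>LEAST\<close> denotes the minimum because compactness makes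
    \<open>S\<close> attain it.\<close>
  have Smin: "S_min = S p0"
    unfolding S_min_def by (rule Least_equality) (use p0 in auto)
  obtain W0 where W0: "openin (mtop M) W0" "p0 \<in> W0" "\<forall>q\<in>W0. \<sigma> q = \<sigma> p0" using locconst[OF p0(1)] by blast
  have "(S p0)\<^sup>2 \<le> (m * \<sigma> p0) * S p0"
    by (rule sq[OF p0(1) W0(1,2)]) (use W0 p0(2) openin_subset[OF W0(1)] in blast)
  note bounds0 = between_0_if_square_le[OF this]
  \<comment> \<open>For the pointwise bound: near a minimum of S - m \<sigma> the subtracted term is
    constant, so \<open>S\<close> itself has a local minimum there and the same estimate
    applies.\<close>
  have "continuous_map (mtop M) euclidean (\<lambda>p. S p - m * \<sigma> p)"
    unfolding S_def
    by (intro continuous_map_diff continuous_map_real_mult continuous_map_const[THEN iffD2]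
        dom.continuous_smooth_fun smooth_\<sigma> continuous_soliton_S) auto
  then obtain p1 where p1: "p1 \<in> points M" "\<And>q. q \<in> points M \<Longrightarrow> S p1 - m * \<sigma> p1 \<le> S q - m * \<sigma> q"
    using compactin_attains_min[OF cpt assms(3)] by blast
  obtain W1 where W1: "openin (mtop M) W1" "p1 \<in> W1" "\<forall>q\<in>W1. \<sigma> q = \<sigma> p1" using locconst[OF p1(1)] by blast
  have "(S p1)\<^sup>2 \<le> (m * \<sigma> p1) * S p1"
  proof (rule sq[OF p1(1) W1(1,2)])
    fix q assume q: "q \<in> W1"
    then have "q \<in> points M" using openin_subset[OF W1(1)] by blast
    then show "\<sigma> q = \<sigma> p1 \<and> S p1 \<le> S q" using p1(2)[of q] W1(3) q by simp
  qed
  note bounds1 = between_0_if_square_le[OF this]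
  show ?thesis
  proof (intro conjI impI)
    assume "steady M \<sigma>"
    then show "S_min = 0" using bounds0(1) p0(1) by (simp add: steady_def Smin)
  next
    assume a: "shrinking M \<sigma> \<and> (\<forall>p\<in>points M. 0 < \<sigma> p \<and> \<sigma> p \<le> \<sigma>_sup)"
    then have b: "0 \<le> S p0 \<and> S p0 \<le> m * \<sigma> p0" using bounds0(2) p0(1) m0 by simp
    then show "0 \<le> S_min" by (simp add: Smin)
    have "m * \<sigma> p0 \<le> m * \<sigma>_sup" using a p0(1) m0 by simp
    then show "S_min \<le> m * \<sigma>_sup" using b by (simp add: Smin)
    show "\<forall>p\<in>points M. 0 \<le> S p" using b p0(2) order_trans by blast
  next
    assume a: "expanding M \<sigma> \<and> (\<forall>p\<in>points M. \<sigma>_inf \<le> \<sigma> p \<and> \<sigma> p < 0)"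
    then have neg: "m * \<sigma> p < 0" if "p \<in> points M" for p using that m0 by (simp add: mult_pos_neg)
    have b: "m * \<sigma> p0 \<le> S p0 \<and> S p0 \<le> 0" using bounds0(3) neg[OF p0(1)] by simp
    have "m * \<sigma>_inf \<le> m * \<sigma> p0" using a p0(1) m0 by simp
    then show "m * \<sigma>_inf \<le> S_min" using b by (simp add: Smin)
    show "S_min \<le> 0" using b by (simp add: Smin)
    have "m * \<sigma> p1 \<le> S p1" using bounds1(3) neg[OF p1(1)] by simp
    then show "\<forall>p\<in>points M. m * \<sigma> p \<le> S p" using p1(2) by fastforce
  qed
qed

end
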